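(* Consider the Markov chain $X=(Q,LI)$ on the state space $\mathcal A$ describing the parallel-server system under the Persistent-Idle (PI) policy with batch arrivals and random service capacities. Assume $\lambda<\sum_{i=1}^n\mu_i$. Then: (i) $X$ is positive recurrent. Consequently, (ii) $X$ has a unique stationary distribution, denoted by $\pi_X$, and (iii) for any initial state $\alpha\in\mathcal A$ and any $B\subset\mathcal A$, $\mathbb P_\alpha(X(t)\in B)\to\pi_X(B)$ as $t\to\infty$.
   Context: **Primitives.** There are $n$ servers; $[n]=\{1,\dots,n\}$, $\mathbb N=\{0,1,2,\dots\}$, $[x]^+=\max\{x,0\}$. The arrivals $\{a(t)\}_{t\ge1}$ are i.i.d. $\mathbb N$-valued random variables with $\mathbb P(a(1)=0)>0$, finite mean $\lambda$ and finite standard deviation $\sigma_a$. For each $i\in[n]$, the service capacities $\{s_i(t)\}_{t\ge1}$ are i.i.d. integer-valued random variables with $1\le s_i(t)\le s_{max}$ for a constant $s_{max}\in\mathbb N$, and with mean $\mu_i$ and standard deviation $\sigma_{s_i}$. The sequences $\{a(t)\},\{s_1(t)\},\dots,\{s_n(t)\}$ are mutually independent and independent of the initial condition $X(0)$. **Chain.** $X(t)=(Q(t),LI(t))$ with $Q(t)=(Q_1(t),\dots,Q_n(t))\in\mathbb N^n$ (queue lengths at the end of slot $t$) and $LI(t)\in[n]$ (the Last-Idle server, to which all jobs arriving in slot $t$ are sent). Let $I(t)=\{i:Q_i(t)=0\}$. For $t>0$, $$Q_i(t)=[Q_i(t-1)+a(t)\mathbf 1_{\{LI(t)=i\}}-s_i(t)]^+,\qquad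 LI(t)=\begin{cases}LI(t-1),&|I(t-1)|=0,\\ \xi_t,&\text{otherwise,}\end{cases}$$ where the conditional distribution of $\xi_t$ given $(X(0),\dots,X(t-1),a(t),s_1(t),\dots,s_n(t))$ is uniform on $I(t-1)$ on the event $\{|I(t-1)|>0\}$, and $\xi_t=1$ on $\{|I(t-1)|=0\}$. For each $t\geq 1$, $(a(t),s_1(t),\dots,s_n(t))$ is independent of $X(0)$, $(a(u),s_1(u),\dots,s_n(u))_{u<t}$ and $(\xi_u)_{u\le t}$ jointly. **State space.** $\mathcal A\subset\mathbb N^n\times[n]$ is the set of all states $\alpha=(\alpha_1,\dots,\alpha_n,l)$ (queue lengths $\alpha_i$, Last-Idle server $l$) that can be reached with positive probability from any of the states $(0,\dots,0,i)$, $i\in[n]$. It is assumed that $X(0)\in\mathcal A$ almost surely; then $X$ is an irreducible, aperiodic, homogeneous Markov chain on $\mathcal A$. $\mathbb P_\alpha(\cdot)=\mathbb P(\cdot\mid X(0)=\alpha)$. *)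

theory Defs
  imports "HOL-Probability.Probability"
begin

section \<open>Discrete-time Markov chains on a countable type\<close>

abbreviation path_space :: "(nat \<Rightarrow> 'x) measure" where
  "path_space \<equiv> PiM UNIV (\<lambda>_. count_space UNIV)"

definition markov_step :: "('x \<Rightarrow> 'x pmf) \<Rightarrow> 'x \<Rightarrow> nat \<Rightarrow> (nat \<Rightarrow> 'x) \<Rightarrow> 'x measure" where
  "markov_step K x t \<omega> = measure_pmf (case t of 0 \<Rightarrow> return_pmf x | Suc u \<Rightarrow> K (\<omega> u))"

text \<open>
  The law on path space of the homogeneous Markov chain with kernel \<open>K\<close> started at \<open>x\<close>
  (Ionescu Tulcea); its finite-dimensional distributions are computed in
  \<open>markov_law_cylinder\<close> below.
\<close>
definition markov_law :: "('x \<Rightarrow> 'x pmf) \<Rightarrow> 'x \<Rightarrow> (nat \<Rightarrow> 'x) measure" where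
  "markov_law K x =
     projective_family.lim UNIV
       (Ionescu_Tulcea.CI (markov_step K x) (\<lambda>_. count_space UNIV))
       (\<lambda>_. count_space UNIV)"

text \<open>
  The law \<open>P(X \<in> \<cdot> | X 0 = x)\<close> of the path of a chain \<open>X\<close> with kernel \<open>K\<close> on the probability
  space \<open>M\<close>. If \<open>X 0\<close> does not charge \<open>x\<close>, the elementary conditional probability is
  undefined and, as usual for Markov chains, the law of the chain with the same kernel started
  at \<open>x\<close> is meant.
\<close>
definition started_law ::
    "'w measure \<Rightarrow> (nat \<Rightarrow> 'w \<Rightarrow> 'x) \<Rightarrow> ('x \<Rightarrow> 'x pmf) \<Rightarrow> 'x \<Rightarrow> (nat \<Rightarrow> 'x) measure" where
  "started_law M X K x =
     (if measure M {\<omega> \<in> space M. X 0 \<omega> = x} > 0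
      then distr (uniform_measure M {\<omega> \<in> space M. X 0 \<omega> = x}) path_space (\<lambda>\<omega> t. X t \<omega>)
      else markov_law K x)"

text \<open>First return time; infinite if there is no return.\<close>
definition return_time :: "'x \<Rightarrow> (nat \<Rightarrow> 'x) \<Rightarrow> ennreal" where
  "return_time x \<omega> = (INF t\<in>{t. 1 \<le> t \<and> \<omega> t = x}. of_nat t)"

text \<open>\<open>P x\<close> is the law of the chain started at \<open>x\<close>.\<close>
definition positive_recurrent :: "('x \<Rightarrow> (nat \<Rightarrow> 'x) measure) \<Rightarrow> 'x set \<Rightarrow> bool" where
  "positive_recurrent P A \<longleftrightarrow> (\<forall>x\<in>A. (\<integral>\<^sup>+\<omega>. return_time x \<omega> \<partial>P x) < \<infinity>)"

definition stationary :: "('x \<Rightarrow> 'x pmf) \<Rightarrow> 'x set \<Rightarrow> 'x pmf \<Rightarrow> bool" where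
  "stationary K A \<pi> \<longleftrightarrow> set_pmf \<pi> \<subseteq> A \<and> bind_pmf \<pi> K = \<pi>"

text \<open>Independence of two random variables whose values may have different types
  (\<open>indep_var\<close> requires equal types).\<close>
definition indep_rv ::
    "'w measure \<Rightarrow> 'x measure \<Rightarrow> ('w \<Rightarrow> 'x) \<Rightarrow> 'y measure \<Rightarrow> ('w \<Rightarrow> 'y) \<Rightarrow> bool" where
  "indep_rv M MX X MY Y \<longleftrightarrow>
     X \<in> measurable M MX \<and> Y \<in> measurable M MY \<and>
     prob_space.indep_set M (sets (vimage_algebra (space M) X MX))
       (sets (vimage_algebra (space M) Y MY))"


section \<open>The Persistent-Idle policy\<close>

text \<open>
  The servers are the elements of the finite type \<open>'n\<close>. A state consists of the vector of
  queue lengths and the Last-Idle server.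
\<close>
type_synonym 'n state = "('n \<Rightarrow> nat) \<times> 'n"

definition idle :: "'n state \<Rightarrow> 'n set" where
  "idle x = {i. fst x i = 0}"

text \<open>Truncated subtraction on \<open>nat\<close> is the positive part \<open>[\<cdot>]\<^sup>+\<close>.\<close>
definition next_queues :: "('n \<Rightarrow> nat) \<Rightarrow> nat \<Rightarrow> ('n \<Rightarrow> nat) \<Rightarrow> 'n \<Rightarrow> 'n \<Rightarrow> nat" where
  "next_queues q av sv l = (\<lambda>i. q i + (if l = i then av else 0) - sv i)"

text \<open>
  The jobs arriving in a slot are routed to the Last-Idle server of the same slot, which is
  determined by the idle servers at the end of the previous slot.
\<close>
definition PI_kernel :: "nat pmf \<Rightarrow> ('n::finite \<Rightarrow> nat pmf) \<Rightarrow> 'n state \<Rightarrow> 'n state pmf" where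
  "PI_kernel arr serv x =
     do { l \<leftarrow> (if idle x = {} then return_pmf (snd x) else pmf_of_set (idle x));
          av \<leftarrow> arr;
          sv \<leftarrow> Pi_pmf UNIV 0 serv;
          return_pmf (next_queues (fst x) av sv l, l) }"

text \<open>
  States reachable from an empty system. All servers of an empty system are idle, so the
  first step from \<open>(\<lambda>_. 0, i)\<close> has the same law for every \<open>i\<close>, and quantifying
  existentially over \<open>i\<close> is the same as quantifying universally.
\<close>
definition PI_states :: "nat pmf \<Rightarrow> ('n::finite \<Rightarrow> nat pmf) \<Rightarrow> 'n state set" where
  "PI_states arr serv =
     {\<alpha>. \<exists>i t. measure (markov_law (PI_kernel arr serv) (\<lambda>_. 0, i))
                 {\<omega> \<in> space path_space. \<omega> t = \<alpha>} > 0}"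

text \<open>
  Here \<open>arr\<close> and \<open>serv i\<close> are the common laws of the arrivals and of the service capacities of
  server \<open>i\<close>. The server \<open>i1\<close> plays the role of server 1 in the convention that fixes
  \<open>\<xi> t\<close> when no server is idle.
\<close>
locale persistent_idle = prob_space M for M :: "'w measure" +
  fixes arr :: "nat pmf" and serv :: "'n::finite \<Rightarrow> nat pmf" and smax :: nat and i1 :: 'n
    and a :: "nat \<Rightarrow> 'w \<Rightarrow> nat" and s :: "'n \<Rightarrow> nat \<Rightarrow> 'w \<Rightarrow> nat"
    and \<xi> :: "nat \<Rightarrow> 'w \<Rightarrow> 'n" and X :: "nat \<Rightarrow> 'w \<Rightarrow> 'n state"
  assumes arr_zero: "pmf arr 0 > 0"
    and arr_mean: "integrable (measure_pmf arr) (\<lambda>k. real k)"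
    and arr_variance: "integrable (measure_pmf arr) (\<lambda>k. (real k)\<^sup>2)"
    and serv_bounds: "\<And>i. set_pmf (serv i) \<subseteq> {1..smax}"
    and law_a: "\<And>t. 1 \<le> t \<Longrightarrow> distr M (count_space UNIV) (a t) = measure_pmf arr"
    and law_s: "\<And>i t. 1 \<le> t \<Longrightarrow> distr M (count_space UNIV) (s i t) = measure_pmf (serv i)"
    \<comment> \<open>\<open>None\<close> indexes the arrival sequence, \<open>Some i\<close> the service sequence of server \<open>i\<close>\<close>
    and indep_primitives:
      "indep_vars (\<lambda>_. count_space UNIV)
         (\<lambda>(c, t). case c of None \<Rightarrow> a t | Some i \<Rightarrow> s i t) (UNIV \<times> {1..})"
    and indep_initial:
      "indep_rv M (count_space UNIV) (X 0)
         (PiM (UNIV \<times> {1..}) (\<lambda>_. count_space UNIV))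
         (\<lambda>\<omega>. \<lambda>(c, t)\<in>UNIV \<times> {1..}. case c of None \<Rightarrow> a t \<omega> | Some i \<Rightarrow> s i t \<omega>)"
    and indep_slot:
      "\<And>t. 1 \<le> t \<Longrightarrow>
         indep_rv M (count_space UNIV) (\<lambda>\<omega>. (a t \<omega>, \<lambda>i. s i t \<omega>))
           (count_space UNIV)
           (\<lambda>\<omega>. (X 0 \<omega>, map (\<lambda>u. (a u \<omega>, \<lambda>i. s i u \<omega>)) [1..<t], map (\<lambda>u. \<xi> u \<omega>) [1..<Suc t]))"
    and initial_state: "AE \<omega> in M. X 0 \<omega> \<in> PI_states arr serv"
    and recursion:
      "\<And>t \<omega>. 1 \<le> t \<Longrightarrow> \<omega> \<in> space M \<Longrightarrow>
         X t \<omega> = (let x = X (t - 1) \<omega>; l = (if idle x = {} then snd x else \<xi> t \<omega>)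
                  in (next_queues (fst x) (a t \<omega>) (\<lambda>i. s i t \<omega>) l, l))"
    and xi_uniform:
      "\<And>t xs av sv j.
         1 \<le> t \<Longrightarrow> idle (last xs) \<noteq> {} \<Longrightarrow>
         \<P>(\<omega> in M. (map (\<lambda>u. X u \<omega>) [0..<t], a t \<omega>, \<lambda>i. s i t \<omega>) = (xs, av, sv)) > 0 \<Longrightarrow>
         \<P>(\<omega> in M. \<xi> t \<omega> = j \<bar>
              (map (\<lambda>u. X u \<omega>) [0..<t], a t \<omega>, \<lambda>i. s i t \<omega>) = (xs, av, sv))
           = pmf (pmf_of_set (idle (last xs))) j"
    and xi_default:
      "\<And>t \<omega>. 1 \<le> t \<Longrightarrow> \<omega> \<in> space M \<Longrightarrow> idle (X (t - 1) \<omega>) = {} \<Longrightarrow> \<xi> t \<omega> = i1"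


section \<open>Finite-dimensional distributions of the canonical chain\<close>

lemma Ionescu_Tulcea_markov_step:
  "Ionescu_Tulcea (markov_step K x) (\<lambda>_. count_space UNIV)"
proof (rule Ionescu_Tulcea.intro)
  fix i :: nat
  show "markov_step K x i \<in> measurable (PiM {0..<i} (\<lambda>_. count_space UNIV))
          (subprob_algebra (count_space UNIV))"
  proof (cases i)
    case 0
    have "markov_step K x i = (\<lambda>_. measure_pmf (return_pmf x))"
      using 0 by (simp add: markov_step_def fun_eq_iff)
    then show ?thesis
      by (simp add: measure_pmf_in_subprob_algebra)
  next
    case (Suc u)
    have K: "(\<lambda>y. measure_pmf (K y)) \<in> measurable (count_space UNIV) (subprob_algebra (count_space UNIV))"
      by (auto intro!: measure_pmf_in_subprob_algebra)
    have c: "(\<lambda>\<omega>. \<omega> u) \<in> measurable (PiM {0..<i} (\<lambda>_. count_space UNIV)) (count_space UNIV)"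
      using Suc by (intro measurable_component_singleton) auto
    show ?thesis
      using measurable_compose[OF c K] Suc by (simp add: markov_step_def[abs_def])
  qed
qed (simp add: markov_step_def measure_pmf.prob_space_axioms)

lemma markov_law_cylinder:
  "emeasure (markov_law K x) {\<omega> \<in> space path_space. \<forall>i\<le>n. \<omega> i = xs i} =
     (if xs 0 = x then \<Prod>i<n. ennreal (pmf (K (xs i)) (xs (Suc i))) else 0)"
proof -
  let ?N = "\<lambda>_::nat. count_space UNIV"
  interpret IT: Ionescu_Tulcea "markov_step K x" ?N
    by (rule Ionescu_Tulcea_markov_step)
  define S where "S m = {f \<in> space (PiM {0..<m} ?N). \<forall>i<m. f i = xs i}" for m
  define u where "u = (\<lambda>_::nat. undefined :: 'a)"
  have S_eq: "S m = (\<Pi>\<^sub>E i\<in>{0..<m}. {xs i})" for m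
    by (auto simp: S_def space_PiM PiE_iff extensional_def)
  have S_sets [measurable]: "S m \<in> sets (PiM {0..<m} ?N)" for m
    unfolding S_eq by (rule sets_PiM_I_finite) auto
  have u: "u \<in> space (PiM {0..<0} ?N)"
    by (simp add: u_def space_PiM)
  have C: "emeasure (IT.C 0 m u) (S m) = (\<Prod>t<m. ennreal (pmf (case t of 0 \<Rightarrow> return_pmf x | Suc v \<Rightarrow> K (xs v)) (xs t)))" for m
  proof (induction m)
    case 0
    have "u \<in> S 0" using u by (simp add: S_def)
    moreover have "S 0 \<in> sets (PiM {0..<0} ?N)" by (rule S_sets)
    ultimately show ?case by (simp add: emeasure_return)
  next
    case (Suc m)
    let ?c = "ennreal (pmf (case m of 0 \<Rightarrow> return_pmf x | Suc v \<Rightarrow> K (xs v)) (xs m))"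
    have sp: "space (IT.C 0 m u) = space (PiM {0..<m} ?N)"
      using IT.space_C[OF u, of m] by simp
    have st: "sets (IT.C 0 m u) = sets (PiM {0..<m} ?N)"
      using IT.sets_C[OF u, of m] by simp
    have ne: "space (IT.C 0 m u) \<noteq> {}"
      unfolding sp by (simp add: space_PiM PiE_eq_empty_iff)
    have m: "IT.eP m \<in> measurable (IT.C 0 m u) (subprob_algebra (PiM {0..<Suc m} ?N))"
      using IT.measurable_eP[of m] by (simp cong: measurable_cong_sets add: st)
    have e: "emeasure (IT.eP m y) (S (Suc m)) = ?c * indicator (S m) y"
      if y: "y \<in> space (PiM {0..<m} ?N)" for y
    proof -
      have "emeasure (IT.eP m y) (S (Suc m)) = emeasure (markov_step K x m y) ((\<lambda>z. y(m := z)) -` S (Suc m))"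
        using IT.emeasure_eP[OF y S_sets[of "Suc m"]] by simp
      also have "(\<lambda>z. y(m := z)) -` S (Suc m) = (if y \<in> S m then {xs m} else {})"
        using y by (auto simp: S_def space_PiM PiE_iff extensional_def less_Suc_eq)
      also have "emeasure (markov_step K x m y) \<dots> = ?c * indicator (S m) y"
      proof (cases "y \<in> S m")
        case True
        then have "v < m \<Longrightarrow> y v = xs v" for v by (simp add: S_def)
        then show ?thesis
          using True by (cases m) (auto simp: markov_step_def emeasure_pmf_single)
      qed simp
      finally show ?thesis .
    qed
    have "emeasure (IT.C 0 (Suc m) u) (S (Suc m)) = (\<integral>\<^sup>+y. emeasure (IT.eP m y) (S (Suc m)) \<partial>IT.C 0 m u)"
      using emeasure_bind[OF ne m S_sets[of "Suc m"]] by simp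
    also have "\<dots> = (\<integral>\<^sup>+y. ?c * indicator (S m) y \<partial>IT.C 0 m u)"
      by (rule nn_integral_cong) (simp add: e sp)
    also have "\<dots> = ?c * emeasure (IT.C 0 m u) (S m)"
      by (rule nn_integral_cmult_indicator) (simp add: st)
    finally show ?case
      by (simp add: Suc mult.commute)
  qed
  have "{\<omega> \<in> space path_space. \<forall>i\<le>n. \<omega> i = xs i} = prod_emb UNIV ?N {0..<Suc n} (S (Suc n))"
    by (auto simp: prod_emb_def S_def space_PiM PiE_iff less_Suc_eq_le)
  then have "emeasure (markov_law K x) {\<omega> \<in> space path_space. \<forall>i\<le>n. \<omega> i = xs i} =
      emeasure (IT.CI {0..<Suc n}) (S (Suc n))"
    using IT.lim[OF _ S_sets[of "Suc n"]] by (simp add: markov_law_def)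
  also have "\<dots> = emeasure (IT.C 0 (Suc n) u) (S (Suc n))"
    using IT.emeasure_CI[OF _ S_sets[of "Suc n"], of "Suc n"]
    by (simp add: u_def prod_emb_id[OF sets.sets_into_space[OF S_sets, unfolded space_PiM]] del: IT.C.simps)
  also have "\<dots> = (if xs 0 = x then \<Prod>i<n. ennreal (pmf (K (xs i)) (xs (Suc i))) else 0)"
    unfolding C by (auto simp: prod.lessThan_Suc_shift pmf_return simp del: prod.lessThan_Suc)
  finally show ?thesis .
qed

end

theory Submission
  imports Defs
begin

text \<open>
  In one slot the total queue length changes on average by \<open>\<lambda> - \<Sum>i. \<mu> i\<close> plus the expected
  wasted service, that is, the part of the service capacity that finds no jobs. So stability is
  a question about waste, and waste is not small at every large state: while one server has a
  huge queue, others may be idle for a long time. What saves the policy is that the servers with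
  long queues get no arrivals as long as jobs circulate among the others.

  Fix a set \<open>J\<close> of servers and pretend that the others are never idle; then only
  idleness inside \<open>J\<close> redirects the arrivals. The claim is that, from every initial state, the
  servers in \<open>J\<close> waste in the long run at most \<open>max 0 (\<mu>(J) - \<lambda>)\<close> per slot, with
  \<open>\<mu>(J) = \<Sum>i\<in>J. \<mu> i\<close>. In the form used here (\<open>waste_potential_exists\<close>): for every \<open>\<epsilon> > 0\<close>
  there is a bounded potential \<open>h\<close> with
  \<open>E (waste + h(next state)) \<le> h(state) + max 0 (\<mu>(J) - \<lambda>) + \<epsilon>\<close> at all states. The proof is by
  induction on \<open>J\<close>.

  \<^item> If some server \<open>i\<in>J\<close> has more than \<open>smax\<close> jobs, it is not idle and wastes nothing, so in this
  slot \<open>J\<close> behaves like \<open>J - {i}\<close>, for which a potential exists. Averaging these potentials with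
  the weights \<open>q i / \<Sum>j\<in>J. q j\<close>, which change slowly when the total is large, gives a potential
  that works wherever the total in \<open>J\<close> is large (\<open>patch_potentials\<close>).

  \<^item> Where the total \<open>T\<close> in \<open>J\<close> is small, a correction is added. If \<open>\<lambda> \<le> \<mu>(J)\<close>, then \<open>T + h\<close> has
  drift at most \<open>\<epsilon>\<close> far out, and replacing it by \<open>sqrt ((T + h)\<^sup>2 + B\<^sup>2)\<close> with large \<open>B\<close> makes
  the drift small everywhere; this uses the second moment of the arrivals. If \<open>\<lambda> > \<mu>(J)\<close>, then
  \<open>T\<close> drifts upwards wherever it is, the states with small \<open>T\<close> are transient, and a multiple of
  \<open>exp (- \<theta> T)\<close> pays for the visits to them.

  \<^item> Both corrections need the arrivals to be sent into \<open>J\<close>. If they are not, then no server of \<open>J\<close> is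
  idle, and this ends with the first waste in \<open>J\<close> at the latest; a constant covers it.

  For \<open>J\<close> the set of all servers, the averaging step gives even more. Removing one server lowers
  \<open>\<mu>(J)\<close> by at least \<open>1\<close>, so at large totals the waste is too small to cancel
  \<open>\<lambda> - \<Sum>i. \<mu> i < 0\<close>, and \<open>G = T + h\<close> has drift at most \<open>- \<delta>\<close> there. Hence \<open>G\<^sup>2\<close> has drift at most
  \<open>- \<delta> G + const\<close>. The square is taken because this bound can be added for two independent copies
  of the chain, so that the sum of the two squares is a Lyapunov function for the pair.

  Since an empty system is reached from every state and every admissible state is reached from
  an empty system, the Foster criterion (\<open>foster_suminf_avoid_finite\<close>) shows that return times
  have finite mean and that two independent copies meet in finite mean time. The first fact
  yields a stationary law, by counting visits during an excursion; the second yields convergence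
  to it, and uniqueness.

  What remains is to see that the process built from the primitives is a Markov chain with this
  kernel: the inputs of a slot are independent of the past, and the server chosen at random is
  uniform given the past and these inputs.
\<close>

section \<open>Path laws and transition probabilities\<close>

primrec steps :: "('x \<Rightarrow> 'x pmf) \<Rightarrow> nat \<Rightarrow> 'x \<Rightarrow> 'x pmf" where
  "steps K 0 x = return_pmf x"
| "steps K (Suc n) x = bind_pmf (K x) (steps K n)"

text \<open>
  The law of the first \<open>Suc n\<close> states. Lists turn events about finitely many coordinates of a
  path into events of a discrete law, where recursion on \<open>n\<close> is available.
\<close>
primrec traj :: "('x \<Rightarrow> 'x pmf) \<Rightarrow> nat \<Rightarrow> 'x \<Rightarrow> 'x list pmf" where
  "traj K 0 x = return_pmf [x]"
| "traj K (Suc n) x = bind_pmf (K x) (\<lambda>y. map_pmf (Cons x) (traj K n y))"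

text \<open>
  The probability that the chain started at \<open>x\<close>, which may lie in \<open>D\<close>, is outside \<open>D\<close> at the
  times \<open>1, ..., n\<close>. Summing over \<open>n\<close> gives the mean of the first positive time in \<open>D\<close>.
\<close>
primrec avoid :: "('x \<Rightarrow> 'x pmf) \<Rightarrow> 'x set \<Rightarrow> nat \<Rightarrow> 'x \<Rightarrow> ennreal" where
  "avoid K D 0 x = 1"
| "avoid K D (Suc n) x = (\<integral>\<^sup>+y. indicator (- D) y * avoid K D n y \<partial>K x)"

lemma length_traj: "xs \<in> set_pmf (traj K n x) \<Longrightarrow> length xs = Suc n"
  by (induction n arbitrary: x xs) auto

lemma pmf_traj:
  "length xs = Suc n \<Longrightarrow> ennreal (pmf (traj K n x) xs) =
     (if xs ! 0 = x then \<Prod>i<n. ennreal (pmf (K (xs ! i)) (xs ! Suc i)) else 0)"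
proof (induction n arbitrary: x xs)
  case 0
  then obtain y where "xs = [y]" by (metis length_Suc_conv length_0_conv)
  then show ?case by (simp add: pmf_return)
next
  case (Suc n)
  then obtain y ys where xs: "xs = y # ys" and ys: "length ys = Suc n"
    by (metis length_Suc_conv)
  let ?c = "\<Prod>i<n. ennreal (pmf (K (ys ! i)) (ys ! Suc i))"
  have 1: "ennreal (pmf (map_pmf (Cons x) (traj K n z)) (y # ys)) =
     (if y = x then ?c * indicator {ys ! 0} z else 0)" for z
  proof (cases "y = x")
    case True
    then have "pmf (map_pmf (Cons x) (traj K n z)) (y # ys) = pmf (traj K n z) ys"
      using pmf_map_inj'[of "Cons x" "traj K n z" ys] by (simp add: inj_def)
    then show ?thesis using Suc.IH[OF ys, of z] True by (auto simp: indicator_def)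
  next
    case False
    then have "y # ys \<notin> set_pmf (map_pmf (Cons x) (traj K n z))" by auto
    then have "pmf (map_pmf (Cons x) (traj K n z)) (y # ys) = 0"
      using set_pmf_iff by metis
    then show ?thesis using False by simp
  qed
  have "ennreal (pmf (traj K (Suc n) x) xs) =
      (\<integral>\<^sup>+z. (if y = x then ?c * indicator {ys ! 0} z else 0) \<partial>K x)"
    by (simp add: ennreal_pmf_bind xs 1)
  also have "\<dots> = (if y = x then ?c * ennreal (pmf (K x) (ys ! 0)) else 0)"
    by (simp add: nn_integral_cmult_indicator emeasure_pmf_single)
  also have "\<dots> = (if xs ! 0 = x then \<Prod>i<Suc n. ennreal (pmf (K (xs ! i)) (xs ! Suc i)) else 0)"
    by (simp add: xs prod.lessThan_Suc_shift mult.commute del: prod.lessThan_Suc)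
  finally show ?case .
qed

text \<open>
  A law is determined on path space by its cylinders, so this is the only information about
  the started chain that is passed on to the theory of the kernel.
\<close>
definition path_law :: "('x \<Rightarrow> 'x pmf) \<Rightarrow> 'x \<Rightarrow> (nat \<Rightarrow> 'x) measure \<Rightarrow> bool" where
  "path_law K x Q \<longleftrightarrow> sets Q = sets path_space \<and>
     (\<forall>n xs. emeasure Q {\<omega> \<in> space path_space. \<forall>i\<le>n. \<omega> i = xs i} =
        (if xs 0 = x then \<Prod>i<n. ennreal (pmf (K (xs i)) (xs (Suc i))) else 0))"

lemma path_law_markov_law: "path_law K x (markov_law K x)"
proof -
  interpret IT: Ionescu_Tulcea "markov_step K x" "\<lambda>_. count_space UNIV"
    by (rule Ionescu_Tulcea_markov_step)
  have "sets (markov_law K x) = sets path_space"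
    unfolding markov_law_def by simp
  then show ?thesis
    unfolding path_law_def using markov_law_cylinder[of K x] by blast
qed

lemma map_upt_eq_iff: "map f [0..<n] = xs \<longleftrightarrow> length xs = n \<and> (\<forall>i<n. f i = xs ! i)"
  by (subst list_eq_iff_nth_eq) auto

lemma measurable_prefix:
  assumes "sets Q = sets (path_space :: (nat \<Rightarrow> 'x::countable) measure)"
  shows "(\<lambda>\<omega>. map \<omega> [0..<n]) \<in> measurable Q (count_space UNIV)"
proof -
  have "(\<lambda>\<omega>. map \<omega> [0..<n]) \<in> measurable (path_space :: (nat \<Rightarrow> 'x) measure) (count_space UNIV)"
  proof (rule measurable_count_space_eq2_countable[THEN iffD2, OF _ ], safe)
    fix xs :: "'x list"
    have "{\<omega> \<in> space (path_space :: (nat \<Rightarrow> 'x) measure). length xs = n \<and> (\<forall>i<n. \<omega> i = xs ! i)} \<in> sets path_space"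
      by measurable
    also have "{\<omega> \<in> space (path_space :: (nat \<Rightarrow> 'x) measure). length xs = n \<and> (\<forall>i<n. \<omega> i = xs ! i)}
       = (\<lambda>\<omega>. map \<omega> [0..<n]) -` {xs} \<inter> space path_space"
      unfolding vimage_def Int_def singleton_iff map_upt_eq_iff by auto
    finally show "(\<lambda>\<omega>. map \<omega> [0..<n]) -` {xs} \<inter> space path_space \<in> sets (path_space :: (nat \<Rightarrow> 'x) measure)" .
  qed auto
  then show ?thesis using assms by (simp cong: measurable_cong_sets)
qed

text \<open>
  Both sides are discrete, so it suffices to compare lists of states, and the preimage of a
  list is a cylinder.
\<close>
lemma distr_prefix_path_law:
  fixes K :: "'x::countable \<Rightarrow> 'x pmf"
  assumes Q: "path_law K x Q"
  shows "distr Q (count_space UNIV) (\<lambda>\<omega>. map \<omega> [0..<Suc n]) = measure_pmf (traj K n x)"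
proof (rule measure_eqI_countable[of _ UNIV])
  have s: "sets Q = sets path_space" using Q by (simp add: path_law_def)
  have sp: "space Q = space path_space" using s by (rule sets_eq_imp_space_eq)
  fix xs :: "'x list"
  have "emeasure (distr Q (count_space UNIV) (\<lambda>\<omega>. map \<omega> [0..<Suc n])) {xs}
      = emeasure Q ((\<lambda>\<omega>. map \<omega> [0..<Suc n]) -` {xs} \<inter> space Q)"
    by (rule emeasure_distr[OF measurable_prefix[OF s]]) simp
  also have "\<dots> = emeasure (measure_pmf (traj K n x)) {xs}"
  proof (cases "length xs = Suc n")
    case True
    have "(\<lambda>\<omega>. map \<omega> [0..<Suc n]) -` {xs} \<inter> space Q = {\<omega> \<in> space path_space. \<forall>i\<le>n. \<omega> i = xs ! i}"
      unfolding sp vimage_def Int_def singleton_iff map_upt_eq_iff using True by (auto simp: less_Suc_eq_le)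
    then show ?thesis
      using Q pmf_traj[OF True, of K x] by (simp add: path_law_def emeasure_pmf_single)
  next
    case False
    then have "(\<lambda>\<omega>. map \<omega> [0..<Suc n]) -` {xs} \<inter> space Q = {}" by auto
    moreover have "pmf (traj K n x) xs = 0"
      using length_traj[of xs K n x] False by (auto simp: set_pmf_iff)
    ultimately show ?thesis by (simp add: emeasure_pmf_single)
  qed
  finally show "emeasure (distr Q (count_space UNIV) (\<lambda>\<omega>. map \<omega> [0..<Suc n])) {xs} =
    emeasure (measure_pmf (traj K n x)) {xs}" .
qed auto

lemma emeasure_path_law:
  fixes K :: "'x::countable \<Rightarrow> 'x pmf"
  assumes Q: "path_law K x Q"
  shows "emeasure Q {\<omega> \<in> space Q. map \<omega> [0..<Suc n] \<in> S} = emeasure (traj K n x) S"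
proof -
  have s: "sets Q = sets path_space" using Q by (simp add: path_law_def)
  have "emeasure (distr Q (count_space UNIV) (\<lambda>\<omega>. map \<omega> [0..<Suc n])) S
      = emeasure Q ((\<lambda>\<omega>. map \<omega> [0..<Suc n]) -` S \<inter> space Q)"
    by (rule emeasure_distr[OF measurable_prefix[OF s]]) simp
  then show ?thesis
    unfolding distr_prefix_path_law[OF Q]
    by (simp add: vimage_def Int_def conj_commute del: upt_Suc)
qed

lemma map_last_traj: "map_pmf last (traj K n x) = steps K n x"
proof (induction n arbitrary: x)
  case (Suc n)
  have "map_pmf last (map_pmf (Cons x) (traj K n y)) = steps K n y" for y
    unfolding pmf.map_comp Suc[symmetric]
    by (rule map_pmf_cong[OF refl]) (use length_traj in fastforce)
  then show ?case by (simp add: map_bind_pmf)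
qed simp

lemma emeasure_path_law_at:
  fixes K :: "'x::countable \<Rightarrow> 'x pmf"
  assumes Q: "path_law K x Q"
  shows "emeasure Q {\<omega> \<in> space Q. \<omega> n \<in> B} = emeasure (steps K n x) B"
proof -
  have "{\<omega> \<in> space Q. \<omega> n \<in> B} = {\<omega> \<in> space Q. map \<omega> [0..<Suc n] \<in> last -` B}"
    by simp
  also have "emeasure Q \<dots> = emeasure (traj K n x) (last -` B)"
    by (rule emeasure_path_law[OF Q])
  also have "\<dots> = emeasure (steps K n x) B"
    unfolding map_last_traj[symmetric] by simp
  finally show ?thesis .
qed

lemma emeasure_traj_avoid:
  "emeasure (traj K n x) {xs. set (tl xs) \<inter> D = {}} = avoid K D n x"
proof (induction n arbitrary: x)
  case (Suc n)
  have "emeasure (map_pmf (Cons x) (traj K n y)) {xs. set (tl xs) \<inter> D = {}} =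
     indicator (- D) y * avoid K D n y" for y
  proof -
    have hd: "xs \<in> set_pmf (traj K n y) \<Longrightarrow> xs = y # tl xs" for xs
      by (cases n) auto
    have "emeasure (map_pmf (Cons x) (traj K n y)) {xs. set (tl xs) \<inter> D = {}}
      = emeasure (traj K n y) {xs. set xs \<inter> D = {}}"
      by (simp add: vimage_def)
    also have "\<dots> = (\<integral>\<^sup>+xs. indicator {xs. set xs \<inter> D = {}} xs \<partial>traj K n y)"
      by (simp add: nn_integral_indicator)
    also have "\<dots> = (\<integral>\<^sup>+xs. indicator (- D) y * indicator {xs. set (tl xs) \<inter> D = {}} xs \<partial>traj K n y)"
    proof (rule nn_integral_cong_AE, rule AE_pmfI)
      fix xs assume "xs \<in> set_pmf (traj K n y)"
      from hd[OF this] obtain zs where "xs = y # zs" by blast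
      then show "indicator {xs. set xs \<inter> D = {}} xs = (indicator (- D) y * indicator {xs. set (tl xs) \<inter> D = {}} xs :: ennreal)"
        by (auto simp: indicator_def)
    qed
    also have "\<dots> = indicator (- D) y * avoid K D n y"
      by (simp add: nn_integral_cmult Suc)
    finally show ?thesis .
  qed
  then show ?case by (simp add: emeasure_bind_pmf)
qed simp

text \<open>
  The tail sum formula: a return time \<open>m\<close> exceeds exactly the \<open>m\<close> numbers \<open>n < m\<close>. If there is no
  return, both sides are infinite.
\<close>
lemma return_time_eq_suminf:
  "return_time x \<omega> = (\<Sum>n. indicator {\<omega>. \<forall>t\<in>{1..n}. \<omega> t \<noteq> x} \<omega>)"
proof (cases "\<exists>t. 1 \<le> t \<and> \<omega> t = x")
  case False
  then have "{t. 1 \<le> t \<and> \<omega> t = x} = {}" by auto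
  then have 1: "return_time x \<omega> = \<top>" by (simp only: return_time_def) simp
  have "(\<Sum>n. indicator {\<omega>. \<forall>t\<in>{1..n}. \<omega> t \<noteq> x} \<omega>) = (\<Sum>n. 1 :: ennreal)"
    using False by (intro suminf_cong) (auto simp: indicator_def)
  also have "\<dots> = \<top>" by (simp add: suminf_eq_SUP ennreal_SUP_of_nat_eq_top)
  finally show ?thesis using 1 by simp
next
  case True
  define m where "m = (LEAST t. 1 \<le> t \<and> \<omega> t = x)"
  have m: "1 \<le> m" "\<omega> m = x" using LeastI_ex[OF True] by (auto simp: m_def)
  have least: "1 \<le> t \<Longrightarrow> \<omega> t = x \<Longrightarrow> m \<le> t" for t
    unfolding m_def by (rule Least_le) simp
  have "return_time x \<omega> = of_nat m"
    unfolding return_time_def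
    by (rule antisym[OF INF_lower INF_greatest]) (use m least in auto)
  moreover have "(\<Sum>n. indicator {\<omega>. \<forall>t\<in>{1..n}. \<omega> t \<noteq> x} \<omega>) = (\<Sum>n<m. 1 :: ennreal)"
  proof (subst suminf_finite[of "{..<m}"])
    fix n assume "n \<notin> {..<m}"
    then have "m \<in> {1..n}" using m by simp
    then show "indicator {\<omega>. \<forall>t\<in>{1..n}. \<omega> t \<noteq> x} \<omega> = (0::ennreal)" using m by (auto simp: indicator_def)
  next
    show "(\<Sum>n<m. indicator {\<omega>. \<forall>t\<in>{1..n}. \<omega> t \<noteq> x} \<omega>) = (\<Sum>n<m. 1 :: ennreal)"
      by (rule sum.cong[OF refl]) (use least in \<open>fastforce simp: indicator_def\<close>)
  qed simp
  ultimately show ?thesis by simp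
qed

lemma nn_integral_return_time:
  fixes K :: "'x::countable \<Rightarrow> 'x pmf"
  assumes Q: "path_law K x Q"
  shows "(\<integral>\<^sup>+\<omega>. return_time y \<omega> \<partial>Q) = (\<Sum>n. avoid K {y} n x)"
proof -
  have s: "sets Q = sets path_space" using Q by (simp add: path_law_def)
  have ev: "{\<omega> \<in> space Q. \<forall>t\<in>{1..n}. \<omega> t \<noteq> y} = {\<omega> \<in> space Q. map \<omega> [0..<Suc n] \<in> {xs. set (tl xs) \<inter> {y} = {}}}" for n
  proof -
    have "tl [0..<Suc n] = [1..<Suc n]" by (simp add: upt_conv_Cons del: upt_Suc)
    then show ?thesis by (auto simp: map_tl[symmetric] simp del: upt_Suc)
  qed
  have m: "{\<omega> \<in> space Q. \<forall>t\<in>{1..n}. \<omega> t \<noteq> y} \<in> sets Q" for n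
    unfolding ev
    using measurable_sets[OF measurable_prefix[OF s, of "Suc n"], of "{xs. set (tl xs) \<inter> {y} = {}}"]
    by (simp add: vimage_def Int_def conj_commute del: upt_Suc)
  have "(\<integral>\<^sup>+\<omega>. return_time y \<omega> \<partial>Q) = (\<integral>\<^sup>+\<omega>. (\<Sum>n. indicator {\<omega> \<in> space Q. \<forall>t\<in>{1..n}. \<omega> t \<noteq> y} \<omega>) \<partial>Q)"
    unfolding return_time_eq_suminf
    by (intro nn_integral_cong suminf_cong) (auto simp: indicator_def)
  also have "\<dots> = (\<Sum>n. emeasure Q {\<omega> \<in> space Q. \<forall>t\<in>{1..n}. \<omega> t \<noteq> y})"
    using m by (subst nn_integral_suminf) (simp_all)
  also have "\<dots> = (\<Sum>n. avoid K {y} n x)"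
    unfolding ev emeasure_path_law[OF Q] emeasure_traj_avoid ..
  finally show ?thesis .
qed

section \<open>Avoidance probabilities and Lyapunov functions\<close>

lemma avoid_le_1: "avoid K D n x \<le> 1"
proof (induction n arbitrary: x)
  case (Suc n)
  have "avoid K D (Suc n) x \<le> (\<integral>\<^sup>+y. 1 \<partial>K x)"
    unfolding avoid.simps by (intro nn_integral_mono) (use Suc in \<open>auto simp: indicator_def\<close>)
  then show ?case by simp
qed simp

lemma avoid_Suc_le: "avoid K D (Suc n) x \<le> avoid K D n x"
proof (induction n arbitrary: x)
  case 0 then show ?case using avoid_le_1[of K D 1 x] by simp
next
  case (Suc n)
  show ?case
    unfolding avoid.simps(2)[of K D "Suc n" x] avoid.simps(2)[of K D n x]
    by (rule nn_integral_mono, rule mult_left_mono[OF Suc]) simp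
qed

lemma avoid_antimono: "m \<le> n \<Longrightarrow> avoid K D n x \<le> avoid K D m x"
  using decseqD[OF decseq_SucI[of "\<lambda>n. avoid K D n x", OF avoid_Suc_le]] .

text \<open>
  Being in \<open>D\<close> at time \<open>Suc n\<close> excludes having avoided \<open>D\<close> up to then; so accessibility of \<open>D\<close>
  at a positive time is enough to keep the avoidance probability below \<open>1\<close>.
\<close>
lemma avoid_plus_hit_le:
  "avoid K D (Suc n) x + emeasure (steps K (Suc n) x) D \<le> 1"
proof (induction n arbitrary: x)
  case 0
  have "avoid K D (Suc 0) x = emeasure (K x) (- D)" by simp
  moreover have "emeasure (K x) (- D) + emeasure (K x) D = emeasure (K x) (- D \<union> D)"
    by (intro plus_emeasure) auto
  ultimately show ?case by (simp add: bind_return_pmf')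
next
  case (Suc n)
  have "avoid K D (Suc (Suc n)) x + emeasure (steps K (Suc (Suc n)) x) D
    = (\<integral>\<^sup>+y. indicator (- D) y * avoid K D (Suc n) y + emeasure (steps K (Suc n) y) D \<partial>K x)"
    unfolding avoid.simps(2)[of K D "Suc n" x] steps.simps(2)[of K "Suc n" x]
    by (simp only: emeasure_bind_pmf) (rule nn_integral_add[symmetric]; simp)
  also have "\<dots> \<le> (\<integral>\<^sup>+y. 1 \<partial>K x)"
  proof (rule nn_integral_mono)
    fix y
    have "emeasure (steps K (Suc n) y) D \<le> 1" by (rule measure_pmf.emeasure_le_1)
    then show "indicator (- D) y * avoid K D (Suc n) y + emeasure (steps K (Suc n) y) D \<le> 1"
      using Suc[of y] by (simp add: indicator_def del: avoid.simps steps.simps)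
  qed
  finally show ?case by simp
qed

lemma avoid_less_1:
  assumes "0 < n" and "y \<in> set_pmf (steps K n x)" and "y \<in> D"
  shows "avoid K D n x < 1"
proof -
  obtain m where n: "n = Suc m" using assms by (cases n) auto
  have "0 < emeasure (steps K n x) D"
    using assms by (auto simp: measure_pmf.emeasure_eq_measure measure_pmf_posI)
  moreover have "avoid K D n x < \<top>"
    using avoid_le_1[of K D n x] by (metis ennreal_one_less_top order_le_less_trans)
  ultimately have "avoid K D n x < avoid K D n x + emeasure (steps K n x) D"
    using ennreal_add_left_cancel_less[of "avoid K D n x" 0] by simp
  also have "\<dots> \<le> 1" unfolding n by (rule avoid_plus_hit_le)
  finally show ?thesis .
qed

text \<open>
  If \<open>U\<close> pays one unit for each step before \<open>D\<close> is entered, it bounds the mean entrance time.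
\<close>
lemma suminf_avoid_le:
  assumes closed: "\<And>x. x \<in> A \<Longrightarrow> set_pmf (K x) \<subseteq> A"
    and U: "\<And>x. x \<in> A \<Longrightarrow> (\<integral>\<^sup>+y. indicator (- D) y * U y \<partial>K x) + 1 \<le> U x"
    and x: "x \<in> A"
  shows "(\<Sum>n. avoid K D n x) \<le> U x"
proof -
  have "(\<Sum>n<N. avoid K D n x) \<le> U x" for N
    using x
  proof (induction N arbitrary: x)
    case (Suc N)
    have "(\<Sum>n<Suc N. avoid K D n x) = 1 + (\<Sum>n<N. \<integral>\<^sup>+y. indicator (- D) y * avoid K D n y \<partial>K x)"
      by (simp add: sum.lessThan_Suc_shift del: sum.lessThan_Suc)
    also have "(\<Sum>n<N. \<integral>\<^sup>+y. indicator (- D) y * avoid K D n y \<partial>K x)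
       = (\<integral>\<^sup>+y. indicator (- D) y * (\<Sum>n<N. avoid K D n y) \<partial>K x)"
      unfolding sum_distrib_left by (rule nn_integral_sum[symmetric]) simp
    also have "\<dots> \<le> (\<integral>\<^sup>+y. indicator (- D) y * U y \<partial>K x)"
      by (rule nn_integral_mono_AE, rule AE_pmfI, rule mult_left_mono)
         (use Suc closed in auto)
    finally show ?case using U[OF Suc.prems] by (simp add: add.commute add_left_mono order_trans)
  qed simp
  then show ?thesis by (simp add: suminf_eq_SUP SUP_le_iff)
qed

text \<open>
  Foster's criterion with the target \<open>D\<close> separated from the exceptional set \<open>F\<close>. Off \<open>F\<close> the
  function \<open>V\<close> alone pays for each step. On \<open>F\<close>, the function \<open>g = (\<Sum>n<N. avoid K D n)\<close> helps:
  before \<open>D\<close> is entered it drops on average by \<open>1 - avoid K D N\<close>, because the sum telescopes, and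
  this drop is positive uniformly over the finite set \<open>F\<close>. A multiple of \<open>g\<close> thus outweighs the
  possible growth of \<open>V\<close> there, and \<open>V + \<beta> * g\<close> satisfies the hypothesis of \<open>suminf_avoid_le\<close>.
\<close>
lemma foster_suminf_avoid_finite:
  fixes V :: "'x \<Rightarrow> real"
  assumes closed: "\<And>x. x \<in> A \<Longrightarrow> set_pmf (K x) \<subseteq> A"
    and F: "finite F" and b: "0 \<le> b"
    and drift: "\<And>x. x \<in> A \<Longrightarrow>
        (\<integral>\<^sup>+y. ennreal (V y) \<partial>K x) + 1 \<le> ennreal (V x) + ennreal b * indicator F x"
    and access: "\<And>x. x \<in> A \<Longrightarrow> x \<in> F \<Longrightarrow> \<exists>n. avoid K D n x < 1"
    and x: "x \<in> A"
  shows "(\<Sum>n. avoid K D n x) < \<infinity>"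
proof -
  obtain nn where nn: "\<And>x. x \<in> A \<Longrightarrow> x \<in> F \<Longrightarrow> avoid K D (nn x) x < 1"
    using access by metis
  define N where "N = Max (insert 0 (nn ` F))"
  have N: "avoid K D N x < 1" if "x \<in> A" "x \<in> F" for x
  proof -
    have "nn x \<le> N" unfolding N_def using F that by auto
    from avoid_antimono[OF this] nn[OF that] show ?thesis by (rule order_le_less_trans)
  qed
  define p where "p = Min (insert 1 ((\<lambda>x. 1 - enn2real (avoid K D N x)) ` (F \<inter> A)))"
  have fin: "avoid K D n x < \<top>" for n x
    using avoid_le_1[of K D n x] by (metis ennreal_one_less_top order_le_less_trans)
  have p0: "0 < p"
    unfolding p_def using F N fin by (subst Min_gr_iff) (auto simp: enn2real_less_iff)
  have pF: "avoid K D N x + ennreal p \<le> 1" if "x \<in> A" "x \<in> F" for x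
  proof -
    have "p \<le> 1 - enn2real (avoid K D N x)"
      unfolding p_def using F that by (intro Min_le) auto
    then have "enn2real (avoid K D N x) + p \<le> 1" by simp
    then have "ennreal (enn2real (avoid K D N x) + p) \<le> 1" by simp
    then show ?thesis using p0 fin by (simp add: ennreal_plus)
  qed
  define g where "g x = (\<Sum>n<N. avoid K D n x)" for x
  define \<beta> where "\<beta> = b / p"
  have \<beta>: "0 \<le> \<beta>" "\<beta> * p = b" using b p0 by (auto simp: \<beta>_def)
  define U where "U x = ennreal (V x) + ennreal \<beta> * g x" for x
  have g: "(\<integral>\<^sup>+y. indicator (- D) y * g y \<partial>K x) + 1 = g x + avoid K D N x" for x
  proof -
    have "(\<integral>\<^sup>+y. indicator (- D) y * g y \<partial>K x) = (\<Sum>n<N. avoid K D (Suc n) x)"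
      unfolding g_def sum_distrib_left avoid.simps by (rule nn_integral_sum) simp
    then have "(\<integral>\<^sup>+y. indicator (- D) y * g y \<partial>K x) + 1 = (\<Sum>n<Suc N. avoid K D n x)"
      by (simp add: sum.lessThan_Suc_shift add.commute del: sum.lessThan_Suc)
    then show ?thesis by (simp add: g_def)
  qed
  have gp: "(\<integral>\<^sup>+y. indicator (- D) y * g y \<partial>K x) + ennreal p * indicator F x \<le> g x"
    if "x \<in> A" for x
  proof -
    have "avoid K D N x + ennreal p * indicator F x \<le> 1"
      using pF[OF that] avoid_le_1[of K D N x] by (auto simp: indicator_def)
    then have "(\<integral>\<^sup>+y. indicator (- D) y * g y \<partial>K x) + (avoid K D N x + ennreal p * indicator F x)
       \<le> g x + avoid K D N x"
      unfolding g[symmetric] by (rule add_left_mono)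
    then have "avoid K D N x + ((\<integral>\<^sup>+y. indicator (- D) y * g y \<partial>K x) + ennreal p * indicator F x)
       \<le> avoid K D N x + g x"
      by (simp add: ac_simps)
    then show ?thesis using fin[of N x] by (auto simp: ennreal_add_left_cancel_le)
  qed
  have "(\<integral>\<^sup>+y. indicator (- D) y * U y \<partial>K x) + 1 \<le> U x" if xA: "x \<in> A" for x
  proof -
    let ?I = "ennreal b * indicator F x"
    have "(\<integral>\<^sup>+y. indicator (- D) y * U y \<partial>K x)
       = (\<integral>\<^sup>+y. indicator (- D) y * ennreal (V y) + ennreal \<beta> * (indicator (- D) y * g y) \<partial>K x)"
      by (simp add: U_def algebra_simps)
    also have "\<dots> = (\<integral>\<^sup>+y. indicator (- D) y * ennreal (V y) \<partial>K x)
        + ennreal \<beta> * (\<integral>\<^sup>+y. indicator (- D) y * g y \<partial>K x)"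
      by (simp add: nn_integral_add nn_integral_cmult)
    also have "(\<integral>\<^sup>+y. indicator (- D) y * ennreal (V y) \<partial>K x) \<le> (\<integral>\<^sup>+y. ennreal (V y) \<partial>K x)"
      by (intro nn_integral_mono) (simp add: indicator_def)
    finally have 1: "(\<integral>\<^sup>+y. indicator (- D) y * U y \<partial>K x)
       \<le> (\<integral>\<^sup>+y. ennreal (V y) \<partial>K x) + ennreal \<beta> * (\<integral>\<^sup>+y. indicator (- D) y * g y \<partial>K x)"
      by (simp add: add_right_mono)
    have "ennreal \<beta> * ((\<integral>\<^sup>+y. indicator (- D) y * g y \<partial>K x) + ennreal p * indicator F x) \<le> ennreal \<beta> * g x"
      by (rule mult_left_mono[OF gp[OF xA]]) simp
    then have 2: "ennreal \<beta> * (\<integral>\<^sup>+y. indicator (- D) y * g y \<partial>K x) + ?I \<le> ennreal \<beta> * g x"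
      using \<beta> p0 by (simp add: distrib_left mult.assoc[symmetric] ennreal_mult[symmetric])
    have "?I + ((\<integral>\<^sup>+y. indicator (- D) y * U y \<partial>K x) + 1)
        \<le> ?I + ((\<integral>\<^sup>+y. ennreal (V y) \<partial>K x) + ennreal \<beta> * (\<integral>\<^sup>+y. indicator (- D) y * g y \<partial>K x) + 1)"
      by (intro add_left_mono add_right_mono 1)
    also have "\<dots> = ((\<integral>\<^sup>+y. ennreal (V y) \<partial>K x) + 1) + (ennreal \<beta> * (\<integral>\<^sup>+y. indicator (- D) y * g y \<partial>K x) + ?I)"
      by (simp add: ac_simps)
    also have "\<dots> \<le> (ennreal (V x) + ?I) + ennreal \<beta> * g x"
      by (intro add_mono drift[OF xA] 2)
    also have "\<dots> = ?I + U x" by (simp add: U_def ac_simps)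
    finally have "?I + ((\<integral>\<^sup>+y. indicator (- D) y * U y \<partial>K x) + 1) \<le> ?I + U x" .
    moreover have "?I \<noteq> \<infinity>" by (simp add: indicator_def)
    ultimately show ?thesis unfolding ennreal_add_left_cancel_le by blast
  qed
  from suminf_avoid_le[OF closed this x] have "(\<Sum>n. avoid K D n x) \<le> U x" .
  also have "U x < \<infinity>"
  proof -
    have "g x < \<top>" unfolding g_def using fin by (induction N) (simp_all add: less_top[symmetric])
    then show ?thesis by (simp add: U_def ennreal_mult_less_top)
  qed
  finally show ?thesis .
qed

section \<open>Stationary laws and convergence by coupling\<close>

text \<open>
  \<open>taboo K z n y\<close> is the probability of being at \<open>y\<close> at time \<open>n\<close>, started at \<open>z\<close>, without a return
  to \<open>z\<close> so far. The sum over \<open>n\<close> counts the visits to \<open>y\<close> during one excursion from \<open>z\<close>.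
\<close>
primrec taboo :: "('x \<Rightarrow> 'x pmf) \<Rightarrow> 'x \<Rightarrow> nat \<Rightarrow> 'x \<Rightarrow> ennreal" where
  "taboo K z 0 y = indicator {z} y"
| "taboo K z (Suc n) y =
     indicator (- {z}) y * (\<integral>\<^sup>+x. taboo K z n x * ennreal (pmf (K x) y) \<partial>count_space UNIV)"

lemma nn_integral_swap_kernel:
  "(\<integral>\<^sup>+y. (\<integral>\<^sup>+x. u x * ennreal (pmf (K x) y) \<partial>count_space UNIV) * f y \<partial>count_space UNIV)
   = (\<integral>\<^sup>+x. u x * (\<integral>\<^sup>+y. f y \<partial>K x) \<partial>count_space UNIV)"
proof -
  have "(\<integral>\<^sup>+y. (\<integral>\<^sup>+x. u x * ennreal (pmf (K x) y) \<partial>count_space UNIV) * f y \<partial>count_space UNIV)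
    = (\<integral>\<^sup>+y. (\<integral>\<^sup>+x. u x * ennreal (pmf (K x) y) * f y \<partial>count_space UNIV) \<partial>count_space UNIV)"
    by (intro nn_integral_cong nn_integral_multc[symmetric]) simp
  also have "\<dots> = (\<integral>\<^sup>+x. (\<integral>\<^sup>+y. u x * ennreal (pmf (K x) y) * f y \<partial>count_space UNIV) \<partial>count_space UNIV)"
    using nn_integral_fst_count_space[of "\<lambda>(x, y). u x * ennreal (pmf (K x) y) * f y"]
      nn_integral_snd_count_space[of "\<lambda>(x, y). u x * ennreal (pmf (K x) y) * f y"] by simp
  also have "\<dots> = (\<integral>\<^sup>+x. u x * (\<integral>\<^sup>+y. f y \<partial>K x) \<partial>count_space UNIV)"
    by (intro nn_integral_cong) (simp add: nn_integral_measure_pmf nn_integral_cmult mult.assoc)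
  finally show ?thesis .
qed

lemma nn_integral_taboo_0: "(\<integral>\<^sup>+y. taboo K z 0 y * f y \<partial>count_space UNIV) = f z"
proof -
  have "(\<integral>\<^sup>+y. taboo K z 0 y * f y \<partial>count_space UNIV) = (\<integral>\<^sup>+y. f z * indicator {z} y \<partial>count_space UNIV)"
    by (intro nn_integral_cong) (simp add: indicator_def)
  then show ?thesis by (simp add: nn_integral_cmult)
qed

lemma nn_integral_taboo_Suc:
  "(\<integral>\<^sup>+y. taboo K z (Suc n) y * f y \<partial>count_space UNIV)
   = (\<integral>\<^sup>+x. taboo K z n x * (\<integral>\<^sup>+y. indicator (- {z}) y * f y \<partial>K x) \<partial>count_space UNIV)"
  unfolding nn_integral_swap_kernel[symmetric] by (simp add: ac_simps)

lemma nn_integral_taboo_avoid: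
  "(\<integral>\<^sup>+y. taboo K z n y * avoid K {z} m y \<partial>count_space UNIV) = avoid K {z} (n + m) z"
proof (induction n arbitrary: m)
  case 0 then show ?case by (simp only: nn_integral_taboo_0 add_0)
next
  case (Suc n)
  show ?case using Suc[of "Suc m"] by (simp add: nn_integral_taboo_Suc del: taboo.simps)
qed

lemma avoid_tendsto_0:
  assumes "(\<Sum>n. avoid K D n x) < \<infinity>"
  shows "(\<lambda>n. enn2real (avoid K D n x)) \<longlonglongrightarrow> 0"
proof (rule summable_LIMSEQ_zero, rule summable_suminf_not_top)
  have "avoid K D n x < \<top>" for n
    using avoid_le_1[of K D n x] by (metis ennreal_one_less_top order_le_less_trans)
  then show "(\<Sum>i. ennreal (enn2real (avoid K D i x))) \<noteq> \<top>"
    using assms by simp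
qed simp

lemma taboo_eq_0:
  assumes closed: "\<And>x. x \<in> A \<Longrightarrow> set_pmf (K x) \<subseteq> A" and "z \<in> A" and "y \<notin> A"
  shows "taboo K z n y = 0"
  using \<open>y \<notin> A\<close>
proof (induction n arbitrary: y)
  case 0 then show ?case using \<open>z \<in> A\<close> by (auto simp: indicator_def)
next
  case (Suc n)
  have "taboo K z n x * ennreal (pmf (K x) y) = 0" for x
  proof (cases "x \<in> A")
    case True
    then have "y \<notin> set_pmf (K x)" using closed Suc.prems by blast
    then show ?thesis by (simp add: pmf_eq_0_set_pmf)
  qed (simp add: Suc.IH)
  then have "(\<integral>\<^sup>+x. taboo K z n x * ennreal (pmf (K x) y) \<partial>count_space UNIV) = (\<integral>\<^sup>+x. 0 \<partial>count_space (UNIV :: 'a set))"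
    by (intro nn_integral_cong)
  then show ?case by simp
qed

text \<open>
  The mean number \<open>\<nu> y\<close> of visits to \<open>y\<close> during an excursion from \<open>z\<close> is an invariant measure:
  moving all visits by one step reproduces the excursion, except that its first point
  is exchanged for its end point, and both are \<open>z\<close>. The latter uses that a return is certain, which is the
  identity \<open>h1\<close>. The total mass is the mean return time, so \<open>\<nu>\<close> can be normalised.
\<close>
lemma stationary_exists:
  fixes K :: "'x \<Rightarrow> 'x pmf"
  assumes closed: "\<And>x. x \<in> A \<Longrightarrow> set_pmf (K x) \<subseteq> A" and z: "z \<in> A"
    and fin: "(\<Sum>n. avoid K {z} n z) < \<infinity>"
  shows "\<exists>\<pi>. stationary K A \<pi>"
proof -
  define \<nu> where "\<nu> y = (\<Sum>n. taboo K z n y)" for y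
  define h where "h n = (\<integral>\<^sup>+x. taboo K z n x * ennreal (pmf (K x) z) \<partial>count_space UNIV)" for n
  have int: "(\<integral>\<^sup>+y. \<nu> y * f y \<partial>count_space UNIV) = (\<Sum>n. \<integral>\<^sup>+y. taboo K z n y * f y \<partial>count_space UNIV)" for f
    unfolding \<nu>_def ennreal_suminf_multc[symmetric] by (rule nn_integral_suminf) simp
  have avfin: "avoid K {z} n z < \<top>" for n
    using avoid_le_1[of K "{z}" n z] by (metis ennreal_one_less_top order_le_less_trans)
  \<comment> \<open>\<open>h n\<close> is the probability that the first return happens at time \<open>Suc n\<close>\<close>
  have h_avoid: "avoid K {z} (Suc n) z + h n = avoid K {z} n z" for n
  proof -
    have split: "(\<integral>\<^sup>+y. indicator (- {z}) y * 1 \<partial>K x) + ennreal (pmf (K x) z) = 1" for x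
    proof -
      have "(\<integral>\<^sup>+y. indicator (- {z}) y * 1 \<partial>K x) + ennreal (pmf (K x) z) = emeasure (K x) (- {z}) + emeasure (K x) {z}"
        by (simp add: emeasure_pmf_single)
      also have "\<dots> = emeasure (K x) (- {z} \<union> {z})" by (intro plus_emeasure) auto
      also have "- {z} \<union> {z} = space (K x)" by auto
      finally show ?thesis by (simp only: measure_pmf.emeasure_space_1)
    qed
    have "avoid K {z} (Suc n) z + h n
       = (\<integral>\<^sup>+x. taboo K z n x * (\<integral>\<^sup>+y. indicator (- {z}) y * 1 \<partial>K x) + taboo K z n x * ennreal (pmf (K x) z) \<partial>count_space UNIV)"
      using nn_integral_taboo_avoid[of K z n 1]
      by (subst nn_integral_add) (simp_all add: h_def)
    also have "\<dots> = (\<integral>\<^sup>+x. taboo K z n x * avoid K {z} 0 x \<partial>count_space UNIV)"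
      unfolding distrib_left[symmetric] split by simp
    also have "\<dots> = avoid K {z} n z" unfolding nn_integral_taboo_avoid by simp
    finally show ?thesis .
  qed
  have h_sum: "(\<Sum>n<N. h n) + avoid K {z} N z = 1" for N
  proof (induction N)
    case (Suc N)
    have "(\<Sum>n<Suc N. h n) + avoid K {z} (Suc N) z = (\<Sum>n<N. h n) + (avoid K {z} (Suc N) z + h N)"
      by (simp add: ac_simps del: avoid.simps)
    then show ?case unfolding h_avoid Suc .
  qed simp
  have h1: "(\<Sum>n. h n) = 1"
  proof -
    have "(\<lambda>N. ennreal (enn2real (avoid K {z} N z))) \<longlonglongrightarrow> ennreal 0"
      by (intro tendsto_ennrealI avoid_tendsto_0 fin)
    then have "(\<lambda>N. avoid K {z} N z) \<longlonglongrightarrow> 0" using avfin by simp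
    moreover have "(\<lambda>N. \<Sum>n<N. h n) \<longlonglongrightarrow> (\<Sum>n. h n)"
      by (rule summable_LIMSEQ) simp
    ultimately have "(\<lambda>N. (\<Sum>n<N. h n) + avoid K {z} N z) \<longlonglongrightarrow> (\<Sum>n. h n) + 0"
      by (intro tendsto_add)
    then have "(\<lambda>N::nat. 1) \<longlonglongrightarrow> (\<Sum>n. h n)" unfolding h_sum by simp
    then show ?thesis using LIMSEQ_unique[OF tendsto_const] by metis
  qed
  have inv: "(\<integral>\<^sup>+x. \<nu> x * ennreal (pmf (K x) y) \<partial>count_space UNIV) = \<nu> y" for y
  proof -
    define c where "c n = (\<integral>\<^sup>+x. taboo K z n x * ennreal (pmf (K x) y) \<partial>count_space UNIV)" for n
    have \<nu>: "\<nu> y = indicator {z} y + (\<Sum>n. indicator (- {z}) y * c n)"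
    proof -
      have "\<nu> y = (\<Sum>n. taboo K z (n + 1) y) + (\<Sum>n<1. taboo K z n y)"
        unfolding \<nu>_def by (rule suminf_offset) simp
      then show ?thesis by (simp add: c_def add.commute)
    qed
    show ?thesis
    proof (cases "y = z")
      case True
      then show ?thesis unfolding int \<nu> using h1 by (simp add: h_def)
    next
      case False
      then show ?thesis unfolding int \<nu> by (simp add: c_def)
    qed
  qed
  define c where "c = (\<integral>\<^sup>+y. \<nu> y \<partial>count_space UNIV)"
  have c: "c = (\<Sum>n. avoid K {z} n z)"
    using int[of "\<lambda>_. 1"] nn_integral_taboo_avoid[of K z _ 0] by (simp add: c_def)
  have c_fin: "c < \<top>" using fin c by simp
  have "avoid K {z} 0 z \<le> (\<Sum>n. avoid K {z} n z)"
    using sum_le_suminf[of "\<lambda>n. avoid K {z} n z" "{0}"] by simp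
  then have c0: "0 < c" unfolding c by (auto intro: less_le_trans[of 0 1])
  have \<nu>_fin: "\<nu> y < \<top>" for y
  proof -
    have "(\<integral>\<^sup>+x. \<nu> y * indicator {y} x \<partial>count_space UNIV) \<le> c"
      unfolding c_def by (intro nn_integral_mono) (simp add: indicator_def)
    then have "\<nu> y \<le> c" by (simp add: nn_integral_cmult)
    then show ?thesis using c_fin by (rule order_le_less_trans)
  qed
  define p where "p y = enn2real (\<nu> y / c)" for y
  have p: "ennreal (p y) = \<nu> y / c" for y
  proof -
    have "\<nu> y / c \<noteq> \<top>" using \<nu>_fin[of y] c0 by (auto simp: ennreal_divide_eq_top_iff)
    then show ?thesis by (simp add: p_def less_top)
  qed
  have div: "(\<integral>\<^sup>+y. \<nu> y / c * f y \<partial>count_space UNIV) = (\<integral>\<^sup>+y. \<nu> y * f y \<partial>count_space UNIV) / c" for f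
  proof -
    have "\<nu> y / c * f y = (\<nu> y * f y) / c" for y by (simp add: divide_ennreal_def ac_simps)
    then show ?thesis by (simp only:) (rule nn_integral_divide, simp)
  qed
  have p1: "(\<integral>\<^sup>+y. ennreal (p y) \<partial>count_space UNIV) = 1"
    using div[of "\<lambda>_. 1"] c0 c_fin by (simp add: p c_def ennreal_divide_self)
  define \<pi> where "\<pi> = embed_pmf p"
  have \<pi>: "pmf \<pi> y = p y" for y
    unfolding \<pi>_def by (rule pmf_embed_pmf[OF _ p1]) (simp add: p_def)
  have "set_pmf \<pi> \<subseteq> A"
  proof
    fix y assume y: "y \<in> set_pmf \<pi>"
    show "y \<in> A"
    proof (rule ccontr)
      assume "y \<notin> A"
      then have "\<nu> y = 0" unfolding \<nu>_def using taboo_eq_0[of A K z y, OF closed z] by simp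
      then have "pmf \<pi> y = 0" by (simp add: \<pi> p_def)
      then show False using y by (simp add: set_pmf_iff)
    qed
  qed
  moreover have "bind_pmf \<pi> K = \<pi>"
  proof (rule pmf_eqI)
    fix y
    have "ennreal (pmf (bind_pmf \<pi> K) y) = (\<integral>\<^sup>+x. \<nu> x / c * ennreal (pmf (K x) y) \<partial>count_space UNIV)"
      by (simp add: ennreal_pmf_bind nn_integral_measure_pmf \<pi> p)
    also have "\<dots> = ennreal (pmf \<pi> y)" unfolding div inv by (simp add: \<pi> p)
    finally show "pmf (bind_pmf \<pi> K) y = pmf \<pi> y" by simp
  qed
  ultimately show ?thesis unfolding stationary_def by blast
qed

definition pair_kernel :: "('x \<Rightarrow> 'x pmf) \<Rightarrow> 'x \<times> 'x \<Rightarrow> ('x \<times> 'x) pmf" where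
  "pair_kernel K xy = pair_pmf (K (fst xy)) (K (snd xy))"

lemma measure_bind_pmf_eq:
  "measure (bind_pmf p f) B = measure_pmf.expectation p (\<lambda>x. measure (f x) B)"
proof -
  have "ennreal (measure (bind_pmf p f) B) = (\<integral>\<^sup>+x. ennreal (measure (f x) B) \<partial>p)"
    unfolding measure_pmf.emeasure_eq_measure[symmetric] by simp
  also have "\<dots> = ennreal (measure_pmf.expectation p (\<lambda>x. measure (f x) B))"
    by (intro nn_integral_eq_integral measure_pmf.integrable_const_bound[where B=1]) auto
  finally show ?thesis by (simp add: integral_nonneg_AE)
qed

text \<open>
  Two independent copies can be glued together when they meet, so the laws at time \<open>n\<close> differ by
  at most the probability that they have not met. The recursion on \<open>n\<close> shows this without
  constructing the glued pair: on the diagonal the difference vanishes, and off the diagonal one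
  step of the independent pair is averaged.
\<close>
lemma coupling_bound:
  "\<bar>measure (steps K n x) B - measure (steps K n y) B\<bar> \<le> enn2real (avoid (pair_kernel K) Id n (x, y))"
proof (induction n arbitrary: x y)
  case 0 then show ?case by (auto simp: indicator_def)
next
  case (Suc n)
  let ?p = "\<lambda>x. measure (steps K n x) B"
  let ?P = "pair_kernel K (x, y)"
  let ?v = "\<lambda>w. indicator (- Id) w * enn2real (avoid (pair_kernel K) Id n w)"
  have av: "enn2real (avoid (pair_kernel K) Id n w) \<le> 1" "avoid (pair_kernel K) Id n w < \<top>" for w
    using avoid_le_1[of "pair_kernel K" Id n w] enn2real_leI[of 1] 
    by (auto intro: order_le_less_trans[OF _ ennreal_one_less_top])
  have int: "integrable ?P (\<lambda>w. ?p (fst w))" "integrable ?P (\<lambda>w. ?p (snd w))" "integrable ?P ?v"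
    using av by (auto intro!: measure_pmf.integrable_const_bound[where B=1] simp: indicator_def)
  have "measure (steps K (Suc n) x) B - measure (steps K (Suc n) y) B
    = measure_pmf.expectation ?P (\<lambda>w. ?p (fst w) - ?p (snd w))"
    using int expectation_pair_pmf_fst[of "K x" "K y" ?p] expectation_pair_pmf_snd[of "K x" "K y" ?p]
    by (simp add: measure_bind_pmf_eq pair_kernel_def)
  also have "\<bar>\<dots>\<bar> \<le> measure_pmf.expectation ?P (\<lambda>w. \<bar>?p (fst w) - ?p (snd w)\<bar>)"
    by (rule integral_abs_bound)
  also have "\<dots> \<le> measure_pmf.expectation ?P ?v"
  proof (rule integral_mono)
    show "integrable ?P (\<lambda>w. \<bar>?p (fst w) - ?p (snd w)\<bar>)"
      using int by (intro integrable_abs Bochner_Integration.integrable_diff)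
    show "\<bar>?p (fst w) - ?p (snd w)\<bar> \<le> ?v w" for w
      using Suc[of "fst w" "snd w"] by (cases w) (auto simp: indicator_def)
  qed (rule int)
  also have "measure_pmf.expectation ?P ?v = enn2real (ennreal (measure_pmf.expectation ?P ?v))"
    by (rule enn2real_ennreal[symmetric], rule Bochner_Integration.integral_nonneg) simp
  also have "ennreal (measure_pmf.expectation ?P ?v) = avoid (pair_kernel K) Id (Suc n) (x, y)"
  proof -
    have "ennreal (measure_pmf.expectation ?P ?v) = (\<integral>\<^sup>+w. ennreal (?v w) \<partial>?P)"
      by (rule nn_integral_eq_integral[symmetric, OF int(3)]) (simp add: indicator_def)
    also have "\<dots> = avoid (pair_kernel K) Id (Suc n) (x, y)"
      unfolding avoid.simps by (intro nn_integral_cong) (use av in \<open>auto simp: indicator_def\<close>)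
    finally show ?thesis .
  qed
  finally show ?case .
qed

lemma bind_pmf_steps_stationary:
  assumes "bind_pmf \<pi> K = \<pi>"
  shows "bind_pmf \<pi> (steps K n) = \<pi>"
proof (induction n)
  case 0 then show ?case by (simp add: bind_return_pmf')
next
  case (Suc n)
  have "steps K (Suc n) = (\<lambda>x. bind_pmf (K x) (steps K n))" by (rule ext) simp
  then have "bind_pmf \<pi> (steps K (Suc n)) = bind_pmf (bind_pmf \<pi> K) (steps K n)"
    by (simp only: bind_assoc_pmf)
  then show ?case unfolding assms Suc .
qed

text \<open>
  The stationary law is the mixture of the laws started from its own states, each of which
  merges with the law started at \<open>x\<close>; dominated convergence interchanges limit and mixture.
\<close>
lemma steps_tendsto_stationary:
  assumes coupling: "\<And>x y. x \<in> A \<Longrightarrow> y \<in> A \<Longrightarrow> (\<Sum>n. avoid (pair_kernel K) Id n (x, y)) < \<infinity>"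
    and \<pi>: "stationary K A \<pi>" and x: "x \<in> A"
  shows "(\<lambda>n. measure (steps K n x) B) \<longlonglongrightarrow> measure \<pi> B"
proof -
  let ?p = "\<lambda>n x. measure (steps K n x) B"
  let ?v = "\<lambda>n y. enn2real (avoid (pair_kernel K) Id n (x, y))"
  have sub: "set_pmf \<pi> \<subseteq> A" and inv: "bind_pmf \<pi> (steps K n) = \<pi>" for n
    using \<pi> bind_pmf_steps_stationary[of \<pi> K] by (auto simp: stationary_def)
  have v1: "?v n y \<le> 1" for n y
    using avoid_le_1[of "pair_kernel K" Id n "(x, y)"] enn2real_leI[of 1] by auto
  have int: "integrable \<pi> (?p n)" "integrable \<pi> (?v n)" for n
    using v1 by (auto intro!: measure_pmf.integrable_const_bound[where B=1])
  have bound: "\<bar>?p n x - measure \<pi> B\<bar> \<le> measure_pmf.expectation \<pi> (?v n)" for n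
  proof -
    have "measure \<pi> B = measure_pmf.expectation \<pi> (?p n)"
      unfolding measure_bind_pmf_eq[symmetric] inv ..
    then have "?p n x - measure \<pi> B = measure_pmf.expectation \<pi> (\<lambda>y. ?p n x - ?p n y)"
      using int by simp
    also have "\<bar>\<dots>\<bar> \<le> measure_pmf.expectation \<pi> (\<lambda>y. \<bar>?p n x - ?p n y\<bar>)"
      by (rule integral_abs_bound)
    also have "\<dots> \<le> measure_pmf.expectation \<pi> (?v n)"
      using int by (intro integral_mono coupling_bound) auto
    finally show ?thesis .
  qed
  have "(\<lambda>n. measure_pmf.expectation \<pi> (?v n)) \<longlonglongrightarrow> measure_pmf.expectation \<pi> (\<lambda>_. 0)"
  proof (rule integral_dominated_convergence[where w="\<lambda>_. 1"])
    show "AE y in \<pi>. (\<lambda>n. ?v n y) \<longlonglongrightarrow> 0"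
      using sub x by (intro AE_pmfI avoid_tendsto_0 coupling) auto
  qed (use v1 in auto)
  then have "(\<lambda>n. ?p n x - measure \<pi> B) \<longlonglongrightarrow> 0"
    by (intro Lim_null_comparison[of "\<lambda>n. ?p n x - measure \<pi> B" "\<lambda>n. measure_pmf.expectation \<pi> (?v n)"] always_eventually allI)
       (simp_all only: real_norm_def bound Bochner_Integration.integral_zero)
  then show ?thesis by (rule LIM_zero_cancel)
qed

lemma stationary_unique:
  assumes coupling: "\<And>x y. x \<in> A \<Longrightarrow> y \<in> A \<Longrightarrow> (\<Sum>n. avoid (pair_kernel K) Id n (x, y)) < \<infinity>"
    and \<pi>: "stationary K A \<pi>" and \<pi>': "stationary K A \<pi>'"
  shows "\<pi>' = \<pi>"
proof (rule pmf_eqI)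
  fix y
  obtain x where "x \<in> A" using \<pi> set_pmf_not_empty[of \<pi>] by (auto simp: stationary_def)
  then show "pmf \<pi>' y = pmf \<pi> y"
    using steps_tendsto_stationary[OF coupling \<pi>, of x "{y}"]
      steps_tendsto_stationary[OF coupling \<pi>', of x "{y}"]
    by (auto simp: measure_pmf_single intro: LIMSEQ_unique)
qed

section \<open>Ergodicity from a drift condition\<close>

lemma steps_add: "steps K (m + n) x = bind_pmf (steps K m x) (steps K n)"
proof (induction m arbitrary: x)
  case 0 then show ?case by (simp add: bind_return_pmf)
next
  case (Suc m)
  then have "steps K (m + n) = (\<lambda>x. bind_pmf (steps K m x) (steps K n))" by (intro ext)
  then show ?case by (simp add: bind_assoc_pmf)
qed

lemma bind_pair_pmf_pair:
  "bind_pmf (pair_pmf p q) (\<lambda>w. pair_pmf (f (fst w)) (g (snd w))) = pair_pmf (bind_pmf p f) (bind_pmf q g)"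
  unfolding pair_pmf_def bind_assoc_pmf bind_return_pmf fst_conv snd_conv
  by (subst bind_commute_pmf[of q]) (rule refl)

lemma steps_pair_kernel:
  "steps (pair_kernel K) n xy = pair_pmf (steps K n (fst xy)) (steps K n (snd xy))"
proof (induction n arbitrary: xy)
  case 0 then show ?case by (simp add: pair_return_pmf1)
next
  case (Suc n)
  then have "steps (pair_kernel K) n = (\<lambda>w. pair_pmf (steps K n (fst w)) (steps K n (snd w)))"
    by (intro ext)
  then show ?case
    by (simp only: steps.simps pair_kernel_def[of K xy] bind_pair_pmf_pair)
qed

text \<open>
  Here the drift condition has a form that can be added over independent copies, in contrast to
  the one with an exceptional set.
\<close>
lemma foster_level_sets:
  fixes V G :: "'x \<Rightarrow> real"
  assumes closed: "\<And>x. x \<in> A \<Longrightarrow> set_pmf (K x) \<subseteq> A"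
    and b: "0 \<le> b" and G: "\<And>r. finite {x. G x \<le> r}"
    and drift: "\<And>x. x \<in> A \<Longrightarrow>
        (\<integral>\<^sup>+y. ennreal (V y) \<partial>K x) + ennreal (G x) \<le> ennreal (V x) + ennreal b"
    and access: "\<And>x. x \<in> A \<Longrightarrow> \<exists>n>0. set_pmf (steps K n x) \<inter> D \<noteq> {}"
    and x: "x \<in> A"
  shows "(\<Sum>n. avoid K D n x) < \<infinity>"
proof (rule foster_suminf_avoid_finite[where A=A and V=V and F="{x. G x \<le> b + 1}" and b="b + 1"])
  fix x assume xA: "x \<in> A"
  let ?I = "\<integral>\<^sup>+y. ennreal (V y) \<partial>K x"
  show "?I + 1 \<le> ennreal (V x) + ennreal (b + 1) * indicator {x. G x \<le> b + 1} x"
  proof (cases "G x \<le> b + 1")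
    case True
    have "?I + 1 \<le> ?I + ennreal (G x) + 1" by (simp add: add_right_mono add_increasing2)
    also have "\<dots> \<le> ennreal (V x) + ennreal b + 1" by (intro add_right_mono drift xA)
    finally show ?thesis using True b by (simp add: ennreal_plus add.assoc)
  next
    case False
    have "ennreal b + (?I + 1) = ?I + ennreal (b + 1)" using b by (simp add: ennreal_plus ac_simps)
    also have "\<dots> \<le> ?I + ennreal (G x)" using False by (intro add_left_mono ennreal_leI) simp
    also have "\<dots> \<le> ennreal b + ennreal (V x)" using drift[OF xA] by (simp add: add.commute)
    finally have "?I + 1 \<le> ennreal (V x)" unfolding ennreal_add_left_cancel_le by simp
    then show ?thesis using False by simp
  qed
next
  fix x assume "x \<in> A"
  from access[OF this] obtain n y where "0 < n" "y \<in> set_pmf (steps K n x)" "y \<in> D" by blast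
  then show "\<exists>n. avoid K D n x < 1" using avoid_less_1 by metis
qed (use assms in auto)

text \<open>
  The same Lyapunov function is used twice: for the chain itself, to bound the return time to a
  state, and added up over two independent copies, to bound their meeting time. The state \<open>z\<close> must be
  reachable at all large times so that both copies can be there at once; this replaces
  aperiodicity.
\<close>
lemma ergodic_of_drift:
  fixes V G :: "'x \<Rightarrow> real"
  assumes closed: "\<And>x. x \<in> A \<Longrightarrow> set_pmf (K x) \<subseteq> A"
    and V: "\<And>x. 0 \<le> V x" and G0: "\<And>x. 0 \<le> G x"
    and b: "0 \<le> b" and G: "\<And>r. finite {x. G x \<le> r}"
    and drift: "\<And>x. x \<in> A \<Longrightarrow>
        (\<integral>\<^sup>+y. ennreal (V y) \<partial>K x) + ennreal (G x) \<le> ennreal (V x) + ennreal b"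
    and to_z: "\<And>x. x \<in> A \<Longrightarrow> \<exists>m. \<forall>n\<ge>m. z \<in> set_pmf (steps K n x)"
    and from_z: "\<And>x. x \<in> A \<Longrightarrow> \<exists>n. x \<in> set_pmf (steps K n z)"
    and z: "z \<in> A"
  shows "\<And>x. x \<in> A \<Longrightarrow> (\<Sum>n. avoid K {x} n x) < \<infinity>"
    and "\<exists>\<pi>. stationary K A \<pi> \<and> (\<forall>\<pi>'. stationary K A \<pi>' \<longrightarrow> \<pi>' = \<pi>) \<and>
      (\<forall>x\<in>A. \<forall>B. (\<lambda>n. measure (steps K n x) B) \<longlonglongrightarrow> measure \<pi> B)"
proof -
  show rec: "(\<Sum>n. avoid K {x} n x) < \<infinity>" if x: "x \<in> A" for x
  proof (rule foster_level_sets[OF closed b G drift _ x])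
    fix y assume "y \<in> A"
    then obtain m where m: "z \<in> set_pmf (steps K n y)" if "m \<le> n" for n using to_z by blast
    obtain n where n: "x \<in> set_pmf (steps K n z)" using from_z[OF x] by blast
    have "x \<in> set_pmf (steps K (Suc m + n) y)"
      unfolding steps_add[of K "Suc m" n] using m[of "Suc m"] n by (auto simp del: steps.simps)
    then show "\<exists>n>0. set_pmf (steps K n y) \<inter> {x} \<noteq> {}"
      by (intro exI[of _ "Suc m + n"]) (auto simp del: steps.simps)
  qed
  have coupling: "(\<Sum>n. avoid (pair_kernel K) Id n (x, y)) < \<infinity>" if xy: "x \<in> A" "y \<in> A" for x y
  proof (rule foster_level_sets[where A="A \<times> A" and V="\<lambda>w. V (fst w) + V (snd w)"
        and G="\<lambda>w. G (fst w) + G (snd w)" and b="b + b"])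
    show "set_pmf (pair_kernel K w) \<subseteq> A \<times> A" if "w \<in> A \<times> A" for w
      using that closed by (fastforce simp: pair_kernel_def)
    show "finite {w. G (fst w) + G (snd w) \<le> r}" for r
    proof (rule finite_subset)
      show "{w. G (fst w) + G (snd w) \<le> r} \<subseteq> {x. G x \<le> r} \<times> {x. G x \<le> r}"
      proof
        fix w assume "w \<in> {w. G (fst w) + G (snd w) \<le> r}"
        then show "w \<in> {x. G x \<le> r} \<times> {x. G x \<le> r}"
          using G0[of "fst w"] G0[of "snd w"] by (cases w) simp
      qed
    qed (simp add: G)
    show "(\<integral>\<^sup>+v. ennreal (V (fst v) + V (snd v)) \<partial>pair_kernel K w) + ennreal (G (fst w) + G (snd w))
        \<le> ennreal (V (fst w) + V (snd w)) + ennreal (b + b)" if w: "w \<in> A \<times> A" for w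
    proof -
      obtain x y where w': "w = (x, y)" "x \<in> A" "y \<in> A" using w by auto
      have "(\<integral>\<^sup>+v. ennreal (V (fst v) + V (snd v)) \<partial>pair_kernel K w)
          = (\<integral>\<^sup>+v. ennreal (V v) \<partial>map_pmf fst (pair_kernel K w)) + (\<integral>\<^sup>+v. ennreal (V v) \<partial>map_pmf snd (pair_kernel K w))"
        by (simp add: V ennreal_plus nn_integral_add)
      also have "\<dots> = (\<integral>\<^sup>+v. ennreal (V v) \<partial>K x) + (\<integral>\<^sup>+v. ennreal (V v) \<partial>K y)"
        by (simp add: w' pair_kernel_def map_fst_pair_pmf map_snd_pair_pmf del: nn_integral_map_pmf)
      finally have I: "(\<integral>\<^sup>+v. ennreal (V (fst v) + V (snd v)) \<partial>pair_kernel K w)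
          = (\<integral>\<^sup>+v. ennreal (V v) \<partial>K x) + (\<integral>\<^sup>+v. ennreal (V v) \<partial>K y)" .
      show ?thesis
        using add_mono[OF drift[OF w'(2)] drift[OF w'(3)]]
        unfolding I unfolding w' fst_conv snd_conv
          ennreal_plus[OF G0 G0] ennreal_plus[OF V V] ennreal_plus[OF b b]
        by (simp only: ac_simps)
    qed
    show "\<exists>n>0. set_pmf (steps (pair_kernel K) n w) \<inter> Id \<noteq> {}" if w: "w \<in> A \<times> A" for w
    proof -
      have w1: "fst w \<in> A" and w2: "snd w \<in> A" using w by auto
      obtain m1 where m1: "z \<in> set_pmf (steps K n (fst w))" if "m1 \<le> n" for n using to_z[OF w1] by blast
      obtain m2 where m2: "z \<in> set_pmf (steps K n (snd w))" if "m2 \<le> n" for n using to_z[OF w2] by blast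
      have "(z, z) \<in> set_pmf (steps (pair_kernel K) (Suc (m1 + m2)) w)"
        unfolding steps_pair_kernel set_pair_pmf using m1[of "Suc (m1 + m2)"] m2[of "Suc (m1 + m2)"]
        by (simp del: steps.simps)
      then show ?thesis by (intro exI[of _ "Suc (m1 + m2)"]) (auto simp del: steps.simps)
    qed
  qed (use xy b in auto)
  obtain \<pi> where \<pi>: "stationary K A \<pi>"
    using stationary_exists[OF closed z rec[OF z]] by blast
  show "\<exists>\<pi>. stationary K A \<pi> \<and> (\<forall>\<pi>'. stationary K A \<pi>' \<longrightarrow> \<pi>' = \<pi>) \<and>
      (\<forall>x\<in>A. \<forall>B. (\<lambda>n. measure (steps K n x) B) \<longlonglongrightarrow> measure \<pi> B)"
  proof (intro exI[of _ \<pi>] conjI allI impI ballI)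
    show "\<pi>' = \<pi>" if "stationary K A \<pi>'" for \<pi>'
      by (rule stationary_unique[OF coupling \<pi> that])
    show "(\<lambda>n. measure (steps K n x) B) \<longlonglongrightarrow> measure \<pi> B" if "x \<in> A" for x B
      by (rule steps_tendsto_stationary[OF coupling \<pi> that])
  qed (rule \<pi>)
qed

section \<open>Persistent-Idle routing inside a set of servers\<close>

locale service_system =
  fixes arr :: "nat pmf" and serv :: "'n::finite \<Rightarrow> nat pmf" and smax :: nat
  assumes arr_mean: "integrable (measure_pmf arr) (\<lambda>k. real k)"
    and arr_variance: "integrable (measure_pmf arr) (\<lambda>k. (real k)\<^sup>2)"
    and serv_bounds: "\<And>i. set_pmf (serv i) \<subseteq> {1..smax}"
begin

definition noise :: "(nat \<times> ('n \<Rightarrow> nat)) pmf" where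
  "noise = pair_pmf arr (Pi_pmf UNIV 0 serv)"

text \<open>
  Only idle servers in \<open>J\<close> redirect the arrivals; the full policy is the case \<open>J = UNIV\<close>. The
  queues outside \<open>J\<close> are served as usual, but their idleness is ignored.
\<close>
definition route :: "'n set \<Rightarrow> 'n state \<Rightarrow> 'n pmf" where
  "route J x = (if idle x \<inter> J = {} then return_pmf (snd x) else pmf_of_set (idle x \<inter> J))"

text \<open>
  The three random ingredients of a slot: the server that gets the arrivals, the number of
  arrivals, and the offered capacities. All one-step expectations below are over this law.
\<close>
definition inputs :: "'n set \<Rightarrow> 'n state \<Rightarrow> ('n \<times> nat \<times> ('n \<Rightarrow> nat)) pmf" where
  "inputs J x = pair_pmf (route J x) noise"

definition step :: "'n state \<Rightarrow> 'n \<times> nat \<times> ('n \<Rightarrow> nat) \<Rightarrow> 'n state" where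
  "step x z = (next_queues (fst x) (fst (snd z)) (snd (snd z)) (fst z), fst z)"

definition backlog :: "'n set \<Rightarrow> 'n state \<Rightarrow> real" where
  "backlog J x = (\<Sum>i\<in>J. real (fst x i))"

definition waste :: "'n set \<Rightarrow> 'n state \<Rightarrow> 'n \<times> nat \<times> ('n \<Rightarrow> nat) \<Rightarrow> real" where
  "waste J x z = (\<Sum>i\<in>J. real (snd (snd z) i - (fst x i + (if fst z = i then fst (snd z) else 0))))"

definition arr_rate :: real where "arr_rate = measure_pmf.expectation arr real"
definition arr_moment2 :: real where "arr_moment2 = measure_pmf.expectation arr (\<lambda>k. (real k)\<^sup>2)"
definition serv_rate :: "'n set \<Rightarrow> real" where "serv_rate J = (\<Sum>i\<in>J. measure_pmf.expectation (serv i) real)"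
text \<open>
  An upper bound of the total capacity offered in a slot.
\<close>
definition cap :: real where "cap = real (CARD('n) * smax)"

abbreviation expect :: "'n set \<Rightarrow> 'n state \<Rightarrow> ('n \<times> nat \<times> ('n \<Rightarrow> nat) \<Rightarrow> real) \<Rightarrow> real" where
  "expect J x f \<equiv> measure_pmf.expectation (inputs J x) f"

abbreviation arrived :: "'n \<times> nat \<times> ('n \<Rightarrow> nat) \<Rightarrow> real" where "arrived z \<equiv> real (fst (snd z))"
abbreviation offered :: "'n \<times> nat \<times> ('n \<Rightarrow> nat) \<Rightarrow> 'n \<Rightarrow> real" where "offered z i \<equiv> real (snd (snd z) i)"

text \<open>
  In these states the arrivals are sent into \<open>J\<close>, and then this remains so forever.
\<close>
definition captures :: "'n set \<Rightarrow> 'n state \<Rightarrow> bool" where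
  "captures J x \<longleftrightarrow> idle x \<inter> J \<noteq> {} \<or> snd x \<in> J"

lemma set_route: "set_pmf (route J x) = (if idle x \<inter> J = {} then {snd x} else idle x \<inter> J)"
  by (simp add: route_def)

lemma offered_support:
  assumes "z \<in> set_pmf (inputs J x)" shows "1 \<le> snd (snd z) i" "snd (snd z) i \<le> smax"
proof -
  have "snd (snd z) \<in> set_pmf (Pi_pmf UNIV 0 serv)" using assms by (auto simp: inputs_def noise_def)
  then have "snd (snd z) i \<in> set_pmf (serv i)"
    using set_Pi_pmf_subset'[of UNIV 0 serv] by (auto simp: PiE_dflt_def)
  then show "1 \<le> snd (snd z) i" "snd (snd z) i \<le> smax" using serv_bounds[of i] by auto
qed

lemma route_support: "z \<in> set_pmf (inputs J x) \<Longrightarrow> fst z \<in> set_pmf (route J x)"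
  by (auto simp: inputs_def)

lemma cap_nonneg [simp]: "0 \<le> cap" by (simp add: cap_def)

lemma card_J_le: "real (card (J :: 'n set)) \<le> real CARD('n)"
  by (simp add: card_mono)

lemma sum_J_smax: "(\<Sum>i\<in>J. real smax) \<le> cap" for J :: "'n set"
  using card_J_le[of J] by (simp add: cap_def mult_right_mono)

lemma smax_le_cap: "real smax \<le> cap"
proof -
  have "1 \<le> CARD('n)" by (simp add: Suc_le_eq)
  then show ?thesis by (simp add: cap_def mult_le_cancel_right1 del: One_nat_def)
qed

lemma sum_offered_le: "z \<in> set_pmf (inputs J x) \<Longrightarrow> (\<Sum>i\<in>L. offered z i) \<le> cap"
  using offered_support(2)[of z J x] by (intro order_trans[OF sum_mono sum_J_smax]) simp

lemma waste_bounds: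
  shows "0 \<le> waste L x z" and "z \<in> set_pmf (inputs J y) \<Longrightarrow> waste L x z \<le> cap"
proof -
  show "0 \<le> waste L x z" by (simp add: waste_def sum_nonneg)
  show "waste L x z \<le> cap" if "z \<in> set_pmf (inputs J y)"
    using sum_offered_le[OF that, of L] by (rule order_trans[rotated]) (auto simp: waste_def intro!: sum_mono)
qed

lemma backlog_nonneg [simp]: "0 \<le> backlog J x" by (simp add: backlog_def sum_nonneg)

lemma backlog_step:
  "backlog J (step x z) = backlog J x + (if fst z \<in> J then arrived z else 0) - (\<Sum>i\<in>J. offered z i) + waste J x z"
proof -
  let ?b = "\<lambda>i. if fst z = i then fst (snd z) else 0"
  have trunc: "real (q + b - s) = real q + real b - real s + real (s - (q + b))" for q b s :: nat
    by linarith
  have "backlog J (step x z) = (\<Sum>i\<in>J. real (fst x i) + real (?b i) - offered z i + real (snd (snd z) i - (fst x i + ?b i)))"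
    unfolding backlog_def step_def next_queues_def fst_conv by (intro sum.cong refl trunc)
  also have "\<dots> = backlog J x + (\<Sum>i\<in>J. real (?b i)) - (\<Sum>i\<in>J. offered z i) + waste J x z"
    by (simp only: sum.distrib sum_subtractf backlog_def waste_def)
  also have "(\<Sum>i\<in>J. real (?b i)) = (if fst z \<in> J then arrived z else 0)"
    by (simp add: if_distrib[of real] sum.delta cong: if_cong)
  finally show ?thesis .
qed

lemma backlog_step_diff:
  assumes "z \<in> set_pmf (inputs L y)" shows "\<bar>backlog J (step x z) - backlog J x\<bar> \<le> arrived z + cap"
proof -
  have "0 \<le> waste J x z" "waste J x z \<le> cap" "(\<Sum>i\<in>J. offered z i) \<le> cap" "0 \<le> (\<Sum>i\<in>J. offered z i)"
    using waste_bounds assms sum_offered_le by (auto intro: sum_nonneg)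
  then show ?thesis unfolding backlog_step by auto
qed

lemma queue_step_diff:
  assumes "z \<in> set_pmf (inputs L y)"
  shows "\<bar>real (fst (step x z) i) - real (fst x i)\<bar> \<le> arrived z + cap"
proof -
  have "fst (step x z) i \<le> fst x i + fst (snd z)" "fst x i \<le> fst (step x z) i + smax"
    using offered_support(2)[OF assms, of i] by (auto simp: step_def next_queues_def)
  then have "real (fst (step x z) i) \<le> real (fst x i) + arrived z" "real (fst x i) \<le> real (fst (step x z) i) + real smax"
    by (simp_all only: of_nat_le_iff flip: of_nat_add)
  moreover have "0 \<le> arrived z" by simp
  ultimately show ?thesis using smax_le_cap cap_nonneg by linarith
qed

lemma integrable_arrived: "integrable (inputs J x) arrived" "integrable (inputs J x) (\<lambda>z. (arrived z)\<^sup>2)"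
  and expect_arrived: "expect J x arrived = arr_rate" "expect J x (\<lambda>z. (arrived z)\<^sup>2) = arr_moment2"
proof -
  have m: "map_pmf (\<lambda>z. fst (snd z)) (inputs J x) = arr"
  proof -
    have "map_pmf (\<lambda>z. fst (snd z)) (inputs J x) = map_pmf fst (map_pmf snd (inputs J x))"
      by (simp add: pmf.map_comp o_def)
    then show ?thesis by (simp add: inputs_def noise_def map_snd_pair_pmf map_fst_pair_pmf)
  qed
  show "integrable (inputs J x) arrived" "integrable (inputs J x) (\<lambda>z. (arrived z)\<^sup>2)"
    using arr_mean arr_variance
      integrable_map_pmf_eq[of "\<lambda>z. fst (snd z)" "inputs J x" real] 
      integrable_map_pmf_eq[of "\<lambda>z. fst (snd z)" "inputs J x" "\<lambda>k. (real k)\<^sup>2"] by (simp_all add: m)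
  show "expect J x arrived = arr_rate" "expect J x (\<lambda>z. (arrived z)\<^sup>2) = arr_moment2"
    using integral_map_pmf[of "\<lambda>z. fst (snd z)" "inputs J x" real]
      integral_map_pmf[of "\<lambda>z. fst (snd z)" "inputs J x" "\<lambda>k. (real k)\<^sup>2"] by (simp_all add: m arr_rate_def arr_moment2_def)
qed

text \<open>
  Besides the number of arrivals, everything that happens in a slot is bounded; so
  quadratic growth in the arrivals is the only case needed.
\<close>
lemma integrable_inputs:
  assumes "\<And>z. z \<in> set_pmf (inputs J x) \<Longrightarrow> \<bar>f z\<bar> \<le> ca + cb * arrived z + cc * (arrived z)\<^sup>2"
  shows "integrable (inputs J x) f"
proof (rule Bochner_Integration.integrable_bound)
  show "integrable (inputs J x) (\<lambda>z. ca + cb * arrived z + cc * (arrived z)\<^sup>2)"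
    by (intro Bochner_Integration.integrable_add integrable_mult_right integrable_arrived) simp
  show "AE z in inputs J x. norm (f z) \<le> norm (ca + cb * arrived z + cc * (arrived z)\<^sup>2)"
    by (rule AE_pmfI) (use assms in fastforce)
qed simp

lemma integrable_inputs_bounded:
  fixes c :: real
  assumes "\<And>z. z \<in> set_pmf (inputs J x) \<Longrightarrow> \<bar>f z\<bar> \<le> c"
  shows "integrable (inputs J x) f"
  by (rule integrable_inputs[where ca=c and cb=0 and cc=0]) (use assms in auto)

lemma expect_mono:
  assumes "integrable (inputs J x) f" "integrable (inputs J x) g"
    and "\<And>z. z \<in> set_pmf (inputs J x) \<Longrightarrow> f z \<le> g z"
  shows "expect J x f \<le> expect J x g"
  by (rule integral_mono_AE) (use assms in \<open>auto intro: AE_pmfI\<close>)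

lemma integrable_offered: "integrable (inputs J x) (\<lambda>z. \<Sum>i\<in>L. offered z i)"
  using sum_offered_le[of _ J x L] by (intro integrable_inputs_bounded[of _ _ _ cap]) (simp add: sum_nonneg)

lemma expect_offered: "expect J x (\<lambda>z. \<Sum>i\<in>L. offered z i) = serv_rate L"
proof -
  have m: "map_pmf (\<lambda>z. snd (snd z) i) (inputs J x) = serv i" for i
  proof -
    have "map_pmf (\<lambda>z. snd (snd z) i) (inputs J x) = map_pmf (\<lambda>f. f i) (map_pmf snd (map_pmf snd (inputs J x)))"
      by (simp add: pmf.map_comp o_def)
    then show ?thesis by (simp add: inputs_def noise_def map_snd_pair_pmf Pi_pmf_component)
  qed
  have e: "expect J x (\<lambda>z. offered z i) = measure_pmf.expectation (serv i) real" for i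
    using integral_map_pmf[of "\<lambda>z. snd (snd z) i" "inputs J x" real] by (simp add: m)
  have "integrable (inputs J x) (\<lambda>z. offered z i)" for i
    using offered_support(2)[of _ J x i] by (intro integrable_inputs_bounded[of _ _ _ "real smax"]) simp
  then show ?thesis by (simp add: serv_rate_def e)
qed

lemma integrable_waste: "integrable (inputs J x) (waste L y)"
  by (rule integrable_inputs_bounded[of _ _ _ cap]) (simp add: waste_bounds)

lemma integrable_bounded_step:
  assumes "\<And>x. 0 \<le> h x \<and> h x \<le> (C::real)" shows "integrable (inputs J x) (\<lambda>z. h (step x z))"
  using assms by (intro integrable_inputs_bounded[of _ _ _ C]) simp

lemma captures_support:
  assumes "captures J x" "z \<in> set_pmf (inputs J x)" shows "fst z \<in> J"
  using assms route_support[of z J x] by (auto simp: captures_def set_route split: if_splits)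

lemma serv_rate_singleton_ge: "1 \<le> measure_pmf.expectation (serv i) real"
proof -
  have int: "integrable (serv i) real"
    using serv_bounds[of i] by (intro measure_pmf.integrable_const_bound[where B=smax]) (auto intro!: AE_pmfI)
  have "measure_pmf.expectation (serv i) (\<lambda>_. 1) \<le> measure_pmf.expectation (serv i) real"
    using int serv_bounds[of i] by (intro integral_mono_AE) (auto intro!: AE_pmfI)
  then show ?thesis by simp
qed

text \<open>
  A server with more than \<open>smax\<close> jobs is not idle and cannot waste service, so in this
  slot it makes no difference whether it belongs to \<open>J\<close>.
\<close>
lemma inputs_eq_remove:
  assumes "smax < fst x i"
  shows "inputs J x = inputs (J - {i}) x"
    and "z \<in> set_pmf (inputs J x) \<Longrightarrow> waste J x z = waste (J - {i}) x z"
proof -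
  have "idle x \<inter> J = idle x \<inter> (J - {i})" using assms by (auto simp: idle_def)
  then show "inputs J x = inputs (J - {i}) x" by (simp add: inputs_def route_def)
  show "waste J x z = waste (J - {i}) x z" if "z \<in> set_pmf (inputs J x)"
    unfolding waste_def using offered_support(2)[OF that, of i] assms
    by (intro sum.mono_neutral_right) auto
qed

section \<open>Bounded potentials for wasted service\<close>

lemma ratio_diff:
  fixes q q' T T' e :: real
  assumes "0 \<le> q" "q \<le> T" "0 \<le> q'" "q' \<le> T'" "0 < T" "\<bar>q' - q\<bar> \<le> e" "\<bar>T' - T\<bar> \<le> e"
  shows "\<bar>q' / T' - q / T\<bar> \<le> 2 * e / T"
proof (cases "T' = 0")
  case True
  then have "q' = 0" using assms by simp
  then show ?thesis using assms True by (simp add: divide_right_mono)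
next
  case False
  then have T': "0 < T'" using assms by simp
  have "q' / T' - q / T = (q' - q) / T + (q' / T') * ((T - T') / T)"
    using T' \<open>0 < T\<close> by (simp add: field_simps)
  also have "\<bar>\<dots>\<bar> \<le> \<bar>(q' - q) / T\<bar> + \<bar>(q' / T') * ((T - T') / T)\<bar>" by (rule abs_triangle_ineq)
  also have "\<bar>(q' - q) / T\<bar> \<le> e / T" using assms by (simp add: divide_right_mono)
  also have "\<bar>(q' / T') * ((T - T') / T)\<bar> \<le> 1 * (e / T)"
    unfolding abs_mult using assms T' by (intro mult_mono) (auto simp: divide_right_mono abs_minus_commute)
  finally show ?thesis by (simp add: field_simps)
qed

text \<open>
  When \<open>J\<close> gets all arrivals, its backlog and its waste determine each other on average. This is
  what turns bounds on the growth of the backlog into bounds on the waste.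
\<close>
lemma captures_drift:
  assumes "captures J x"
  shows "expect J x (\<lambda>z. backlog J (step x z) - backlog J x) = arr_rate - serv_rate J + expect J x (waste J x)"
proof -
  have "expect J x (\<lambda>z. backlog J (step x z) - backlog J x) = expect J x (\<lambda>z. arrived z - (\<Sum>i\<in>J. offered z i) + waste J x z)"
    by (intro integral_cong_AE AE_pmfI) (use captures_support[OF assms] in \<open>simp_all add: backlog_step\<close>)
  also have "\<dots> = arr_rate - serv_rate J + expect J x (waste J x)"
    using integrable_arrived(1)[of J x] integrable_offered[of J x J] integrable_waste[of J x J x]
    by (simp add: expect_arrived(1) expect_offered del: of_nat_sum)
  finally show ?thesis .
qed

lemma waste_potential_le:
  assumes "\<And>x. 0 \<le> h x \<and> h x \<le> C"
  shows "expect J x (\<lambda>z. waste L y z + h (step x z)) \<le> cap + C"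
proof -
  have "expect J x (\<lambda>z. waste L y z + h (step x z)) \<le> expect J x (\<lambda>_. cap + C)"
  proof (rule expect_mono)
    show "integrable (inputs J x) (\<lambda>z. waste L y z + h (step x z))"
      by (intro Bochner_Integration.integrable_add integrable_waste integrable_bounded_step[OF assms])
    show "waste L y z + h (step x z) \<le> cap + C" if "z \<in> set_pmf (inputs J x)" for z
      using waste_bounds(2)[OF that] assms by (intro add_mono) auto
  qed simp
  then show ?thesis by simp
qed

text \<open>
  The weights \<open>p i = q i / T\<close> are a partition of unity in which a server counts only as far as its queue is
  long, which is where the potential for \<open>J - {i}\<close> is usable. In one slot a weight changes by
  at most \<open>2 * (arrivals + cap) / T\<close>, and the servers with at most \<open>smax\<close> jobs have weight at most
  \<open>smax / T\<close>. So the total error is of order \<open>1 / T\<close>.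
\<close>
lemma patch_potentials:
  assumes J: "J \<noteq> {}" and c: "0 \<le> c" and e: "0 < e"
    and H: "\<And>i. i \<in> J \<Longrightarrow> \<exists>h C. \<forall>x. 0 \<le> h x \<and> h x \<le> C \<and>
        expect (J - {i}) x (\<lambda>z. waste (J - {i}) x z + h (step x z)) \<le> h x + c"
  shows "\<exists>h C R. (\<forall>x. 0 \<le> h x \<and> h x \<le> C) \<and>
    (\<forall>x. R \<le> backlog J x \<longrightarrow> expect J x (\<lambda>z. waste J x z + h (step x z)) \<le> h x + c + e)"
proof -
  let ?P = "\<lambda>i h C. \<forall>x. 0 \<le> h x \<and> h x \<le> C \<and>
        expect (J - {i}) x (\<lambda>z. waste (J - {i}) x z + h (step x z)) \<le> h x + c"
  have "\<forall>i\<in>J. \<exists>h C. ?P i h C" using H by blast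
  from bchoice[OF this] obtain hh where "\<forall>i\<in>J. \<exists>C. ?P i (hh i) C" by (elim exE)
  from bchoice[OF this] obtain CC where P: "\<forall>i\<in>J. ?P i (hh i) (CC i)" by (elim exE)
  have hC: "0 \<le> hh i x \<and> hh i x \<le> CC i" if "i \<in> J" for i x using P that by blast
  have hh: "expect (J - {i}) x (\<lambda>z. waste (J - {i}) x z + hh i (step x z)) \<le> hh i x + c" if "i \<in> J" for i x
    using P that by blast
  define C where "C = (\<Sum>i\<in>J. CC i)"
  have CC0: "0 \<le> CC i" if "i \<in> J" for i using hC[OF that] order_trans by blast
  have CC: "CC i \<le> C" if "i \<in> J" for i
    unfolding C_def using that CC0 by (intro member_le_sum) auto
  have C0: "0 \<le> C" unfolding C_def using CC0 by (rule sum_nonneg)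
  have hC': "0 \<le> hh i x" "hh i x \<le> C" if "i \<in> J" for i x
    using hC[OF that, of x] CC[OF that] by auto
  define p where "p i x = real (fst x i) / backlog J x" for i x
  define h where "h x = (\<Sum>i\<in>J. p i x * hh i x)" for x
  have q_le: "real (fst x i) \<le> backlog J x" if "i \<in> J" for i x
    unfolding backlog_def using that by (intro member_le_sum) auto
  have p: "0 \<le> p i x" "p i x \<le> 1" if "i \<in> J" for i x
  proof -
    show "0 \<le> p i x" by (simp add: p_def)
    show "p i x \<le> 1"
    proof (cases "backlog J x = 0")
      case False
      then have "0 < backlog J x" using backlog_nonneg[of J x] by linarith
      then show ?thesis using q_le[OF that, of x] by (simp add: p_def)
    qed (simp add: p_def)
  qed
  have h: "0 \<le> h x \<and> h x \<le> C" for x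
  proof
    show "0 \<le> h x" unfolding h_def using p hC' by (intro sum_nonneg mult_nonneg_nonneg) auto
    have "h x \<le> (\<Sum>i\<in>J. 1 * CC i)" unfolding h_def using p hC CC0 by (intro sum_mono mult_mono) auto
    then show "h x \<le> C" by (simp add: C_def)
  qed
  define N where "N = real (card J)"
  \<comment> \<open>\<open>k / T\<close> is the sum of the error from moving the weights and the error from the short queues\<close>
  define k where "k = N * (2 * C * (arr_rate + cap) + real smax * (cap + C))"
  define R where "R = \<bar>k\<bar> / e + 1"
  have "expect J x (\<lambda>z. waste J x z + h (step x z)) \<le> h x + c + e" if R: "R \<le> backlog J x" for x
  proof -
    let ?T = "backlog J x"
    have "0 \<le> \<bar>k\<bar> / e" using e by simp
    then have T: "0 < ?T" using R unfolding R_def by linarith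
    have "\<bar>k\<bar> / e \<le> ?T" using R unfolding R_def by simp
    then have kT: "k / ?T \<le> e" using T e by (simp add: field_simps)
    have p1: "(\<Sum>i\<in>J. p i x) = 1"
      using T by (simp add: p_def sum_divide_distrib[symmetric] backlog_def)
    let ?f = "\<lambda>i z. waste J x z + hh i (step x z)"
    have intf: "integrable (inputs J x) (?f i)" if "i \<in> J" for i
      using hC'[OF that] by (intro Bochner_Integration.integrable_add integrable_waste integrable_bounded_step[where C=C]) auto
    have point: "waste J x z + h (step x z) \<le> (\<Sum>i\<in>J. p i x * ?f i z) + N * C * (2 * (arrived z + cap) / ?T)"
      if z: "z \<in> set_pmf (inputs J x)" for z
    proof -
      have "p i (step x z) * hh i (step x z) \<le> p i x * hh i (step x z) + C * (2 * (arrived z + cap) / ?T)" if i: "i \<in> J" for i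
      proof -
        have "\<bar>p i (step x z) - p i x\<bar> \<le> 2 * (arrived z + cap) / ?T"
          unfolding p_def using q_le[OF i] T backlog_step_diff[OF z] queue_step_diff[OF z]
          by (intro ratio_diff) auto
        then have "(p i (step x z) - p i x) * hh i (step x z) \<le> (2 * (arrived z + cap) / ?T) * C"
          using hC'[OF i, of "step x z"] by (intro mult_mono) auto
        then show ?thesis by (simp add: algebra_simps)
      qed
      then have "h (step x z) \<le> (\<Sum>i\<in>J. p i x * hh i (step x z) + C * (2 * (arrived z + cap) / ?T))"
        unfolding h_def by (intro sum_mono)
      also have "\<dots> = (\<Sum>i\<in>J. p i x * hh i (step x z)) + N * C * (2 * (arrived z + cap) / ?T)"
        by (simp add: sum.distrib N_def)
      finally have "waste J x z + h (step x z) \<le> (\<Sum>i\<in>J. p i x) * waste J x z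
          + (\<Sum>i\<in>J. p i x * hh i (step x z)) + N * C * (2 * (arrived z + cap) / ?T)"
        unfolding p1 by simp
      also have "(\<Sum>i\<in>J. p i x) * waste J x z + (\<Sum>i\<in>J. p i x * hh i (step x z)) = (\<Sum>i\<in>J. p i x * ?f i z)"
        by (simp add: sum_distrib_right sum.distrib[symmetric] distrib_left)
      finally show ?thesis .
    qed
    have f_le: "p i x * expect J x (?f i) \<le> p i x * (hh i x + c) + real smax * (cap + C) / ?T" if i: "i \<in> J" for i
    proof (cases "smax < fst x i")
      case True
      have "expect J x (?f i) = expect J x (\<lambda>z. waste (J - {i}) x z + hh i (step x z))"
        using inputs_eq_remove(2)[OF True] by (intro integral_cong_AE AE_pmfI) auto
      then have "expect J x (?f i) \<le> hh i x + c"
        using hh[OF i, of x] inputs_eq_remove(1)[OF True, of J] by simp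
      then have "p i x * expect J x (?f i) \<le> p i x * (hh i x + c)"
        using p[OF i] by (intro mult_left_mono)
      moreover have "0 \<le> real smax * (cap + C) / ?T" using T C0 by simp
      ultimately show ?thesis by linarith
    next
      case False
      have "expect J x (?f i) \<le> cap + C" by (rule waste_potential_le) (use hC'[OF i] in auto)
      then have "p i x * expect J x (?f i) \<le> p i x * (cap + C)" using p[OF i] by (intro mult_left_mono)
      also have "\<dots> \<le> real smax / ?T * (cap + C)"
        using False T C0 by (intro mult_right_mono) (auto simp: p_def divide_right_mono)
      finally have "p i x * expect J x (?f i) \<le> real smax * (cap + C) / ?T" by simp
      moreover have "0 \<le> p i x * (hh i x + c)" using p[OF i] hC'[OF i] c by simp
      ultimately show ?thesis by linarith
    qed
    have int2: "integrable (inputs J x) (\<lambda>z. N * C * (2 * (arrived z + cap) / ?T))"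
      using integrable_arrived(1)[of J x] by simp
    have e2: "expect J x (\<lambda>z. N * C * (2 * (arrived z + cap) / ?T)) = N * C * (2 * (arr_rate + cap) / ?T)"
      using integrable_arrived(1)[of J x] by (simp add: expect_arrived)
    have intsum: "integrable (inputs J x) (\<lambda>z. \<Sum>i\<in>J. p i x * ?f i z)"
      using intf by (intro Bochner_Integration.integrable_sum integrable_mult_right)
    have "expect J x (\<lambda>z. waste J x z + h (step x z))
       \<le> expect J x (\<lambda>z. (\<Sum>i\<in>J. p i x * ?f i z) + N * C * (2 * (arrived z + cap) / ?T))"
    proof (rule expect_mono)
      show "integrable (inputs J x) (\<lambda>z. waste J x z + h (step x z))"
        by (intro Bochner_Integration.integrable_add integrable_waste integrable_bounded_step[OF h])
    qed (intro Bochner_Integration.integrable_add intsum int2, rule point)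
    also have "\<dots> = (\<Sum>i\<in>J. p i x * expect J x (?f i)) + N * C * (2 * (arr_rate + cap) / ?T)"
    proof -
      have "expect J x (\<lambda>z. \<Sum>i\<in>J. p i x * ?f i z) = (\<Sum>i\<in>J. p i x * expect J x (?f i))"
        using intf by (subst Bochner_Integration.integral_sum) auto
      then show ?thesis unfolding Bochner_Integration.integral_add[OF intsum int2] e2 by simp
    qed
    also have "\<dots> \<le> (\<Sum>i\<in>J. p i x * (hh i x + c) + real smax * (cap + C) / ?T) + N * C * (2 * (arr_rate + cap) / ?T)"
      by (intro add_right_mono sum_mono f_le)
    also have "\<dots> = (\<Sum>i\<in>J. p i x * (hh i x + c)) + k / ?T"
    proof -
      have "k / ?T = N * (real smax * (cap + C) / ?T) + N * C * (2 * (arr_rate + cap) / ?T)"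
        using T by (simp add: k_def field_simps)
      then show ?thesis by (simp only: sum.distrib sum_constant N_def add.assoc)
    qed
    also have "(\<Sum>i\<in>J. p i x * (hh i x + c)) = h x + c"
      using p1 by (simp add: h_def distrib_left sum.distrib sum_distrib_right[symmetric])
    finally show ?thesis using kT by linarith
  qed
  then show ?thesis using h by blast
qed

text \<open>
  The bound is needed for large negative \<open>u\<close> as well, since a batch of arrivals can be large.
\<close>
lemma exp_le_quadratic:
  fixes u :: real assumes "u \<le> 1" shows "exp u \<le> 1 + u + u\<^sup>2"
proof (cases "0 \<le> u")
  case True then show ?thesis using exp_bound assms by blast
next
  case False
  have "1 - u \<le> exp (- u)" using exp_ge_add_one_self[of "- u"] by simp
  then have "exp u * (1 - u) \<le> exp u * exp (- u)" by (intro mult_left_mono) auto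
  then have "exp u * (1 - u) \<le> 1" by (simp add: exp_minus)
  also have "1 \<le> 1 - u * (u * u)" using False by (simp add: mult_nonpos_nonneg zero_le_mult_iff mult_le_0_iff)
  also have "\<dots> = (1 + u + u\<^sup>2) * (1 - u)" by (simp add: power2_eq_square algebra_simps)
  finally show ?thesis using False by (simp add: mult_le_cancel_right)
qed

text \<open>
  The process \<open>G = T + h\<close> has drift at most \<open>e\<close> where \<open>T \<ge> R\<close>, but it may be pushed upwards where
  \<open>T < R\<close>, as a reflected walk is. The function \<open>\<phi> = sqrt (G\<^sup>2 + B\<^sup>2)\<close> is almost flat near the
  origin and nearly equal to \<open>G\<close> far out: by its tangent bound, the drift of \<open>\<phi>\<close> is at most
  \<open>(2 * G * E d + E d\<^sup>2) / (2 * \<phi>)\<close> with \<open>d\<close> the increment of \<open>G\<close>, which is at most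
  \<open>e + O(1 / B)\<close> at every state where \<open>J\<close> gets the arrivals.
  As \<open>\<phi> - T\<close> is bounded, it can serve as the potential.
\<close>
lemma potential_captures_underloaded:
  assumes c: "arr_rate \<le> serv_rate J" and e: "0 < e"
    and h: "\<And>x. 0 \<le> h x \<and> h x \<le> C"
    and drift: "\<And>x. R \<le> backlog J x \<Longrightarrow> expect J x (\<lambda>z. waste J x z + h (step x z)) \<le> h x + (serv_rate J - arr_rate) + e"
  shows "\<exists>h' C'. (\<forall>x. 0 \<le> h' x \<and> h' x \<le> C') \<and>
    (\<forall>x. captures J x \<longrightarrow> expect J x (\<lambda>z. waste J x z + h' (step x z)) \<le> h' x + (serv_rate J - arr_rate) + 2 * e)"
proof -
  have C0: "0 \<le> C" using h order_trans by blast
  define G where "G x = backlog J x + h x" for x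
  have G0: "0 \<le> G x" for x using h by (simp add: G_def)
  define D where "D = 2 * arr_moment2 + 2 * (2 * cap + C)\<^sup>2"
  have "0 \<le> arr_moment2" unfolding arr_moment2_def by (rule Bochner_Integration.integral_nonneg) simp
  then have D0: "0 \<le> D" by (simp add: D_def)
  \<comment> \<open>an upper bound of \<open>2 * G * E d + E d\<^sup>2\<close> where the backlog is below \<open>R\<close>\<close>
  define k where "k = 2 * ((\<bar>R\<bar> + C) * (cap + C)) + D"
  have k0: "D \<le> k" "0 \<le> k" using C0 D0 by (auto simp: k_def)
  define B where "B = k / (2 * e) + 1"
  have B: "0 < B" using k0 e by (simp add: B_def add_nonneg_pos)
  have kB: "k / (2 * B) \<le> e"
    using e B k0 by (simp add: B_def field_simps)
  define \<phi> where "\<phi> x = sqrt ((G x)\<^sup>2 + B\<^sup>2)" for x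
  have \<phi>: "B \<le> \<phi> x" "G x \<le> \<phi> x" "\<phi> x \<le> G x + B" "(\<phi> x)\<^sup>2 = (G x)\<^sup>2 + B\<^sup>2" for x
    using G0[of x] B real_sqrt_sum_squares_ge1[of "G x" B] real_sqrt_sum_squares_ge2[of B "G x"]
      sqrt_sum_squares_le_sum[of "G x" B] by (auto simp: \<phi>_def)
  define h' where "h' x = \<phi> x - backlog J x" for x
  have h': "0 \<le> h' x \<and> h' x \<le> C + B" for x
    using \<phi>(2,3)[of x] h[of x] by (auto simp: h'_def G_def)
  have "expect J x (\<lambda>z. waste J x z + h' (step x z)) \<le> h' x + (serv_rate J - arr_rate) + 2 * e" if captures: "captures J x" for x
  proof -
    let ?d = "\<lambda>z. G (step x z) - G x"
    have \<phi>0: "0 < \<phi> x" using \<phi>(1)[of x] B by linarith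
    have d: "\<bar>?d z\<bar> \<le> arrived z + (cap + C)" if "z \<in> set_pmf (inputs J x)" for z
      using backlog_step_diff[OF that, of J x] h[of x] h[of "step x z"] by (auto simp: G_def)
    have d2: "(?d z)\<^sup>2 \<le> 2 * (arrived z)\<^sup>2 + 2 * (2 * cap + C)\<^sup>2" if "z \<in> set_pmf (inputs J x)" for z
    proof -
      have "\<bar>?d z\<bar> \<le> arrived z + (2 * cap + C)" using d[OF that] cap_nonneg by linarith
      then have "(?d z)\<^sup>2 \<le> (arrived z + (2 * cap + C))\<^sup>2" by (simp add: abs_le_square_iff[symmetric])
      also have "\<dots> \<le> 2 * (arrived z)\<^sup>2 + 2 * (2 * cap + C)\<^sup>2"
        using sum_squares_ge_zero[of "arrived z - (2 * cap + C)" 0] by (simp add: power2_eq_square algebra_simps)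
      finally show ?thesis .
    qed
    have int_d: "integrable (inputs J x) ?d"
      by (rule integrable_inputs[where ca="cap + C" and cb=1 and cc=0]) (use d in \<open>simp add: add.commute\<close>)
    have int_d2: "integrable (inputs J x) (\<lambda>z. (?d z)\<^sup>2)"
      by (rule integrable_inputs[where ca="2 * (2 * cap + C)\<^sup>2" and cb=0 and cc=2]) (use d2 in \<open>simp add: add.commute\<close>)
    have int_h: "integrable (inputs J x) (\<lambda>z. h (step x z))"
      by (rule integrable_bounded_step[OF h])
    have int_T: "integrable (inputs J x) (\<lambda>z. backlog J (step x z) - backlog J x)"
      by (rule integrable_inputs[where ca=cap and cb=1 and cc=0]) (use backlog_step_diff in \<open>simp add: add.commute\<close>)
    have Ed: "expect J x ?d = arr_rate - serv_rate J + expect J x (\<lambda>z. waste J x z + h (step x z)) - h x"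
    proof -
      have "expect J x ?d = expect J x (\<lambda>z. (backlog J (step x z) - backlog J x) + h (step x z) - h x)"
        by (simp add: G_def algebra_simps)
      also have "\<dots> = expect J x (\<lambda>z. backlog J (step x z) - backlog J x) + expect J x (\<lambda>z. h (step x z)) - h x"
        using int_T int_h by simp
      finally show ?thesis unfolding captures_drift[OF captures]
        using int_h integrable_waste[of J x J x] by simp
    qed
    have Ed2: "expect J x (\<lambda>z. (?d z)\<^sup>2) \<le> D"
    proof -
      have "expect J x (\<lambda>z. (?d z)\<^sup>2) \<le> expect J x (\<lambda>z. 2 * (arrived z)\<^sup>2 + 2 * (2 * cap + C)\<^sup>2)"
        using integrable_arrived(2)[of J x] by (intro expect_mono int_d2 d2) auto
      also have "\<dots> = D" using integrable_arrived(2)[of J x] by (simp add: expect_arrived D_def)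
      finally show ?thesis .
    qed
    \<comment> \<open>the tangent to \<open>sqrt\<close> at \<open>(\<phi> x)\<^sup>2\<close>\<close>
    have tangent: "\<phi> (step x z) \<le> \<phi> x + (2 * G x * ?d z + (?d z)\<^sup>2) / (2 * \<phi> x)" for z
    proof -
      have "2 * \<phi> x * \<phi> (step x z) \<le> (\<phi> x)\<^sup>2 + (\<phi> (step x z))\<^sup>2"
        using sum_squares_ge_zero[of "\<phi> x - \<phi> (step x z)" 0] by (simp add: power2_eq_square algebra_simps)
      also have "\<dots> = 2 * (\<phi> x)\<^sup>2 + 2 * G x * ?d z + (?d z)\<^sup>2"
        unfolding \<phi>(4) by (simp add: power2_eq_square algebra_simps)
      finally show ?thesis using \<phi>0 by (simp add: field_simps power2_eq_square)
    qed
    have int_t: "integrable (inputs J x) (\<lambda>z. (2 * G x * ?d z + (?d z)\<^sup>2) / (2 * \<phi> x))"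
      by (intro integrable_divide Bochner_Integration.integrable_add integrable_mult_right int_d int_d2)
    have "expect J x (\<lambda>z. waste J x z + h' (step x z))
       \<le> expect J x (\<lambda>z. (waste J x z + h' x - (backlog J (step x z) - backlog J x)) + (2 * G x * ?d z + (?d z)\<^sup>2) / (2 * \<phi> x))"
    proof (rule expect_mono)
      show "integrable (inputs J x) (\<lambda>z. waste J x z + h' (step x z))"
        by (intro Bochner_Integration.integrable_add integrable_waste integrable_bounded_step[OF h'])
      show "integrable (inputs J x) (\<lambda>z. (waste J x z + h' x - (backlog J (step x z) - backlog J x)) + (2 * G x * ?d z + (?d z)\<^sup>2) / (2 * \<phi> x))"
        by (intro Bochner_Integration.integrable_add Bochner_Integration.integrable_diff integrable_waste int_T int_t) simp
      show "waste J x z + h' (step x z) \<le> (waste J x z + h' x - (backlog J (step x z) - backlog J x)) + (2 * G x * ?d z + (?d z)\<^sup>2) / (2 * \<phi> x)" for z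
        using tangent[of z] unfolding h'_def by linarith
    qed
    also have "\<dots> = h' x + (serv_rate J - arr_rate) + expect J x (\<lambda>z. (2 * G x * ?d z + (?d z)\<^sup>2) / (2 * \<phi> x))"
      using int_t int_T integrable_waste[of J x J x] captures_drift[OF captures]
      by (subst Bochner_Integration.integral_add) auto
    also have "expect J x (\<lambda>z. (2 * G x * ?d z + (?d z)\<^sup>2) / (2 * \<phi> x))
        = (2 * (G x * expect J x ?d) + expect J x (\<lambda>z. (?d z)\<^sup>2)) / (2 * \<phi> x)"
      using int_d int_d2 by simp
    also have "\<dots> \<le> 2 * e"
    proof (cases "R \<le> backlog J x")
      case True
      have "expect J x ?d \<le> e" using drift[OF True] unfolding Ed by linarith
      then have "G x * expect J x ?d \<le> G x * e" using G0 by (intro mult_left_mono)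
      also have "G x * e \<le> \<phi> x * e" using \<phi>(2) e by (intro mult_right_mono) auto
      finally have "2 * (G x * expect J x ?d) + expect J x (\<lambda>z. (?d z)\<^sup>2) \<le> 2 * (\<phi> x * e) + k"
        using Ed2 k0 by linarith
      then have "(2 * (G x * expect J x ?d) + expect J x (\<lambda>z. (?d z)\<^sup>2)) / (2 * \<phi> x) \<le> (2 * (\<phi> x * e) + k) / (2 * \<phi> x)"
        using \<phi>0 by (intro divide_right_mono) auto
      also have "\<dots> = e + k / (2 * \<phi> x)" using \<phi>0 by (simp add: field_simps)
      also have "k / (2 * \<phi> x) \<le> k / (2 * B)" using k0 \<phi>(1)[of x] B by (intro divide_left_mono) auto
      finally show ?thesis using kB by linarith
    next
      case False
      have "expect J x ?d \<le> cap + C"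
        unfolding Ed using waste_potential_le[of h C J x J x, OF h] h[of x] c by linarith
      moreover have "G x \<le> \<bar>R\<bar> + C" using False h[of x] unfolding G_def by linarith
      ultimately have "G x * expect J x ?d \<le> (\<bar>R\<bar> + C) * (cap + C)"
        using G0[of x] C0 cap_nonneg by (cases "0 \<le> expect J x ?d")
          (auto intro: mult_mono order_trans[of _ 0] simp: mult_nonneg_nonpos)
      then have "2 * (G x * expect J x ?d) + expect J x (\<lambda>z. (?d z)\<^sup>2) \<le> k"
        using Ed2 by (simp add: k_def)
      then have "(2 * (G x * expect J x ?d) + expect J x (\<lambda>z. (?d z)\<^sup>2)) / (2 * \<phi> x) \<le> k / (2 * \<phi> x)"
        using \<phi>0 by (intro divide_right_mono) auto
      also have "k / (2 * \<phi> x) \<le> k / (2 * B)" using k0 \<phi>(1)[of x] B by (intro divide_left_mono) auto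
      finally show ?thesis using kB e by linarith
    qed
    finally show ?thesis by simp
  qed
  then show ?thesis using h' by blast
qed

text \<open>
  While \<open>J\<close> gets the arrivals, the upward drift is at least \<open>d > 0\<close> at every state, and decrements of
  the backlog are at most \<open>cap\<close>, so \<open>exp (- \<theta> * T)\<close> shrinks on average by the factor \<open>1 - \<theta> * d / 2\<close> for small \<open>\<theta>\<close>. Where
  \<open>T < R\<close>, the absolute decrease is at least \<open>\<eta>\<close>, and \<open>H\<close> copies of it pay for any possible waste
  and for the failure of \<open>h\<close> there.
\<close>
lemma potential_captures_overloaded:
  assumes c: "serv_rate J < arr_rate" and e: "0 < e"
    and h: "\<And>x. 0 \<le> h x \<and> h x \<le> C"
    and drift: "\<And>x. R \<le> backlog J x \<Longrightarrow> expect J x (\<lambda>z. waste J x z + h (step x z)) \<le> h x + e"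
  shows "\<exists>h' C'. (\<forall>x. 0 \<le> h' x \<and> h' x \<le> C') \<and>
    (\<forall>x. captures J x \<longrightarrow> expect J x (\<lambda>z. waste J x z + h' (step x z)) \<le> h' x + e)"
proof -
  have C0: "0 \<le> C" using h order_trans by blast
  define d where "d = arr_rate - serv_rate J"
  have d: "0 < d" using c by (simp add: d_def)
  define D where "D = 2 * arr_moment2 + 2 * cap\<^sup>2"
  have "0 \<le> arr_moment2" unfolding arr_moment2_def by (rule Bochner_Integration.integral_nonneg) simp
  then have D0: "0 \<le> D" by (simp add: D_def)
  \<comment> \<open>small enough that \<open>exp_le_quadratic\<close> applies and that the quadratic term costs at most half of the linear one\<close>
  define \<theta> where "\<theta> = min (1 / (cap + 1)) (d / (2 * (D + 1)))"
  have S1: "0 < cap + 1" using cap_nonneg by linarith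
  have \<theta>: "0 < \<theta>" using d D0 S1 by (simp add: \<theta>_def)
  have \<theta>cap: "\<theta> * cap \<le> 1"
  proof -
    have "\<theta> * cap \<le> 1 / (cap + 1) * (cap + 1)" using \<theta> cap_nonneg S1 by (intro mult_mono) (auto simp: \<theta>_def)
    then show ?thesis using S1 by simp
  qed
  have \<theta>D: "\<theta> * D \<le> d / 2"
  proof -
    have "\<theta> * D \<le> d / (2 * (D + 1)) * (D + 1)" using \<theta> D0 d by (intro mult_mono) (auto simp: \<theta>_def)
    also have "\<dots> = d / 2" using D0 by (simp add: field_simps)
    finally show ?thesis .
  qed
  define f where "f x = exp (- \<theta> * backlog J x)" for x
  have f: "0 < f x" "f x \<le> 1" for x using \<theta> by (auto simp: f_def)
  define \<eta> where "\<eta> = \<theta> * d / 2 * exp (- \<theta> * R)"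
  have \<eta>: "0 < \<eta>" using \<theta> d by (simp add: \<eta>_def)
  define H where "H = (cap + C) / \<eta>"
  have H: "0 \<le> H" "H * \<eta> = cap + C" using \<eta> C0 by (auto simp: H_def)
  define h' where "h' x = h x + H * f x" for x
  have h': "0 \<le> h' x \<and> h' x \<le> C + H" for x
  proof -
    have "0 \<le> H * f x" "H * f x \<le> H" using f[of x] H by (auto simp: mult_left_le)
    then show ?thesis unfolding h'_def using h[of x] by linarith
  qed
  have "expect J x (\<lambda>z. waste J x z + h' (step x z)) \<le> h' x + e" if captures: "captures J x" for x
  proof -
    let ?d = "\<lambda>z. backlog J (step x z) - backlog J x"
    have int_d: "integrable (inputs J x) ?d"
      by (rule integrable_inputs[where ca=cap and cb=1 and cc=0]) (use backlog_step_diff in \<open>simp add: add.commute\<close>)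
    have int_f: "integrable (inputs J x) (\<lambda>z. f (step x z))"
      by (rule integrable_bounded_step[where C=1]) (use f in \<open>simp add: less_imp_le\<close>)
    have int_w: "integrable (inputs J x) (\<lambda>z. waste J x z + h (step x z))"
      by (intro Bochner_Integration.integrable_add integrable_waste integrable_bounded_step[OF h])
    have d2: "(?d z)\<^sup>2 \<le> 2 * (arrived z)\<^sup>2 + 2 * cap\<^sup>2" if "z \<in> set_pmf (inputs J x)" for z
    proof -
      have "(?d z)\<^sup>2 \<le> (arrived z + cap)\<^sup>2"
        using backlog_step_diff[OF that, of J x] cap_nonneg by (simp add: abs_le_square_iff[symmetric])
      also have "\<dots> \<le> 2 * (arrived z)\<^sup>2 + 2 * cap\<^sup>2"
        using sum_squares_ge_zero[of "arrived z - cap" 0] by (simp add: power2_eq_square algebra_simps)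
      finally show ?thesis .
    qed
    have point: "f (step x z) \<le> f x * (1 - \<theta> * ?d z + \<theta>\<^sup>2 * (2 * (arrived z)\<^sup>2 + 2 * cap\<^sup>2))"
      if z: "z \<in> set_pmf (inputs J x)" for z
    proof -
      have "- cap \<le> ?d z"
        using sum_offered_le[OF z, of J] waste_bounds(1)[of J x z] unfolding backlog_step by auto
      then have "\<theta> * (- ?d z) \<le> \<theta> * cap" using \<theta> by (intro mult_left_mono) auto
      then have "- \<theta> * ?d z \<le> 1" using \<theta>cap by linarith
      from exp_le_quadratic[OF this]
      have "exp (- \<theta> * ?d z) \<le> 1 - \<theta> * ?d z + \<theta>\<^sup>2 * (?d z)\<^sup>2" by (simp add: power_mult_distrib)
      also have "\<dots> \<le> 1 - \<theta> * ?d z + \<theta>\<^sup>2 * (2 * (arrived z)\<^sup>2 + 2 * cap\<^sup>2)"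
        by (intro add_left_mono mult_left_mono d2 z) simp
      finally have "f x * exp (- \<theta> * ?d z) \<le> f x * (1 - \<theta> * ?d z + \<theta>\<^sup>2 * (2 * (arrived z)\<^sup>2 + 2 * cap\<^sup>2))"
        using f(1)[of x] by (intro mult_left_mono) auto
      moreover have "f (step x z) = f x * exp (- \<theta> * ?d z)"
        by (simp add: f_def exp_add[symmetric] algebra_simps)
      ultimately show ?thesis by simp
    qed
    have Ef: "expect J x (\<lambda>z. f (step x z)) \<le> f x * (1 - \<theta> * d / 2)"
    proof -
      have int_r: "integrable (inputs J x) (\<lambda>z. f x * (1 - \<theta> * ?d z + \<theta>\<^sup>2 * (2 * (arrived z)\<^sup>2 + 2 * cap\<^sup>2)))"
        using integrable_arrived(2)[of J x]
        by (intro integrable_mult_right Bochner_Integration.integrable_add Bochner_Integration.integrable_diff int_d) auto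
      have "expect J x (\<lambda>z. f (step x z)) \<le> expect J x (\<lambda>z. f x * (1 - \<theta> * ?d z + \<theta>\<^sup>2 * (2 * (arrived z)\<^sup>2 + 2 * cap\<^sup>2)))"
        by (intro expect_mono int_f int_r point)
      also have "\<dots> = f x * (1 - \<theta> * expect J x ?d + \<theta>\<^sup>2 * D)"
      proof -
        have "expect J x (\<lambda>z. \<theta>\<^sup>2 * (2 * (arrived z)\<^sup>2 + 2 * cap\<^sup>2)) = \<theta>\<^sup>2 * D"
          using integrable_arrived(2)[of J x] by (simp add: expect_arrived D_def)
        moreover have "integrable (inputs J x) (\<lambda>z. 1 - \<theta> * ?d z)"
          by (intro Bochner_Integration.integrable_diff integrable_mult_right int_d) simp
        moreover have "integrable (inputs J x) (\<lambda>z. \<theta>\<^sup>2 * (2 * (arrived z)\<^sup>2 + 2 * cap\<^sup>2))"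
          using integrable_arrived(2)[of J x] by simp
        moreover have "expect J x (\<lambda>z. 1 - \<theta> * ?d z) = 1 - \<theta> * expect J x ?d"
          using int_d by simp
        ultimately show ?thesis
          by (subst integral_mult_right_zero) (simp only: Bochner_Integration.integral_add)
      qed
      also have "\<dots> \<le> f x * (1 - \<theta> * d / 2)"
      proof (rule mult_left_mono)
        have "d \<le> expect J x ?d"
          unfolding captures_drift[OF captures] d_def
          using Bochner_Integration.integral_nonneg[of "inputs J x" "waste J x"] waste_bounds(1) by simp
        then have "\<theta> * d \<le> \<theta> * expect J x ?d" using \<theta> by (intro mult_left_mono) auto
        moreover have "\<theta> * (\<theta> * D) \<le> \<theta> * (d / 2)" using \<theta>D \<theta> by (intro mult_left_mono) auto
        ultimately show "1 - \<theta> * expect J x ?d + \<theta>\<^sup>2 * D \<le> 1 - \<theta> * d / 2"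
          by (simp add: power2_eq_square mult.assoc)
      qed (use f(1)[of x] in simp)
      finally show ?thesis .
    qed
    have "expect J x (\<lambda>z. waste J x z + h' (step x z))
       = expect J x (\<lambda>z. (waste J x z + h (step x z)) + H * f (step x z))"
      by (simp add: h'_def algebra_simps)
    also have "\<dots> = expect J x (\<lambda>z. waste J x z + h (step x z)) + H * expect J x (\<lambda>z. f (step x z))"
      using int_w int_f by (subst Bochner_Integration.integral_add) auto
    also have "\<dots> \<le> expect J x (\<lambda>z. waste J x z + h (step x z)) + H * (f x * (1 - \<theta> * d / 2))"
      using H Ef by (intro add_left_mono mult_left_mono)
    also have "\<dots> = expect J x (\<lambda>z. waste J x z + h (step x z)) + H * f x - H * (\<theta> * d / 2 * f x)"
      by (simp add: algebra_simps)
    also have "\<dots> \<le> h' x + e"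
    proof (cases "R \<le> backlog J x")
      case True
      have "0 \<le> H * (\<theta> * d / 2 * f x)" using H \<theta> d f(1)[of x] by simp
      then show ?thesis using drift[OF True] unfolding h'_def by linarith
    next
      case False
      have "exp (- \<theta> * R) \<le> f x" unfolding f_def using False \<theta> by simp
      then have "\<eta> \<le> \<theta> * d / 2 * f x" unfolding \<eta>_def using \<theta> d by (intro mult_left_mono) auto
      then have "H * \<eta> \<le> H * (\<theta> * d / 2 * f x)" using H by (intro mult_left_mono)
      then have "cap + C \<le> H * (\<theta> * d / 2 * f x)" unfolding H(2) .
      then show ?thesis using waste_potential_le[of h C J x J x, OF h] h[of x] e unfolding h'_def by linarith
    qed
    finally show ?thesis .
  qed
  then show ?thesis using h' by blast
qed

lemma captures_step:
  assumes "captures J x" "z \<in> set_pmf (inputs J x)" shows "captures J (step x z)"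
  using captures_support[OF assms] by (simp add: captures_def step_def)

lemma waste_zero:
  assumes "idle (step x z) \<inter> J = {}" shows "waste J x z = 0"
  unfolding waste_def
proof (intro sum.neutral ballI)
  fix i assume "i \<in> J"
  then have "fst (step x z) i \<noteq> 0" using assms by (auto simp: idle_def)
  then show "real (snd (snd z) i - (fst x i + (if fst z = i then fst (snd z) else 0))) = 0"
    by (simp add: step_def next_queues_def split: if_splits)
qed

text \<open>
  As long as \<open>J\<close> does not get the arrivals, none of its servers is idle. Waste in \<open>J\<close> leaves
  an empty queue behind, so the first waste ends this period, and the constant \<open>cap + C\<close>
  covers that single slot and the potential after it.
\<close>
lemma potential_all_states:
  assumes h: "\<And>x. 0 \<le> h x \<and> h x \<le> C" and c: "0 \<le> c"
    and drift: "\<And>x. captures J x \<Longrightarrow> expect J x (\<lambda>z. waste J x z + h (step x z)) \<le> h x + c"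
  shows "\<exists>h' C'. \<forall>x. 0 \<le> h' x \<and> h' x \<le> C' \<and>
    expect J x (\<lambda>z. waste J x z + h' (step x z)) \<le> h' x + c"
proof -
  have C0: "0 \<le> C" using h order_trans by blast
  define h' where "h' x = (if captures J x then h x else cap + C)" for x
  have h': "0 \<le> h' x \<and> h' x \<le> cap + C" for x
  proof -
    have "0 \<le> h x" "h x \<le> cap + C" "0 \<le> cap + C" using h[of x] C0 cap_nonneg by linarith+
    then show ?thesis by (simp add: h'_def)
  qed
  have "expect J x (\<lambda>z. waste J x z + h' (step x z)) \<le> h' x + c" for x
  proof (cases "captures J x")
    case True
    have "expect J x (\<lambda>z. waste J x z + h' (step x z)) = expect J x (\<lambda>z. waste J x z + h (step x z))"
      by (intro integral_cong_AE AE_pmfI) (use captures_step[OF True] in \<open>auto simp: h'_def\<close>)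
    then show ?thesis using drift[OF True] True by (simp add: h'_def)
  next
    case False
    have "expect J x (\<lambda>z. waste J x z + h' (step x z)) \<le> expect J x (\<lambda>_. cap + C)"
    proof (rule expect_mono)
      show "integrable (inputs J x) (\<lambda>z. waste J x z + h' (step x z))"
        by (intro Bochner_Integration.integrable_add integrable_waste integrable_bounded_step[OF h'])
      fix z assume z: "z \<in> set_pmf (inputs J x)"
      show "waste J x z + h' (step x z) \<le> cap + C"
      proof (cases "captures J (step x z)")
        case True
        then show ?thesis using waste_bounds(2)[OF z] h unfolding h'_def by (simp add: add_mono)
      next
        case False
        then have "waste J x z = 0" by (intro waste_zero) (auto simp: captures_def)
        then show ?thesis using h'[of "step x z"] by simp
      qed
    qed simp
    then show ?thesis using False c by (simp add: h'_def)
  qed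
  then show ?thesis using h' by blast
qed

lemma serv_rate_remove:
  assumes "i \<in> J" shows "serv_rate (J - {i}) \<le> serv_rate J - 1"
proof -
  have "serv_rate J = measure_pmf.expectation (serv i) real + serv_rate (J - {i})"
    unfolding serv_rate_def by (rule sum.remove) (use assms in auto)
  then show ?thesis using serv_rate_singleton_ge[of i] by linarith
qed

text \<open>
  Removing a server only lowers \<open>max 0 (\<mu>(J) - \<lambda>)\<close>, so the potentials of the smaller sets are
  good enough for \<open>J\<close>. Each of the three constructions loses a part of \<open>e\<close>; quarters suffice.
\<close>
lemma waste_potential_exists:
  assumes "0 < e"
  shows "\<exists>h C. \<forall>x. 0 \<le> h x \<and> h x \<le> C \<and>
    expect J x (\<lambda>z. waste J x z + h (step x z)) \<le> h x + max 0 (serv_rate J - arr_rate) + e"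
  using assms
proof (induction "card J" arbitrary: J e rule: less_induct)
  case less
  show ?case
  proof (cases "J = {}")
    case True
    then have "\<forall>x. 0 \<le> (0::real) \<and> (0::real) \<le> 0 \<and> expect J x (\<lambda>z. waste J x z + 0) \<le> 0 + max 0 (serv_rate J - arr_rate) + e"
      using less.prems by (simp add: waste_def)
    then show ?thesis by (intro exI[of _ "\<lambda>_. 0"] exI[of _ 0])
  next
    case False
    let ?c = "max 0 (serv_rate J - arr_rate)"
    let ?e = "e / 4"
    have e: "0 < ?e" and e2: "0 < 2 * ?e" using less.prems by simp_all
    have "\<exists>h C. \<forall>x. 0 \<le> h x \<and> h x \<le> C \<and>
        expect (J - {i}) x (\<lambda>z. waste (J - {i}) x z + h (step x z)) \<le> h x + (?c + ?e)" if i: "i \<in> J" for i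
    proof -
      have "card (J - {i}) < card J" using i by (intro card_Diff1_less) auto
      from less.hyps[OF this e] obtain h C where h: "\<forall>x. 0 \<le> h x \<and> h x \<le> C \<and>
        expect (J - {i}) x (\<lambda>z. waste (J - {i}) x z + h (step x z)) \<le> h x + max 0 (serv_rate (J - {i}) - arr_rate) + ?e" by blast
      have "max 0 (serv_rate (J - {i}) - arr_rate) \<le> ?c" using serv_rate_remove[OF i] by simp
      then have "expect (J - {i}) x (\<lambda>z. waste (J - {i}) x z + h (step x z)) \<le> h x + (?c + ?e)" for x
        using spec[OF h, of x] by linarith
      then show ?thesis using h by blast
    qed
    note patch = patch_potentials[OF False _ e this]
    have "0 \<le> ?c + ?e" using e by simp
    from patch[OF this]
    obtain h C R where h: "\<And>x. 0 \<le> h x \<and> h x \<le> C"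
      and drift: "\<And>x. R \<le> backlog J x \<Longrightarrow> expect J x (\<lambda>z. waste J x z + h (step x z)) \<le> h x + (?c + ?e) + ?e"
      by blast
    have "\<exists>h' C'. (\<forall>x. 0 \<le> h' x \<and> h' x \<le> C') \<and>
      (\<forall>x. captures J x \<longrightarrow> expect J x (\<lambda>z. waste J x z + h' (step x z)) \<le> h' x + (?c + 4 * ?e))"
    proof (cases "arr_rate \<le> serv_rate J")
      case True
      have drift': "expect J x (\<lambda>z. waste J x z + h (step x z)) \<le> h x + (serv_rate J - arr_rate) + 2 * ?e" if "R \<le> backlog J x" for x
        using drift[OF that] True by simp
      have "\<exists>h' C'. (\<forall>x. 0 \<le> h' x \<and> h' x \<le> C') \<and>
          (\<forall>x. captures J x \<longrightarrow> expect J x (\<lambda>z. waste J x z + h' (step x z)) \<le> h' x + (serv_rate J - arr_rate) + 2 * (2 * ?e))"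
        by (rule potential_captures_underloaded[OF True e2 h drift'])
      then obtain h' C' where h': "\<forall>x. 0 \<le> h' x \<and> h' x \<le> C'"
        and d': "\<forall>x. captures J x \<longrightarrow> expect J x (\<lambda>z. waste J x z + h' (step x z)) \<le> h' x + (serv_rate J - arr_rate) + 2 * (2 * ?e)"
        by (elim exE conjE)
      have "\<forall>x. captures J x \<longrightarrow> expect J x (\<lambda>z. waste J x z + h' (step x z)) \<le> h' x + (?c + 4 * ?e)"
      proof (intro allI impI)
        fix x assume "captures J x"
        then show "expect J x (\<lambda>z. waste J x z + h' (step x z)) \<le> h' x + (?c + 4 * ?e)"
          using spec[OF d', of x] True by simp
      qed
      then show ?thesis using h' by blast
    next
      case False
      have drift': "expect J x (\<lambda>z. waste J x z + h (step x z)) \<le> h x + 2 * ?e" if "R \<le> backlog J x" for x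
        using drift[OF that] False by simp
      have less: "serv_rate J < arr_rate" using False by simp
      have "\<exists>h' C'. (\<forall>x. 0 \<le> h' x \<and> h' x \<le> C') \<and>
          (\<forall>x. captures J x \<longrightarrow> expect J x (\<lambda>z. waste J x z + h' (step x z)) \<le> h' x + 2 * ?e)"
        by (rule potential_captures_overloaded[OF less e2 h drift'])
      then obtain h' C' where h': "\<forall>x. 0 \<le> h' x \<and> h' x \<le> C'"
        and d': "\<forall>x. captures J x \<longrightarrow> expect J x (\<lambda>z. waste J x z + h' (step x z)) \<le> h' x + 2 * ?e"
        by (elim exE conjE)
      have "\<forall>x. captures J x \<longrightarrow> expect J x (\<lambda>z. waste J x z + h' (step x z)) \<le> h' x + (?c + 4 * ?e)"
      proof (intro allI impI)
        fix x assume "captures J x"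
        then show "expect J x (\<lambda>z. waste J x z + h' (step x z)) \<le> h' x + (?c + 4 * ?e)"
          using spec[OF d', of x] False e by simp
      qed
      then show ?thesis using h' by blast
    qed
    then obtain h' C' where h': "\<And>x. 0 \<le> h' x \<and> h' x \<le> C'"
      and d': "\<And>x. captures J x \<Longrightarrow> expect J x (\<lambda>z. waste J x z + h' (step x z)) \<le> h' x + (?c + 4 * ?e)"
      by blast
    have "0 \<le> ?c + 4 * ?e" using e by simp
    from potential_all_states[OF h' this d'] show ?thesis by (simp add: add.assoc)
  qed
qed

lemma finite_backlog_le: "finite {x :: 'n state. backlog UNIV x \<le> r}"
proof (rule finite_subset)
  show "{x :: 'n state. backlog UNIV x \<le> r} \<subseteq> PiE UNIV (\<lambda>_. {..nat \<lceil>r\<rceil>}) \<times> UNIV"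
  proof
    fix x :: "'n state" assume "x \<in> {x. backlog UNIV x \<le> r}"
    moreover have "real (fst x i) \<le> backlog UNIV x" for i
      unfolding backlog_def by (intro member_le_sum) auto
    ultimately have "real (fst x i) \<le> r" for i using order_trans by blast
    then have "fst x i \<le> nat \<lceil>r\<rceil>" for i by (metis real_nat_ceiling_ge of_nat_le_iff order_trans)
    then show "x \<in> PiE UNIV (\<lambda>_. {..nat \<lceil>r\<rceil>}) \<times> UNIV" by (cases x) auto
  qed
qed (intro finite_cartesian_product finite_PiE; simp)

text \<open>
  At large backlogs the waste is bounded by the potentials of the sets \<open>UNIV - {i}\<close>, that is, by
  about \<open>max 0 (\<mu>(UNIV) - \<mu> i - \<lambda>)\<close>. As \<open>\<mu> i \<ge> 1\<close>, this is smaller than \<open>\<mu>(UNIV) - \<lambda>\<close> by at least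
  \<open>\<delta> = min (\<mu>(UNIV) - \<lambda>) 1\<close>. Half of \<open>\<delta>\<close> is spent on errors, so \<open>g = T + h\<close> has drift at most
  \<open>- \<delta> / 2\<close> far out and its square has drift at most \<open>- \<delta> * g\<close> up to a constant; dividing \<open>g\<close> by
  \<open>\<delta>\<close> normalises this.
\<close>
lemma quadratic_drift:
  assumes load: "arr_rate < serv_rate UNIV"
  shows "\<exists>G b. (\<forall>x. 0 \<le> G x) \<and> (\<forall>r. finite {x. G x \<le> r}) \<and> 0 \<le> b \<and>
    (\<forall>x. integrable (inputs UNIV x) (\<lambda>z. (G (step x z))\<^sup>2) \<and>
         expect UNIV x (\<lambda>z. (G (step x z))\<^sup>2) + G x \<le> (G x)\<^sup>2 + b)"
proof -
  define \<delta> where "\<delta> = min (serv_rate UNIV - arr_rate) 1"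
  have \<delta>: "0 < \<delta>" using load by (simp add: \<delta>_def)
  let ?c = "serv_rate UNIV - arr_rate - 3 / 4 * \<delta>"
  have \<delta>_le: "\<delta> \<le> serv_rate UNIV - arr_rate" "\<delta> \<le> 1" by (simp_all add: \<delta>_def)
  have c: "0 \<le> ?c" using \<delta> \<delta>_le by linarith
  have e: "0 < \<delta> / 4" using \<delta> by simp
  have "\<exists>h C. \<forall>x. 0 \<le> h x \<and> h x \<le> C \<and>
      expect (UNIV - {i}) x (\<lambda>z. waste (UNIV - {i}) x z + h (step x z)) \<le> h x + ?c" for i
  proof -
    obtain h C where h: "\<forall>x. 0 \<le> h x \<and> h x \<le> C \<and>
      expect (UNIV - {i}) x (\<lambda>z. waste (UNIV - {i}) x z + h (step x z)) \<le> h x + max 0 (serv_rate (UNIV - {i}) - arr_rate) + \<delta> / 4"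
      using waste_potential_exists[OF e, of "UNIV - {i}"] by blast
    have "max 0 (serv_rate (UNIV - {i}) - arr_rate) + \<delta> / 4 \<le> ?c"
      using serv_rate_remove[of i UNIV] \<delta> \<delta>_le by (simp add: max_def)
    then have "expect (UNIV - {i}) x (\<lambda>z. waste (UNIV - {i}) x z + h (step x z)) \<le> h x + ?c" for x
      using spec[OF h, of x] by linarith
    then show ?thesis using h by blast
  qed
  from patch_potentials[OF _ c e this]
  obtain h C R where h: "\<And>x. 0 \<le> h x \<and> h x \<le> C"
    and drift: "\<And>x. R \<le> backlog UNIV x \<Longrightarrow> expect UNIV x (\<lambda>z. waste UNIV x z + h (step x z)) \<le> h x + ?c + \<delta> / 4"
    by blast
  have C0: "0 \<le> C" using h order_trans by blast
  define g where "g x = backlog UNIV x + h x" for x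
  have g0: "0 \<le> g x" for x using h by (simp add: g_def)
  define D where "D = 2 * arr_moment2 + 2 * (cap + C)\<^sup>2"
  have "0 \<le> arr_moment2" unfolding arr_moment2_def by (rule Bochner_Integration.integral_nonneg) simp
  then have D0: "0 \<le> D" by (simp add: D_def)
  define k where "k = 2 * ((\<bar>R\<bar> + C) * (cap + C + \<delta>)) + D"
  have k0: "D \<le> k" "0 \<le> k" using C0 D0 \<delta> by (auto simp: k_def)
  have main: "integrable (inputs UNIV x) (\<lambda>z. (g (step x z))\<^sup>2) \<and>
      expect UNIV x (\<lambda>z. (g (step x z))\<^sup>2) + \<delta> * g x \<le> (g x)\<^sup>2 + k" for x
  proof -
    have captures: "captures UNIV x" by (simp add: captures_def)
    let ?d = "\<lambda>z. g (step x z) - g x"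
    have d: "\<bar>?d z\<bar> \<le> arrived z + (cap + C)" if "z \<in> set_pmf (inputs UNIV x)" for z
      using backlog_step_diff[OF that, of UNIV x] h[of x] h[of "step x z"] by (auto simp: g_def)
    have d2: "(?d z)\<^sup>2 \<le> 2 * (arrived z)\<^sup>2 + 2 * (cap + C)\<^sup>2" if "z \<in> set_pmf (inputs UNIV x)" for z
    proof -
      have "(?d z)\<^sup>2 \<le> (arrived z + (cap + C))\<^sup>2" using d[OF that] by (simp add: abs_le_square_iff[symmetric])
      also have "\<dots> \<le> 2 * (arrived z)\<^sup>2 + 2 * (cap + C)\<^sup>2"
        using sum_squares_ge_zero[of "arrived z - (cap + C)" 0] by (simp add: power2_eq_square algebra_simps)
      finally show ?thesis .
    qed
    have int_d: "integrable (inputs UNIV x) ?d"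
      by (rule integrable_inputs[where ca="cap + C" and cb=1 and cc=0]) (use d in \<open>simp add: add.commute\<close>)
    have int_d2: "integrable (inputs UNIV x) (\<lambda>z. (?d z)\<^sup>2)"
      by (rule integrable_inputs[where ca="2 * (cap + C)\<^sup>2" and cb=0 and cc=2]) (use d2 in \<open>simp add: add.commute\<close>)
    have int_h: "integrable (inputs UNIV x) (\<lambda>z. h (step x z))"
      by (rule integrable_bounded_step[OF h])
    have int_T: "integrable (inputs UNIV x) (\<lambda>z. backlog UNIV (step x z) - backlog UNIV x)"
      by (rule integrable_inputs[where ca=cap and cb=1 and cc=0]) (use backlog_step_diff in \<open>simp add: add.commute\<close>)
    have Ed: "expect UNIV x ?d = arr_rate - serv_rate UNIV + expect UNIV x (\<lambda>z. waste UNIV x z + h (step x z)) - h x"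
    proof -
      have "expect UNIV x ?d = expect UNIV x (\<lambda>z. (backlog UNIV (step x z) - backlog UNIV x) + h (step x z) - h x)"
        by (simp add: g_def algebra_simps)
      also have "\<dots> = expect UNIV x (\<lambda>z. backlog UNIV (step x z) - backlog UNIV x) + expect UNIV x (\<lambda>z. h (step x z)) - h x"
        using int_T int_h by simp
      finally show ?thesis unfolding captures_drift[OF captures]
        using int_h integrable_waste[of UNIV x UNIV x] by simp
    qed
    have Ed2: "expect UNIV x (\<lambda>z. (?d z)\<^sup>2) \<le> D"
    proof -
      have "expect UNIV x (\<lambda>z. (?d z)\<^sup>2) \<le> expect UNIV x (\<lambda>z. 2 * (arrived z)\<^sup>2 + 2 * (cap + C)\<^sup>2)"
        using integrable_arrived(2)[of UNIV x] by (intro expect_mono int_d2 d2) auto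
      also have "\<dots> = D" using integrable_arrived(2)[of UNIV x] by (simp add: expect_arrived D_def)
      finally show ?thesis .
    qed
    have sq: "(g (step x z))\<^sup>2 = (g x)\<^sup>2 + 2 * g x * ?d z + (?d z)\<^sup>2" for z
      by (simp add: power2_eq_square algebra_simps)
    have int: "integrable (inputs UNIV x) (\<lambda>z. (g (step x z))\<^sup>2)"
      unfolding sq by (intro Bochner_Integration.integrable_add integrable_mult_right int_d int_d2) simp
    have "expect UNIV x (\<lambda>z. (g (step x z))\<^sup>2) = (g x)\<^sup>2 + 2 * (g x * expect UNIV x ?d) + expect UNIV x (\<lambda>z. (?d z)\<^sup>2)"
      unfolding sq using int_d int_d2 by simp
    moreover have "2 * (g x * expect UNIV x ?d) + \<delta> * g x \<le> k - D"
    proof (cases "R \<le> backlog UNIV x")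
      case True
      have "expect UNIV x ?d \<le> - (\<delta> / 2)" using drift[OF True] unfolding Ed by linarith
      then have "g x * expect UNIV x ?d \<le> g x * - (\<delta> / 2)" using g0 by (intro mult_left_mono)
      then have "2 * (g x * expect UNIV x ?d) + \<delta> * g x \<le> 0" by (simp add: mult.commute)
      then show ?thesis using k0 by linarith
    next
      case False
      have "expect UNIV x ?d + \<delta> / 2 \<le> cap + C + \<delta>"
        unfolding Ed using waste_potential_le[of h C UNIV x UNIV x, OF h] h[of x] load \<delta> by linarith
      moreover have "g x \<le> \<bar>R\<bar> + C" using False h[of x] unfolding g_def by linarith
      moreover have "0 \<le> cap + C + \<delta>" using C0 \<delta> cap_nonneg by linarith
      ultimately have "g x * (expect UNIV x ?d + \<delta> / 2) \<le> (\<bar>R\<bar> + C) * (cap + C + \<delta>)"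
        using g0[of x] by (intro order_trans[OF mult_left_mono mult_right_mono])
      then show ?thesis by (simp add: k_def algebra_simps)
    qed
    ultimately show ?thesis using int Ed2 by linarith
  qed
  define G where "G x = g x / \<delta>" for x
  have "finite {x. G x \<le> r}" for r
  proof (rule finite_subset[OF _ finite_backlog_le])
    show "{x. G x \<le> r} \<subseteq> {x. backlog UNIV x \<le> r * \<delta>}"
    proof
      fix x assume "x \<in> {x. G x \<le> r}"
      then have "g x \<le> r * \<delta>" using \<delta> by (simp add: G_def field_simps)
      then show "x \<in> {x. backlog UNIV x \<le> r * \<delta>}" using h[of x] unfolding g_def by simp
    qed
  qed
  moreover have "integrable (inputs UNIV x) (\<lambda>z. (G (step x z))\<^sup>2) \<and>
         expect UNIV x (\<lambda>z. (G (step x z))\<^sup>2) + G x \<le> (G x)\<^sup>2 + k / \<delta>\<^sup>2" for x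
  proof -
    have "(expect UNIV x (\<lambda>z. (g (step x z))\<^sup>2) + \<delta> * g x) / \<delta>\<^sup>2 \<le> ((g x)\<^sup>2 + k) / \<delta>\<^sup>2"
      using main[of x] by (intro divide_right_mono) auto
    then show ?thesis using main[of x] \<delta> 
      by (simp add: G_def power_divide add_divide_distrib power2_eq_square[of \<delta>])
  qed
  moreover have "0 \<le> G x" for x using g0[of x] \<delta> by (simp add: G_def)
  moreover have "0 \<le> k / \<delta>\<^sup>2" using k0 by simp
  ultimately show ?thesis by blast
qed

end

section \<open>Ergodicity of the Persistent-Idle kernel\<close>

context service_system begin

lemma PI_kernel_eq: "PI_kernel arr serv x = map_pmf (step x) (inputs UNIV x)"
proof -
  have r: "(if idle x = {} then return_pmf (snd x) else pmf_of_set (idle x)) = route UNIV x"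
    by (simp add: route_def)
  show ?thesis
    unfolding PI_kernel_def r inputs_def noise_def map_pmf_def pair_pmf_def bind_assoc_pmf bind_return_pmf step_def
    by simp
qed

lemma PI_drift:
  assumes load: "arr_rate < serv_rate UNIV"
  shows "\<exists>G b. (\<forall>x. 0 \<le> G x) \<and> (\<forall>r. finite {x. G x \<le> r}) \<and> 0 \<le> b \<and>
    (\<forall>x. (\<integral>\<^sup>+y. ennreal ((G y)\<^sup>2) \<partial>PI_kernel arr serv x) + ennreal (G x) \<le> ennreal ((G x)\<^sup>2) + ennreal b)"
proof -
  obtain G b where G: "\<forall>x. 0 \<le> G x" "\<forall>r. finite {x. G x \<le> r}" "0 \<le> b"
    and drift: "\<forall>x. integrable (inputs UNIV x) (\<lambda>z. (G (step x z))\<^sup>2) \<and>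
         expect UNIV x (\<lambda>z. (G (step x z))\<^sup>2) + G x \<le> (G x)\<^sup>2 + b"
    using quadratic_drift[OF load] by blast
  have "(\<integral>\<^sup>+y. ennreal ((G y)\<^sup>2) \<partial>PI_kernel arr serv x) + ennreal (G x) \<le> ennreal ((G x)\<^sup>2) + ennreal b" for x
  proof -
    have "(\<integral>\<^sup>+y. ennreal ((G y)\<^sup>2) \<partial>PI_kernel arr serv x) = ennreal (expect UNIV x (\<lambda>z. (G (step x z))\<^sup>2))"
      unfolding PI_kernel_eq nn_integral_map_pmf
      by (rule nn_integral_eq_integral) (use drift in blast, simp)
    also have "\<dots> + ennreal (G x) = ennreal (expect UNIV x (\<lambda>z. (G (step x z))\<^sup>2) + G x)"
      by (rule ennreal_plus[symmetric]) (simp, use G in blast)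
    also have "\<dots> \<le> ennreal ((G x)\<^sup>2 + b)" using drift by (intro ennreal_leI) blast
    also have "\<dots> = ennreal ((G x)\<^sup>2) + ennreal b" using G by (intro ennreal_plus) auto
    finally show ?thesis .
  qed
  then show ?thesis using G by blast
qed

text \<open>
  Without arrivals every queue shrinks, because each server offers at least one unit.
\<close>
lemma PI_kernel_no_arrival:
  assumes "0 \<in> set_pmf arr" and "l \<in> set_pmf (route UNIV x)"
  shows "\<exists>y\<in>set_pmf (PI_kernel arr serv x). snd y = l \<and> (\<forall>i. fst y i \<le> fst x i - 1)"
proof -
  obtain s where s: "s \<in> set_pmf (Pi_pmf UNIV 0 serv)" using set_pmf_not_empty by fast
  have z: "(l, 0, s) \<in> set_pmf (inputs UNIV x)" using assms s by (auto simp: inputs_def noise_def)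
  then have "step x (l, 0, s) \<in> set_pmf (PI_kernel arr serv x)" unfolding PI_kernel_eq by auto
  moreover have "1 \<le> s i" for i using offered_support(1)[OF z, of i] by simp
  then have "fst (step x (l, 0, s)) i \<le> fst x i - 1" for i
    by (simp add: step_def next_queues_def diff_le_mono2)
  moreover have "snd (step x (l, 0, s)) = l" by (simp add: step_def)
  ultimately show ?thesis by blast
qed

text \<open>
  In an empty system all servers are idle, so without arrivals each of them can be the next
  Last-Idle server.
\<close>
lemma empty_to_empty:
  assumes "0 \<in> set_pmf arr"
  shows "(\<lambda>_. 0, j) \<in> set_pmf (PI_kernel arr serv (\<lambda>_. 0, l))"
proof -
  have "j \<in> set_pmf (route UNIV (\<lambda>_. 0, l))" by (simp add: set_route idle_def)
  from PI_kernel_no_arrival[OF assms this] obtain y where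
    y: "y \<in> set_pmf (PI_kernel arr serv (\<lambda>_. 0, l))" "snd y = j" "\<forall>i. fst y i \<le> 0 - 1" by auto
  then have "fst y = (\<lambda>_. 0)" by auto
  then have "y = (\<lambda>_. 0, j)" using y(2) by (cases y) simp
  then show ?thesis using y(1) by simp
qed

lemma drains:
  assumes "0 \<in> set_pmf arr" and "\<And>i. fst x i \<le> n"
  shows "\<exists>l. (\<lambda>_. 0, l) \<in> set_pmf (steps (PI_kernel arr serv) n x)"
  using assms(2)
proof (induction n arbitrary: x)
  case 0
  then have "fst x = (\<lambda>_. 0)" by auto
  then have "x = (\<lambda>_. 0, snd x)" by (cases x) simp
  then show ?case by (metis set_return_pmf singletonI steps.simps(1))
next
  case (Suc n)
  obtain l where "l \<in> set_pmf (route UNIV x)" using set_pmf_not_empty by fast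
  from PI_kernel_no_arrival[OF assms(1) this] obtain y where
    y: "y \<in> set_pmf (PI_kernel arr serv x)" "\<forall>i. fst y i \<le> fst x i - 1" by blast
  have "fst y i \<le> n" for i using spec[OF y(2), of i] Suc.prems[of i] by linarith
  from Suc.IH[OF this] y(1) show ?case by auto
qed

lemma reaches_empty:
  assumes "0 \<in> set_pmf arr"
  shows "\<exists>m. \<forall>n\<ge>m. (\<lambda>_. 0, j) \<in> set_pmf (steps (PI_kernel arr serv) n x)"
proof (intro exI allI impI)
  fix n assume n: "Suc (\<Sum>i\<in>UNIV. fst x i) \<le> n"
  then obtain k where k: "n = k + 1" "(\<Sum>i\<in>UNIV. fst x i) \<le> k" by (cases n) auto
  have "fst x i \<le> k" for i
    using member_le_sum[of i UNIV "fst x"] k by simp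
  from drains[OF assms this] obtain l where "(\<lambda>_. 0, l) \<in> set_pmf (steps (PI_kernel arr serv) k x)" by blast
  then show "(\<lambda>_. 0, j) \<in> set_pmf (steps (PI_kernel arr serv) n x)"
    unfolding k(1) steps_add using empty_to_empty[OF assms, of j l]
    by (auto simp: bind_return_pmf')
qed

lemma PI_states_eq:
  "PI_states arr serv = {\<alpha>. \<exists>i t. \<alpha> \<in> set_pmf (steps (PI_kernel arr serv) t (\<lambda>_. 0, i))}"
proof -
  have "measure (markov_law (PI_kernel arr serv) x) {\<omega> \<in> space path_space. \<omega> t = \<alpha>} > 0 \<longleftrightarrow>
    \<alpha> \<in> set_pmf (steps (PI_kernel arr serv) t x)" for x \<alpha> t
  proof -
    have Q: "path_law (PI_kernel arr serv) x (markov_law (PI_kernel arr serv) x)"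
      by (rule path_law_markov_law)
    then have "sets (markov_law (PI_kernel arr serv) x) = sets path_space"
      by (simp add: path_law_def)
    then have "space (markov_law (PI_kernel arr serv) x) = space path_space"
      by (rule sets_eq_imp_space_eq)
    then have "emeasure (markov_law (PI_kernel arr serv) x) {\<omega> \<in> space path_space. \<omega> t = \<alpha>}
      = ennreal (pmf (steps (PI_kernel arr serv) t x) \<alpha>)"
      using emeasure_path_law_at[OF Q, of t "{\<alpha>}"] by (simp add: emeasure_pmf_single)
    then have "measure (markov_law (PI_kernel arr serv) x) {\<omega> \<in> space path_space. \<omega> t = \<alpha>}
      = pmf (steps (PI_kernel arr serv) t x) \<alpha>"
      by (simp add: measure_def)
    then show ?thesis by (simp add: pmf_positive_iff)
  qed
  then show ?thesis by (simp add: PI_states_def)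
qed

lemma PI_states_closed:
  assumes "x \<in> PI_states arr serv" shows "set_pmf (PI_kernel arr serv x) \<subseteq> PI_states arr serv"
proof
  fix y assume y: "y \<in> set_pmf (PI_kernel arr serv x)"
  obtain i t where x: "x \<in> set_pmf (steps (PI_kernel arr serv) t (\<lambda>_. 0, i))"
    using assms by (auto simp: PI_states_eq)
  have "y \<in> set_pmf (steps (PI_kernel arr serv) (t + 1) (\<lambda>_. 0, i))"
    unfolding steps_add using x y by (auto simp: bind_return_pmf')
  then show "y \<in> PI_states arr serv" unfolding PI_states_eq by blast
qed

lemma PI_states_from_empty:
  assumes "0 \<in> set_pmf arr" and "x \<in> PI_states arr serv"
  shows "\<exists>n. x \<in> set_pmf (steps (PI_kernel arr serv) n (\<lambda>_. 0, j))"
proof -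
  obtain i t where "x \<in> set_pmf (steps (PI_kernel arr serv) t (\<lambda>_. 0, i))"
    using assms by (auto simp: PI_states_eq)
  then have "x \<in> set_pmf (steps (PI_kernel arr serv) (Suc t) (\<lambda>_. 0, j))"
    using empty_to_empty[OF assms(1), of i j] by auto
  then show ?thesis by blast
qed

lemma empty_in_PI_states: "(\<lambda>_. 0, j) \<in> PI_states arr serv"
proof -
  have "(\<lambda>_. 0, j) \<in> set_pmf (steps (PI_kernel arr serv) 0 (\<lambda>_. 0, j))" by simp
  then show ?thesis unfolding PI_states_eq by blast
qed

lemma PI_ergodic:
  assumes zero: "0 \<in> set_pmf arr" and load: "arr_rate < serv_rate UNIV"
  defines "K \<equiv> PI_kernel arr serv" and "A \<equiv> PI_states arr serv"
  shows "\<forall>x\<in>A. (\<Sum>n. avoid K {x} n x) < \<infinity>"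
    and "\<exists>\<pi>. stationary K A \<pi> \<and> (\<forall>\<pi>'. stationary K A \<pi>' \<longrightarrow> \<pi>' = \<pi>) \<and>
      (\<forall>x\<in>A. \<forall>B. (\<lambda>n. measure (steps K n x) B) \<longlonglongrightarrow> measure \<pi> B)"
proof -
  obtain G b where G: "\<And>x. 0 \<le> G x" "\<And>r. finite {x. G x \<le> r}" "0 \<le> b"
    and drift: "\<And>x. (\<integral>\<^sup>+y. ennreal ((G y)\<^sup>2) \<partial>K x) + ennreal (G x) \<le> ennreal ((G x)\<^sup>2) + ennreal b"
    using PI_drift[OF load] unfolding K_def by blast
  let ?z = "(\<lambda>_. 0, undefined) :: 'n state"
  have closed: "set_pmf (K x) \<subseteq> A" if "x \<in> A" for x
    using PI_states_closed that unfolding K_def A_def .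
  have sq: "0 \<le> (G x)\<^sup>2" for x by simp
  have to_z: "\<exists>m. \<forall>n\<ge>m. ?z \<in> set_pmf (steps K n x)" for x
    unfolding K_def by (rule reaches_empty[OF zero])
  have from_z: "\<exists>n. x \<in> set_pmf (steps K n ?z)" if "x \<in> A" for x
    using PI_states_from_empty[OF zero] that unfolding K_def A_def .
  have z: "?z \<in> A" unfolding A_def by (rule empty_in_PI_states)
  note erg = ergodic_of_drift[of A K "\<lambda>x. (G x)\<^sup>2" G b ?z, OF closed sq G(1,3,2) drift to_z from_z z]
  show "\<forall>x\<in>A. (\<Sum>n. avoid K {x} n x) < \<infinity>" by (intro ballI erg(1))
  show "\<exists>\<pi>. stationary K A \<pi> \<and> (\<forall>\<pi>'. stationary K A \<pi>' \<longrightarrow> \<pi>' = \<pi>) \<and>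
      (\<forall>x\<in>A. \<forall>B. (\<lambda>n. measure (steps K n x) B) \<longlonglongrightarrow> measure \<pi> B)"
    by (rule erg(2))
qed

end

section \<open>The Markov property from the stochastic primitives\<close>

sublocale persistent_idle \<subseteq> service_system arr serv smax
  using arr_mean arr_variance serv_bounds by unfold_locales

context persistent_idle begin

abbreviation slot :: "nat \<Rightarrow> 'w \<Rightarrow> nat \<times> ('n \<Rightarrow> nat)" where
  "slot t \<omega> \<equiv> (a t \<omega>, \<lambda>i. s i t \<omega>)"

abbreviation past :: "nat \<Rightarrow> 'w \<Rightarrow> 'n state \<times> (nat \<times> ('n \<Rightarrow> nat)) list \<times> 'n list" where
  "past t \<omega> \<equiv> (X 0 \<omega>, map (\<lambda>u. slot u \<omega>) [1..<t], map (\<lambda>u. \<xi> u \<omega>) [1..<Suc t])"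

lemma measurable_slot: "1 \<le> t \<Longrightarrow> slot t \<in> measurable M (count_space UNIV)"
  using indep_slot unfolding indep_rv_def by blast

lemma measurable_past: "1 \<le> t \<Longrightarrow> past t \<in> measurable M (count_space UNIV)"
  using indep_slot unfolding indep_rv_def by blast

text \<open>
  The states before slot \<open>t\<close> involve only the initial state, the inputs before \<open>t\<close> and the random
  choices before \<open>t\<close>, so the inputs of slot \<open>t\<close>, which are independent of \<open>past t\<close>, are
  independent of the states before \<open>t\<close> jointly.
\<close>
lemma X_of_past:
  assumes "u < t" shows "\<exists>F. \<forall>\<omega>\<in>space M. X u \<omega> = F (past t \<omega>)"
  using assms
proof (induction u)
  case 0 then show ?case by (intro exI[of _ fst]) simp
next
  case (Suc u)
  then obtain F where F: "\<forall>\<omega>\<in>space M. X u \<omega> = F (past t \<omega>)" by auto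
  let ?F = "\<lambda>p. let x = F p; l = (if idle x = {} then snd x else snd (snd p) ! u)
     in (next_queues (fst x) (fst (fst (snd p) ! u)) (snd (fst (snd p) ! u)) l, l)"
  have "X (Suc u) \<omega> = ?F (past t \<omega>)" if "\<omega> \<in> space M" for \<omega>
    using recursion[of "Suc u" \<omega>] F Suc.prems that by (simp add: Let_def nth_append del: upt_Suc)
  then show ?case by (intro exI[of _ ?F]) blast
qed

lemma measurable_X [measurable]: "X u \<in> measurable M (count_space UNIV)"
proof -
  obtain F where F: "\<forall>\<omega>\<in>space M. X u \<omega> = F (past (Suc u) \<omega>)" using X_of_past[of u "Suc u"] by blast
  have "(\<lambda>\<omega>. F (past (Suc u) \<omega>)) \<in> measurable M (count_space UNIV)"
    by (rule measurable_compose[OF measurable_past]) auto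
  then show ?thesis using F by (simp cong: measurable_cong)
qed

lemma measurable_xi [measurable]: "1 \<le> t \<Longrightarrow> \<xi> t \<in> measurable M (count_space UNIV)"
proof -
  assume t: "1 \<le> t"
  have "(\<lambda>\<omega>. last (snd (snd (past t \<omega>)))) \<in> measurable M (count_space UNIV)"
    by (rule measurable_compose[OF measurable_past[OF t]]) auto
  moreover have "last (snd (snd (past t \<omega>))) = \<xi> t \<omega>" for \<omega> using t by (simp add: last_map)
  ultimately show ?thesis by simp
qed

lemma prob_slot:
  assumes t: "1 \<le> t"
  shows "prob {\<omega> \<in> space M. slot t \<omega> = v} = pmf noise v"
proof -
  let ?Y = "\<lambda>(c, t). case c of None \<Rightarrow> a t | Some i \<Rightarrow> s i t"
  let ?A = "\<lambda>(c, t :: nat). case c of None \<Rightarrow> {fst v} | Some i \<Rightarrow> {snd v i}"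
  let ?J = "(UNIV :: 'n option set) \<times> {t}"
  have meas: "?Y j \<in> measurable M (count_space UNIV)" if "j \<in> ?J" for j
    using indep_primitives that t unfolding indep_vars_def by auto
  have p: "prob (?Y (c, t) -` ?A (c, t) \<inter> space M) = (case c of None \<Rightarrow> pmf arr (fst v) | Some i \<Rightarrow> pmf (serv i) (snd v i))" for c
  proof (cases c)
    case None
    have "prob (a t -` {fst v} \<inter> space M) = measure (distr M (count_space UNIV) (a t)) {fst v}"
      using meas[of "(None, t)"] by (intro measure_distr[symmetric]) auto
    then show ?thesis using None law_a[OF t] by (simp add: measure_pmf_single)
  next
    case (Some i)
    have "prob (s i t -` {snd v i} \<inter> space M) = measure (distr M (count_space UNIV) (s i t)) {snd v i}"
      using meas[of "(Some i, t)"] by (intro measure_distr[symmetric]) auto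
    then show ?thesis using Some law_s[OF t] by (simp add: measure_pmf_single)
  qed
  have "{\<omega> \<in> space M. slot t \<omega> = v} = (\<Inter>j\<in>?J. ?Y j -` ?A j \<inter> space M)"
  proof -
    have "slot t \<omega> = v \<longleftrightarrow> (\<forall>c. ?Y (c, t) \<omega> \<in> ?A (c, t))" for \<omega>
      by (cases v) (auto simp: fun_eq_iff split: option.splits)
    then show ?thesis by auto
  qed
  also have "prob \<dots> = (\<Prod>j\<in>?J. prob (?Y j -` ?A j \<inter> space M))"
    by (rule indep_varsD[OF indep_primitives]) (use t in auto)
  also have "\<dots> = (\<Prod>c\<in>UNIV. prob (?Y (c, t) -` ?A (c, t) \<inter> space M))"
    by (rule prod.reindex_cong[of "\<lambda>c. (c, t)"]) (auto simp: inj_on_def)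
  also have "\<dots> = (\<Prod>c\<in>UNIV. case c of None \<Rightarrow> pmf arr (fst v) | Some i \<Rightarrow> pmf (serv i) (snd v i))"
    by (rule prod.cong[OF refl p])
  also have "\<dots> = pmf arr (fst v) * (\<Prod>i\<in>UNIV. pmf (serv i) (snd v i))"
    unfolding UNIV_option_conv by (subst prod.insert) (auto simp: prod.reindex)
  also have "\<dots> = pmf noise v"
    by (cases v) (simp add: noise_def pmf_pair pmf_Pi)
  finally show ?thesis .
qed

definition hist :: "nat \<Rightarrow> (nat \<Rightarrow> 'n state) \<Rightarrow> 'w set" where
  "hist n xs = {\<omega> \<in> space M. \<forall>i\<le>n. X i \<omega> = xs i}"

lemma hist_past: "\<exists>H. hist n xs = {\<omega> \<in> space M. past (Suc n) \<omega> \<in> H}"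
proof -
  have "\<forall>i. \<exists>F. i \<le> n \<longrightarrow> (\<forall>\<omega>\<in>space M. X i \<omega> = F (past (Suc n) \<omega>))"
    using X_of_past[of _ "Suc n"] by (auto simp: less_Suc_eq_le)
  from choice[OF this] obtain F where F: "\<forall>i. i \<le> n \<longrightarrow> (\<forall>\<omega>\<in>space M. X i \<omega> = F i (past (Suc n) \<omega>))" by (elim exE)
  have "hist n xs = {\<omega> \<in> space M. past (Suc n) \<omega> \<in> {p. \<forall>i\<le>n. F i p = xs i}}"
  proof -
    have "X i \<omega> = xs i \<longleftrightarrow> F i (past (Suc n) \<omega>) = xs i" if "i \<le> n" "\<omega> \<in> space M" for i \<omega>
      by (rule arg_cong[where f="\<lambda>v. v = xs i", OF F[rule_format, OF that]])
    then show ?thesis unfolding hist_def mem_Collect_eq by blast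
  qed
  then show ?thesis by blast
qed

lemma prob_hist_slot:
  "prob {\<omega> \<in> hist n xs. slot (Suc n) \<omega> = v} = prob (hist n xs) * pmf noise v"
proof -
  obtain H where H: "hist n xs = {\<omega> \<in> space M. past (Suc n) \<omega> \<in> H}" using hist_past by blast
  have ind: "indep_set (sets (vimage_algebra (space M) (slot (Suc n)) (count_space UNIV)))
      (sets (vimage_algebra (space M) (past (Suc n)) (count_space UNIV)))"
  proof -
    have "1 \<le> Suc n" by simp
    from indep_slot[OF this] show ?thesis unfolding indep_rv_def by (elim conjE)
  qed
  have "slot (Suc n) -` {v} \<inter> space M \<in> sets (vimage_algebra (space M) (slot (Suc n)) (count_space UNIV))"
    by (rule in_vimage_algebra) simp
  also have "slot (Suc n) -` {v} \<inter> space M = {\<omega> \<in> space M. slot (Suc n) \<omega> = v}" by blast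
  finally have 1: "{\<omega> \<in> space M. slot (Suc n) \<omega> = v} \<in> sets (vimage_algebra (space M) (slot (Suc n)) (count_space UNIV))" .
  have "past (Suc n) -` H \<inter> space M \<in> sets (vimage_algebra (space M) (past (Suc n)) (count_space UNIV))"
    by (rule in_vimage_algebra) simp
  also have "past (Suc n) -` H \<inter> space M = hist n xs" unfolding H by blast
  finally have 2: "hist n xs \<in> sets (vimage_algebra (space M) (past (Suc n)) (count_space UNIV))" .
  have "{\<omega> \<in> hist n xs. slot (Suc n) \<omega> = v} = {\<omega> \<in> space M. slot (Suc n) \<omega> = v} \<inter> hist n xs"
    by (auto simp: hist_def)
  then show ?thesis using indep_setD[OF ind 1 2] prob_slot[of "Suc n" v] by simp
qed

text \<open>
  The server chosen in slot \<open>Suc n\<close> together with the inputs of the slot, for a history that ends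
  in \<open>xs n\<close>. If no server is idle in \<open>xs n\<close>, the value of \<open>\<xi> (Suc n)\<close> is a mere convention and
  is replaced by the previous server.
\<close>
definition drive :: "nat \<Rightarrow> (nat \<Rightarrow> 'n state) \<Rightarrow> 'w \<Rightarrow> 'n \<times> nat \<times> ('n \<Rightarrow> nat)" where
  "drive n xs \<omega> = (if idle (xs n) = {} then snd (xs n) else \<xi> (Suc n) \<omega>, slot (Suc n) \<omega>)"

lemma sets_hist: "hist n xs \<in> sets M"
proof -
  have "hist n xs = (\<Inter>i\<in>{..n}. X i -` {xs i} \<inter> space M)" by (auto simp: hist_def)
  also have "\<dots> \<in> sets M" by (intro sets.finite_INT measurable_sets[OF measurable_X]) auto
  finally show ?thesis .
qed

lemma measurable_drive: "drive n xs \<in> measurable M (count_space UNIV)"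
proof -
  have t: "1 \<le> Suc n" by simp
  have "(\<lambda>\<omega>. (\<xi> (Suc n) \<omega>, slot (Suc n) \<omega>)) \<in> measurable M (count_space UNIV \<Otimes>\<^sub>M count_space UNIV)"
    by (rule measurable_Pair[OF measurable_xi[OF t] measurable_slot[OF t]])
  also have "(count_space UNIV \<Otimes>\<^sub>M count_space UNIV :: ('n \<times> nat \<times> ('n \<Rightarrow> nat)) measure) = count_space UNIV"
    by (subst pair_measure_countable) simp_all
  finally have m: "(\<lambda>\<omega>. (\<lambda>z. (if idle (xs n) = {} then snd (xs n) else fst z, snd z)) (\<xi> (Suc n) \<omega>, slot (Suc n) \<omega>))
      \<in> measurable M (count_space UNIV)"
    by (rule measurable_compose) simp
  have eq: "drive n xs = (\<lambda>\<omega>. (\<lambda>z. (if idle (xs n) = {} then snd (xs n) else fst z, snd z)) (\<xi> (Suc n) \<omega>, slot (Suc n) \<omega>))"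
    by (rule ext) (simp add: drive_def)
  show ?thesis unfolding eq by (rule m)
qed

text \<open>
  Given the history, the inputs of the slot have their product law by independence; given in
  addition these inputs, \<open>\<xi> (Suc n)\<close> is uniform on the idle servers.
\<close>
lemma prob_hist_drive:
  "prob {\<omega> \<in> hist n xs. drive n xs \<omega> = z} = prob (hist n xs) * pmf (inputs UNIV (xs n)) z"
proof -
  obtain l v where z: "z = (l, v)" by (cases z)
  have inputs: "pmf (inputs UNIV (xs n)) z = pmf (route UNIV (xs n)) l * pmf noise v"
    by (simp add: inputs_def z pmf_pair)
  show ?thesis
  proof (cases "idle (xs n) = {}")
    case True
    have "{\<omega> \<in> hist n xs. drive n xs \<omega> = z} = (if l = snd (xs n) then {\<omega> \<in> hist n xs. slot (Suc n) \<omega> = v} else {})"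
      using True by (auto simp: drive_def z)
    then show ?thesis using True prob_hist_slot[of n xs v] unfolding inputs
      by (auto simp: route_def pmf_return)
  next
    case False
    let ?ys = "map xs [0..<Suc n]"
    obtain av sv where v: "v = (av, sv)" by (cases v)
    have last: "last ?ys = xs n" by simp
    have hs: "{\<omega> \<in> hist n xs. slot (Suc n) \<omega> = v}
       = {\<omega> \<in> space M. (map (\<lambda>u. X u \<omega>) [0..<Suc n], a (Suc n) \<omega>, \<lambda>i. s i (Suc n) \<omega>) = (?ys, av, sv)}"
      unfolding hist_def v by (auto simp: less_Suc_eq_le simp del: upt_Suc)
    have hd: "{\<omega> \<in> hist n xs. drive n xs \<omega> = z}
       = {\<omega> \<in> space M. \<xi> (Suc n) \<omega> = l \<and> (map (\<lambda>u. X u \<omega>) [0..<Suc n], a (Suc n) \<omega>, \<lambda>i. s i (Suc n) \<omega>) = (?ys, av, sv)}"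
      unfolding hist_def z v using False by (auto simp: drive_def less_Suc_eq_le simp del: upt_Suc)
    have route: "route UNIV (xs n) = pmf_of_set (idle (xs n))" using False by (simp add: route_def)
    let ?p = "prob {\<omega> \<in> hist n xs. slot (Suc n) \<omega> = v}"
    have "prob {\<omega> \<in> hist n xs. drive n xs \<omega> = z} = ?p * pmf (route UNIV (xs n)) l"
    proof (cases "0 < ?p")
      case True
      then show ?thesis
        using xi_uniform[of "Suc n" ?ys av sv l] False
        unfolding cond_prob_def last route hs hd by (simp add: field_simps del: upt_Suc)
    next
      case False
      then have 0: "?p = 0" using measure_nonneg[of M] by (simp add: less_le)
      have "prob {\<omega> \<in> hist n xs. drive n xs \<omega> = z} \<le> ?p"
      proof (rule finite_measure_mono)
        show "{\<omega> \<in> hist n xs. drive n xs \<omega> = z} \<subseteq> {\<omega> \<in> hist n xs. slot (Suc n) \<omega> = v}"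
          by (auto simp: drive_def z)
        have "{\<omega> \<in> hist n xs. slot (Suc n) \<omega> = v} = hist n xs \<inter> (slot (Suc n) -` {v} \<inter> space M)"
          by (auto simp: hist_def)
        then show "{\<omega> \<in> hist n xs. slot (Suc n) \<omega> = v} \<in> sets M"
          using sets_hist measurable_sets[OF measurable_slot[of "Suc n"], of "{v}"] by simp
      qed
      then show ?thesis using 0 measure_nonneg[of M "{\<omega> \<in> hist n xs. drive n xs \<omega> = z}"] by simp
    qed
    then show ?thesis unfolding prob_hist_slot inputs by simp
  qed
qed

lemma hist_Suc: "hist (Suc n) xs = {\<omega> \<in> hist n xs. drive n xs \<omega> \<in> step (xs n) -` {xs (Suc n)}}"
proof -
  have "X (Suc n) \<omega> = step (xs n) (drive n xs \<omega>)" if "\<omega> \<in> hist n xs" for \<omega>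
    using recursion[of "Suc n" \<omega>] that by (simp add: hist_def step_def drive_def Let_def)
  then have "{\<omega> \<in> hist n xs. drive n xs \<omega> \<in> step (xs n) -` {xs (Suc n)}} = {\<omega> \<in> hist n xs. X (Suc n) \<omega> = xs (Suc n)}"
    by auto
  also have "\<dots> = hist (Suc n) xs" by (auto simp: hist_def le_Suc_eq)
  finally show ?thesis ..
qed

lemma emeasure_hist_Suc:
  "emeasure M (hist (Suc n) xs) = emeasure M (hist n xs) * ennreal (pmf (PI_kernel arr serv (xs n)) (xs (Suc n)))"
proof -
  let ?R = "step (xs n) -` {xs (Suc n)}"
  let ?p = "inputs UNIV (xs n)"
  have single: "{\<omega> \<in> hist n xs. drive n xs \<omega> = z} \<in> sets M" for z
  proof -
    have "{\<omega> \<in> hist n xs. drive n xs \<omega> = z} = hist n xs \<inter> (drive n xs -` {z} \<inter> space M)"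
      by (auto simp: hist_def)
    then show ?thesis using sets_hist measurable_sets[OF measurable_drive, of "{z}" n xs] by simp
  qed
  have "hist (Suc n) xs = (\<Union>z\<in>?R. {\<omega> \<in> hist n xs. drive n xs \<omega> = z})"
    unfolding hist_Suc by auto
  also have "emeasure M \<dots> = (\<integral>\<^sup>+z. emeasure M {\<omega> \<in> hist n xs. drive n xs \<omega> = z} \<partial>count_space ?R)"
    by (rule emeasure_UN_countable) (auto simp: single disjoint_family_on_def)
  also have "\<dots> = (\<integral>\<^sup>+z. emeasure M (hist n xs) * ennreal (pmf ?p z) \<partial>count_space ?R)"
    by (simp only: emeasure_eq_measure prob_hist_drive ennreal_mult[OF measure_nonneg pmf_nonneg])
  also have "\<dots> = emeasure M (hist n xs) * (\<integral>\<^sup>+z. ennreal (pmf ?p z) \<partial>count_space ?R)"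
    by (rule nn_integral_cmult) simp
  also have "(\<integral>\<^sup>+z. ennreal (pmf ?p z) \<partial>count_space ?R) = ennreal (pmf (PI_kernel arr serv (xs n)) (xs (Suc n)))"
    by (simp add: nn_integral_pmf PI_kernel_eq pmf_map measure_pmf.emeasure_eq_measure)
  finally show ?thesis .
qed

lemma emeasure_hist:
  "emeasure M (hist n xs) = emeasure M {\<omega> \<in> space M. X 0 \<omega> = xs 0} *
     (\<Prod>i<n. ennreal (pmf (PI_kernel arr serv (xs i)) (xs (Suc i))))"
proof (induction n)
  case 0 then show ?case by (simp add: hist_def)
next
  case (Suc n)
  then show ?case unfolding emeasure_hist_Suc by (simp add: mult.assoc)
qed

text \<open>
  Conditioning on the initial state cancels its probability from the cylinder formula; if this
  probability is zero, the started law is the canonical chain by definition.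
\<close>
lemma path_law_started_law:
  "path_law (PI_kernel arr serv) x (started_law M X (PI_kernel arr serv) x)"
proof (cases "0 < prob {\<omega> \<in> space M. X 0 \<omega> = x}")
  case False
  then show ?thesis by (simp add: started_law_def path_law_markov_law)
next
  case True
  let ?B = "{\<omega> \<in> space M. X 0 \<omega> = x}"
  let ?N = "uniform_measure M ?B"
  let ?path = "\<lambda>\<omega> t. X t \<omega>"
  have "?B = X 0 -` {x} \<inter> space M" by auto
  then have B: "?B \<in> sets M" using measurable_sets[OF measurable_X] by simp
  have pB: "emeasure M ?B \<noteq> 0" "emeasure M ?B \<noteq> \<top>" using True by (auto simp: emeasure_eq_measure)
  have eq: "started_law M X (PI_kernel arr serv) x = distr ?N path_space ?path"
    using True by (simp add: started_law_def)
  have path: "?path \<in> measurable M path_space"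
    by (rule measurable_PiM_single') auto
  then have path': "?path \<in> measurable ?N path_space" by simp
  have "emeasure (distr ?N path_space ?path) {\<omega> \<in> space path_space. \<forall>i\<le>n. \<omega> i = xs i} =
     (if xs 0 = x then \<Prod>i<n. ennreal (pmf (PI_kernel arr serv (xs i)) (xs (Suc i))) else 0)" for n xs
  proof -
    have "{\<omega> \<in> space path_space. \<forall>i\<le>n. \<omega> i = xs i} \<in> sets (path_space :: (nat \<Rightarrow> 'n state) measure)"
      by measurable
    then have "emeasure (distr ?N path_space ?path) {\<omega> \<in> space path_space. \<forall>i\<le>n. \<omega> i = xs i}
      = emeasure ?N (?path -` {\<omega> \<in> space path_space. \<forall>i\<le>n. \<omega> i = xs i} \<inter> space ?N)"
      by (rule emeasure_distr[OF path'])
    also have "?path -` {\<omega> \<in> space path_space. \<forall>i\<le>n. \<omega> i = xs i} \<inter> space ?N = hist n xs"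
      by (auto simp: hist_def space_PiM)
    also have "emeasure ?N (hist n xs) = emeasure M (?B \<inter> hist n xs) / emeasure M ?B"
      by (rule emeasure_uniform_measure[OF B sets_hist])
    also have "\<dots> = (if xs 0 = x then \<Prod>i<n. ennreal (pmf (PI_kernel arr serv (xs i)) (xs (Suc i))) else 0)"
    proof (cases "xs 0 = x")
      case True
      then have "?B \<inter> hist n xs = hist n xs" by (auto simp: hist_def)
      moreover have "emeasure M (hist n xs) =
          (\<Prod>i<n. ennreal (pmf (PI_kernel arr serv (xs i)) (xs (Suc i)))) * emeasure M ?B"
        unfolding emeasure_hist True by (rule mult.commute)
      ultimately show ?thesis
        using True by (simp only: mult_divide_eq_ennreal[OF pB] simp_thms if_True)
    next
      case False
      then have "?B \<inter> hist n xs = {}" by (auto simp: hist_def)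
      then show ?thesis using False by simp
    qed
    finally show ?thesis .
  qed
  then show ?thesis unfolding path_law_def eq by simp
qed

end

theorem theorem3p2:
  fixes M :: "'w measure" and arr :: "nat pmf" and serv :: "'n::finite \<Rightarrow> nat pmf"
    and smax :: nat and i1 :: 'n
    and a :: "nat \<Rightarrow> 'w \<Rightarrow> nat" and s :: "'n \<Rightarrow> nat \<Rightarrow> 'w \<Rightarrow> nat"
    and \<xi> :: "nat \<Rightarrow> 'w \<Rightarrow> 'n" and X :: "nat \<Rightarrow> 'w \<Rightarrow> 'n state"
  defines "K \<equiv> PI_kernel arr serv"
    and "A \<equiv> PI_states arr serv"
    and "P \<equiv> started_law M X (PI_kernel arr serv)"
  assumes system: "persistent_idle M arr serv smax i1 a s \<xi> X"
    and load: "measure_pmf.expectation arr real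
                 < (\<Sum>i\<in>UNIV. measure_pmf.expectation (serv i) real)"
  shows "positive_recurrent P A \<and>
    (\<exists>\<pi>. stationary K A \<pi> \<and> (\<forall>\<pi>'. stationary K A \<pi>' \<longrightarrow> \<pi>' = \<pi>) \<and>
      (\<forall>\<alpha>\<in>A. \<forall>B\<subseteq>A.
        (\<lambda>t. measure (P \<alpha>) {\<omega> \<in> space (P \<alpha>). \<omega> t \<in> B}) \<longlonglongrightarrow> measure_pmf.prob \<pi> B))"
proof -
  interpret persistent_idle M arr serv smax i1 a s \<xi> X by (rule system)
  have zero: "0 \<in> set_pmf arr" using arr_zero by (simp add: pmf_positive_iff)
  have load': "arr_rate < serv_rate UNIV" using load by (simp add: arr_rate_def serv_rate_def)
  have law: "path_law K \<alpha> (P \<alpha>)" for \<alpha>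
    unfolding P_def K_def by (rule path_law_started_law)
  have "positive_recurrent P A"
    using PI_ergodic(1)[OF zero load'] nn_integral_return_time[OF law]
    by (simp add: positive_recurrent_def A_def K_def)
  moreover have at: "measure (P \<alpha>) {\<omega> \<in> space (P \<alpha>). \<omega> t \<in> B} = measure (steps K t \<alpha>) B" for \<alpha> t B
    using emeasure_path_law_at[OF law, of \<alpha> t B] by (simp add: measure_def)
  obtain \<pi> where \<pi>: "stationary K A \<pi>" "\<forall>\<pi>'. stationary K A \<pi>' \<longrightarrow> \<pi>' = \<pi>"
      "\<forall>\<alpha>\<in>A. \<forall>B. (\<lambda>t. measure (steps K t \<alpha>) B) \<longlonglongrightarrow> measure \<pi> B"
    using PI_ergodic(2)[OF zero load'] unfolding K_def[symmetric] A_def[symmetric]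
    by (elim exE conjE)
  have "\<forall>\<alpha>\<in>A. \<forall>B\<subseteq>A.
      (\<lambda>t. measure (P \<alpha>) {\<omega> \<in> space (P \<alpha>). \<omega> t \<in> B}) \<longlonglongrightarrow> measure \<pi> B"
    unfolding at using \<pi>(3) by blast
  with \<pi>(1,2) have "\<exists>\<pi>. stationary K A \<pi> \<and> (\<forall>\<pi>'. stationary K A \<pi>' \<longrightarrow> \<pi>' = \<pi>) \<and>
      (\<forall>\<alpha>\<in>A. \<forall>B\<subseteq>A.
        (\<lambda>t. measure (P \<alpha>) {\<omega> \<in> space (P \<alpha>). \<omega> t \<in> B}) \<longlonglongrightarrow> measure \<pi> B)"
    by (intro exI[of _ \<pi>] conjI)
  ultimately show ?thesis ..
qed

end
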